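(* Let $T$ be simple, and let $p \in S(C)$ be a regular type. Then the following are equivalent: (1) $F_{Mb}(p) \leq n$. (2) $p$ has weakly $n$-degenerate dependence over $C$. (3) For every forking extension $q$ of $p$, the solution set of $q$ is covered by finitely many sets of the form $\mathrm{cl}_{p}(a_{0} \ldots a_{n-1})$, where $a_{0}, \ldots ,a_{n-1} \models p$.
   Context: $\mathrel{\perp\!\!\!\perp}$ denotes forking independence and $\mathrel{\not\perp\!\!\!\perp}$ its negation. For nonalgebraic $p \in S(C)$, $F_{Mb}(p)$ is the least $n$ such that for every $C$-indiscernible sequence $(a_i)_{i<\omega}$ of realizations of $p$ that is not a Morley sequence over $C$, $\mathrm{tp}(a_n/Ca_{<n})$ is a forking extension of $p$ ($\infty$ if none). $p \in S(C)$ has weakly $n$-degenerate dependence over $C$ if for $a \models p$ and $|C|^{+}$-saturated models $M \supset C$, if $a \mathrel{\not\perp\!\!\!\perp}_{C} p(M)$ then for some $B_{0} \subset p(M)$ with $|B_{0}| \leq n$, $a \mathrel{\not\perp\!\!\!\perp}_{C} B_{0}$. For the regular type $p$, $\mathrm{cl}_p(B)$ denotes the $p$-closure of $B$: the set of realizations $a$ of $p$ with $a \mathrel{\not\perp\!\!\!\perp}_C B$. *)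

theory Defs
  imports Main "HOL-Library.Extended_Nat"
begin

unbundle cardinal_syntax

section \<open>First-order structures\<close>

datatype 'f trm = Var nat | Fn 'f "'f trm list"

datatype ('f, 'r) fm =
    Eq "'f trm" "'f trm"
  | Rel 'r "'f trm list"
  | Neg "('f, 'r) fm"
  | Conj "('f, 'r) fm" "('f, 'r) fm"
  | Ex nat "('f, 'r) fm"

text \<open>A structure carries its language: a symbol is a name together with an arity, so that
  either kind of symbol may be absent.\<close>

record ('a, 'f, 'r) struct =
  univ :: "'a set"
  funs :: "('f \<times> nat) set"
  rels :: "('r \<times> nat) set"
  fint :: "'f \<Rightarrow> 'a list \<Rightarrow> 'a"
  rint :: "'r \<Rightarrow> 'a list \<Rightarrow> bool"

fun wf_trm :: "('a, 'f, 'r) struct \<Rightarrow> 'f trm \<Rightarrow> bool" where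
  "wf_trm M (Var i) = True"
| "wf_trm M (Fn f ts) = ((f, length ts) \<in> funs M \<and> (\<forall>t\<in>set ts. wf_trm M t))"

fun wf_fm :: "('a, 'f, 'r) struct \<Rightarrow> ('f, 'r) fm \<Rightarrow> bool" where
  "wf_fm M (Eq s t) = (wf_trm M s \<and> wf_trm M t)"
| "wf_fm M (Rel r ts) = ((r, length ts) \<in> rels M \<and> (\<forall>t\<in>set ts. wf_trm M t))"
| "wf_fm M (Neg \<phi>) = wf_fm M \<phi>"
| "wf_fm M (Conj \<phi> \<psi>) = (wf_fm M \<phi> \<and> wf_fm M \<psi>)"
| "wf_fm M (Ex x \<phi>) = wf_fm M \<phi>"

definition formulas :: "('a, 'f, 'r) struct \<Rightarrow> ('f, 'r) fm set" where
  "formulas M = {\<phi>. wf_fm M \<phi>}"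

fun fv_trm :: "'f trm \<Rightarrow> nat set" where
  "fv_trm (Var i) = {i}"
| "fv_trm (Fn f ts) = (\<Union>t\<in>set ts. fv_trm t)"

fun fv :: "('f, 'r) fm \<Rightarrow> nat set" where
  "fv (Eq s t) = fv_trm s \<union> fv_trm t"
| "fv (Rel r ts) = (\<Union>t\<in>set ts. fv_trm t)"
| "fv (Neg \<phi>) = fv \<phi>"
| "fv (Conj \<phi> \<psi>) = fv \<phi> \<union> fv \<psi>"
| "fv (Ex x \<phi>) = fv \<phi> - {x}"

fun eval_trm :: "('a, 'f, 'r) struct \<Rightarrow> (nat \<Rightarrow> 'a) \<Rightarrow> 'f trm \<Rightarrow> 'a" where
  "eval_trm M v (Var i) = v i"
| "eval_trm M v (Fn f ts) = fint M f (map (eval_trm M v) ts)"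

fun sat :: "('a, 'f, 'r) struct \<Rightarrow> (nat \<Rightarrow> 'a) \<Rightarrow> ('f, 'r) fm \<Rightarrow> bool" where
  "sat M v (Eq s t) = (eval_trm M v s = eval_trm M v t)"
| "sat M v (Rel r ts) = rint M r (map (eval_trm M v) ts)"
| "sat M v (Neg \<phi>) = (\<not> sat M v \<phi>)"
| "sat M v (Conj \<phi> \<psi>) = (sat M v \<phi> \<and> sat M v \<psi>)"
| "sat M v (Ex x \<phi>) = (\<exists>a\<in>univ M. sat M (v(x := a)) \<phi>)"

definition tuples :: "('a, 'f, 'r) struct \<Rightarrow> nat \<Rightarrow> 'a list set" where
  "tuples M k = {a. length a = k \<and> set a \<subseteq> univ M}"

definition is_structure :: "('a, 'f, 'r) struct \<Rightarrow> bool" where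
  "is_structure M \<longleftrightarrow> univ M \<noteq> {} \<and>
     (\<forall>(f, n)\<in>funs M. \<forall>a\<in>tuples M n. fint M f a \<in> univ M)"

definition elementary_submodel ::
    "('a, 'f, 'r) struct \<Rightarrow> ('a, 'f, 'r) struct \<Rightarrow> bool" where
  "elementary_submodel N M \<longleftrightarrow>
     (\<exists>U \<subseteq> univ M. N = M\<lparr>univ := U\<rparr>) \<and> is_structure N \<and>
     (\<forall>\<phi>\<in>formulas M. \<forall>v. range v \<subseteq> univ N \<longrightarrow> sat N v \<phi> = sat M v \<phi>)"

section \<open>Types\<close>

text \<open>A formula \<open>\<phi>(x, b)\<close> with parameters is the pair of \<open>\<phi>\<close> and the list \<open>b\<close>. In a context with
  \<open>k\<close> object variables these are \<open>0, \<dots>, k - 1\<close>, and the parameters are substituted for the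
  variables from \<open>k\<close> on.\<close>

definition pformulas ::
    "('a, 'f, 'r) struct \<Rightarrow> nat \<Rightarrow> 'a set \<Rightarrow> (('f, 'r) fm \<times> 'a list) set" where
  "pformulas M k C =
     {(\<phi>, b). \<phi> \<in> formulas M \<and> fv \<phi> \<subseteq> {..<k + length b} \<and> set b \<subseteq> C}"

definition holds :: "('a, 'f, 'r) struct \<Rightarrow> 'a list \<Rightarrow> ('f, 'r) fm \<times> 'a list \<Rightarrow> bool" where
  "holds M a \<delta> = sat M ((!) (a @ snd \<delta>)) (fst \<delta>)"

definition realizations ::
    "('a, 'f, 'r) struct \<Rightarrow> nat \<Rightarrow> (('f, 'r) fm \<times> 'a list) set \<Rightarrow> 'a list set" where
  "realizations M k q = {a \<in> tuples M k. \<forall>\<delta>\<in>q. holds M a \<delta>}"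

text \<open>\<open>S\<^sub>k(C)\<close>, the complete \<open>k\<close>-types over \<open>C\<close>.\<close>

definition types ::
    "('a, 'f, 'r) struct \<Rightarrow> nat \<Rightarrow> 'a set \<Rightarrow> (('f, 'r) fm \<times> 'a list) set set" where
  "types M k C = {p. p \<subseteq> pformulas M k C \<and>
     (\<forall>p\<^sub>0 \<subseteq> p. finite p\<^sub>0 \<longrightarrow> realizations M k p\<^sub>0 \<noteq> {}) \<and>
     (\<forall>(\<phi>, b)\<in>pformulas M k C. (\<phi>, b) \<in> p \<or> (Neg \<phi>, b) \<in> p)}"

definition tp ::
    "('a, 'f, 'r) struct \<Rightarrow> 'a list \<Rightarrow> 'a set \<Rightarrow> (('f, 'r) fm \<times> 'a list) set" where
  "tp M a C = {\<delta> \<in> pformulas M (length a) C. holds M a \<delta>}"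

definition nonalgebraic ::
    "('a, 'f, 'r) struct \<Rightarrow> nat \<Rightarrow> (('f, 'r) fm \<times> 'a list) set \<Rightarrow> bool" where
  "nonalgebraic M k p \<longleftrightarrow> (\<forall>\<delta>\<in>p. infinite (realizations M k {\<delta>}))"

section \<open>Saturation and the monster model\<close>

definition saturated :: "('a, 'f, 'r) struct \<Rightarrow> 'k rel \<Rightarrow> bool" where
  "saturated M \<kappa> \<longleftrightarrow>
     (\<forall>B \<subseteq> univ M. |B| <o \<kappa> \<longrightarrow> (\<forall>k. \<forall>q\<in>types M k B. realizations M k q \<noteq> {}))"

definition automorphism :: "('a, 'f, 'r) struct \<Rightarrow> ('a \<Rightarrow> 'a) \<Rightarrow> bool" where
  "automorphism M \<sigma> \<longleftrightarrow> bij_betw \<sigma> (univ M) (univ M) \<and>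
     (\<forall>(f, n)\<in>funs M. \<forall>a\<in>tuples M n. \<sigma> (fint M f a) = fint M f (map \<sigma> a)) \<and>
     (\<forall>(r, n)\<in>rels M. \<forall>a\<in>tuples M n. rint M r a = rint M r (map \<sigma> a))"

definition elementary_map :: "('a, 'f, 'r) struct \<Rightarrow> 'a set \<Rightarrow> ('a \<Rightarrow> 'a) \<Rightarrow> bool" where
  "elementary_map M B g \<longleftrightarrow> g ` B \<subseteq> univ M \<and>
     (\<forall>b. set b \<subseteq> B \<longrightarrow> tp M (map g b) {} = tp M b {})"

definition strongly_homogeneous :: "('a, 'f, 'r) struct \<Rightarrow> 'k rel \<Rightarrow> bool" where
  "strongly_homogeneous M \<kappa> \<longleftrightarrow>
     (\<forall>B \<subseteq> univ M. |B| <o \<kappa> \<longrightarrow> (\<forall>g. elementary_map M B g \<longrightarrow>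
        (\<exists>\<sigma>. automorphism M \<sigma> \<and> (\<forall>b\<in>B. \<sigma> b = g b))))"

text \<open>\<open>M\<close> is a monster model of its complete theory \<open>T = Th(M)\<close>, and sets of cardinality less than
  \<open>\<kappa>\<close> are small. The set \<open>formulas M\<close> is always infinite; its cardinality is \<open>|T|\<close>.
  As \<open>\<kappa>\<close> need not be a strong limit, statements about models over a set \<open>C\<close> also ask for
  \<open>2\<^bsup>|C| + |T|\<^esup> < \<kappa>\<close>, so that \<open>C\<close> lies in small \<open>|C|\<^sup>+\<close>-saturated models.\<close>

definition monster :: "('a, 'f, 'r) struct \<Rightarrow> 'k rel \<Rightarrow> bool" where
  "monster M \<kappa> \<longleftrightarrow> is_structure M \<and> Card_order \<kappa> \<and> |formulas M| <o \<kappa> \<and>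
     saturated M \<kappa> \<and> strongly_homogeneous M \<kappa>"

definition small :: "('a, 'f, 'r) struct \<Rightarrow> 'k rel \<Rightarrow> 'a set \<Rightarrow> bool" where
  "small M \<kappa> B \<longleftrightarrow> B \<subseteq> univ M \<and> |B| <o \<kappa>"

section \<open>Simplicity and forking\<close>

text \<open>The family \<open>\<phi>(x, b i)\<close>, \<open>i < \<omega>\<close>, is \<open>r\<close>-inconsistent.\<close>

definition inconsistent_family ::
    "('a, 'f, 'r) struct \<Rightarrow> nat \<Rightarrow> nat \<Rightarrow> ('f, 'r) fm \<Rightarrow> (nat \<Rightarrow> 'a list) \<Rightarrow> bool" where
  "inconsistent_family M k r \<phi> b \<longleftrightarrow>
     (\<forall>I. finite I \<and> card I = r \<longrightarrow> realizations M k ((\<lambda>i. (\<phi>, b i)) ` I) = {})"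

text \<open>The tree property of \<open>\<phi>(x, y)\<close> with \<open>k\<close> variables \<open>x\<close> and \<open>m\<close> variables \<open>y\<close>; the tree
  \<open>\<omega>\<^bsup><\<omega>\<^esup>\<close> is indexed by lists, and only its nonempty nodes matter.\<close>

definition tree_property ::
    "('a, 'f, 'r) struct \<Rightarrow> nat \<Rightarrow> nat \<Rightarrow> ('f, 'r) fm \<Rightarrow> bool" where
  "tree_property M k m \<phi> \<longleftrightarrow>
     (\<exists>r. \<exists>b :: nat list \<Rightarrow> 'a list. (\<forall>s. b s \<in> tuples M m) \<and>
        (\<forall>s. inconsistent_family M k r \<phi> (\<lambda>i. b (s @ [i]))) \<and>
        (\<forall>\<sigma> :: nat \<Rightarrow> nat. \<forall>N.
           realizations M k ((\<lambda>n. (\<phi>, b (map \<sigma> [0..<Suc n]))) ` {..<N}) \<noteq> {}))"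

text \<open>Simplicity of \<open>T = Th(M)\<close>, for a monster model \<open>M\<close>.\<close>

definition simple_theory :: "('a, 'f, 'r) struct \<Rightarrow> bool" where
  "simple_theory M \<longleftrightarrow>
     (\<forall>k m. \<forall>\<phi>\<in>formulas M. fv \<phi> \<subseteq> {..<k + m} \<longrightarrow> \<not> tree_property M k m \<phi>)"

definition divides ::
    "('a, 'f, 'r) struct \<Rightarrow> nat \<Rightarrow> 'a set \<Rightarrow> ('f, 'r) fm \<times> 'a list \<Rightarrow> bool" where
  "divides M k C \<delta> \<longleftrightarrow>
     (\<exists>r. \<exists>b :: nat \<Rightarrow> 'a list.
        (\<forall>i. b i \<in> tuples M (length (snd \<delta>)) \<and> tp M (b i) C = tp M (snd \<delta>) C) \<and>
        inconsistent_family M k r (fst \<delta>) b)"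

definition forks ::
    "('a, 'f, 'r) struct \<Rightarrow> nat \<Rightarrow> 'a set \<Rightarrow> (('f, 'r) fm \<times> 'a list) set \<Rightarrow> bool" where
  "forks M k C q \<longleftrightarrow>
     (\<exists>q\<^sub>0 \<Delta>. finite q\<^sub>0 \<and> q\<^sub>0 \<subseteq> q \<and> finite \<Delta> \<and> \<Delta> \<subseteq> pformulas M k (univ M) \<and>
        (\<forall>\<delta>\<in>\<Delta>. divides M k C \<delta>) \<and>
        realizations M k q\<^sub>0 \<subseteq> (\<Union>\<delta>\<in>\<Delta>. realizations M k {\<delta>}))"

definition indep :: "('a, 'f, 'r) struct \<Rightarrow> 'a list \<Rightarrow> 'a set \<Rightarrow> 'a set \<Rightarrow> bool" where
  "indep M a C B \<longleftrightarrow> \<not> forks M (length a) C (tp M a (C \<union> B))"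

definition forking_extension ::
    "('a, 'f, 'r) struct \<Rightarrow> nat \<Rightarrow> 'a set \<Rightarrow> (('f, 'r) fm \<times> 'a list) set \<Rightarrow>
     'a set \<Rightarrow> (('f, 'r) fm \<times> 'a list) set \<Rightarrow> bool" where
  "forking_extension M k C p D q \<longleftrightarrow>
     C \<subseteq> D \<and> q \<in> types M k D \<and> p \<subseteq> q \<and> forks M k C q"

section \<open>Regular types\<close>

definition orthogonal ::
    "('a, 'f, 'r) struct \<Rightarrow> 'k rel \<Rightarrow> nat \<Rightarrow> 'a set \<Rightarrow> (('f, 'r) fm \<times> 'a list) set \<Rightarrow>
     nat \<Rightarrow> 'a set \<Rightarrow> (('f, 'r) fm \<times> 'a list) set \<Rightarrow> bool" where
  "orthogonal M \<kappa> k A p m B q \<longleftrightarrow>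
     (\<forall>D a b. small M \<kappa> D \<and> A \<union> B \<subseteq> D \<and> a \<in> realizations M k p \<and> b \<in> realizations M m q \<and>
        indep M a A D \<and> indep M b B D \<longrightarrow> indep M a D (set b))"

definition regular_type ::
    "('a, 'f, 'r) struct \<Rightarrow> 'k rel \<Rightarrow> nat \<Rightarrow> 'a set \<Rightarrow> (('f, 'r) fm \<times> 'a list) set \<Rightarrow> bool" where
  "regular_type M \<kappa> k C p \<longleftrightarrow> nonalgebraic M k p \<and>
     (\<forall>B q. small M \<kappa> B \<and> forking_extension M k C p B q \<longrightarrow> orthogonal M \<kappa> k C p k B q)"

section \<open>Indiscernible sequences and degenerate dependence\<close>

definition indiscernible ::
    "('a, 'f, 'r) struct \<Rightarrow> 'a set \<Rightarrow> (nat \<Rightarrow> 'a list) \<Rightarrow> bool" where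
  "indiscernible M C a \<longleftrightarrow>
     (\<forall>is js. sorted_wrt (<) is \<and> sorted_wrt (<) js \<and> length is = length js \<longrightarrow>
        tp M (concat (map a is)) C = tp M (concat (map a js)) C)"

definition morley_sequence ::
    "('a, 'f, 'r) struct \<Rightarrow> 'a set \<Rightarrow> (nat \<Rightarrow> 'a list) \<Rightarrow> bool" where
  "morley_sequence M C a \<longleftrightarrow>
     indiscernible M C a \<and> (\<forall>i. indep M (a i) C (\<Union>j<i. set (a j)))"

definition F_Mb ::
    "('a, 'f, 'r) struct \<Rightarrow> nat \<Rightarrow> 'a set \<Rightarrow> (('f, 'r) fm \<times> 'a list) set \<Rightarrow> enat" where
  "F_Mb M k C p = Inf {enat n | n.
     \<forall>a :: nat \<Rightarrow> 'a list.
       (\<forall>i. a i \<in> realizations M k p) \<and> indiscernible M C a \<and> \<not> morley_sequence M C a \<longrightarrow>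
       forking_extension M k C p
         (C \<union> (\<Union>j<n. set (a j))) (tp M (a n) (C \<union> (\<Union>j<n. set (a j))))}"

text \<open>For finite \<open>C\<close>, \<open>|C|\<^sup>+\<close>-saturation is read as \<open>\<aleph>\<^sub>0\<close>-saturation, saturation being a notion for
  infinite cardinals: the cardinal sum below is the maximum of \<open>|C|\<^sup>+\<close> and \<open>\<aleph>\<^sub>0\<close>.\<close>

definition weakly_degenerate ::
    "('a, 'f, 'r) struct \<Rightarrow> 'k rel \<Rightarrow> nat \<Rightarrow> nat \<Rightarrow> 'a set \<Rightarrow>
     (('f, 'r) fm \<times> 'a list) set \<Rightarrow> bool" where
  "weakly_degenerate M \<kappa> n k C p \<longleftrightarrow>
     (\<forall>a\<in>realizations M k p. \<forall>N.
        elementary_submodel N M \<and> small M \<kappa> (univ N) \<and> C \<subseteq> univ N \<and>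
        saturated N (cardSuc |C| +c natLeq) \<and>
        \<not> indep M a C (\<Union>b\<in>realizations N k p. set b) \<longrightarrow>
        (\<exists>B\<^sub>0 \<subseteq> realizations N k p. finite B\<^sub>0 \<and> card B\<^sub>0 \<le> n \<and>
           \<not> indep M a C (\<Union>b\<in>B\<^sub>0. set b)))"

definition p_closure ::
    "('a, 'f, 'r) struct \<Rightarrow> nat \<Rightarrow> 'a set \<Rightarrow> (('f, 'r) fm \<times> 'a list) set \<Rightarrow>
     'a set \<Rightarrow> 'a list set" where
  "p_closure M k C p B = {a \<in> realizations M k p. \<not> indep M a C B}"

end

theory Submission
  imports Defs "HOL-Library.Ramsey" "HOL-Library.Countable_Set"
begin

text \<open>By Kim's theory of simple theories, forking equals dividing and independence is symmetric and
  transitive. Symmetry makes dependence of realizations of \<open>p\<close> an open condition, and Kim's lemma shows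
  that an independent sequence of conjugates of \<open>a\<close> over \<open>C d\<close> cannot exist when \<open>a\<close> depends on \<open>d\<close>.

  If \<open>a\<close> depends on \<open>d\<close> in a saturated \<open>N\<close>, realize in \<open>N\<close> successively the types of \<open>a\<close> over \<open>C d\<close> and
  the earlier elements. Were \<open>a\<close> independent of every \<open>n\<close> realizations of \<open>p\<close> in \<open>N\<close>, any \<open>n + 1\<close> members
  would be independent; this passes to an extracted indiscernible sequence, which is not Morley and so
  contradicts (1). The same sequence shows that every realization of a forking extension depends on
  \<open>p(N)\<close>, so (2) and compactness give the finite cover in (3). Given (3), infinitely many members of an
  indiscernible sequence that is not Morley lie in the closure of \<open>n\<close> elements, and since regularity makes
  \<open>p\<close>-closure a pregeometry, \<open>n + 1\<close> of them are dependent.\<close>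

section \<open>Formulas\<close>

text \<open>Formulas are used through the sets they define and types through orbits of
  automorphisms, so that changing parameters becomes moving sets. The obstacle is that
  \<open>saturated\<close> speaks of finitely many variables, while the arguments produce infinite
  sequences and trees; these are obtained as limits along ultrafilters. Simplicity enters as
  finiteness of a local rank: it shows that types do not fork over their base, and it proves Kim's
  lemma for sequences that are merely independent. The cardinal hypothesis
  \<open>|Pow (C <+> formulas M)| <o \<kappa>\<close> is spent in passing from (2) to (3), where the
  parameters witnessing that an extension forks must be put into a small saturated model. Its
  elements serve as parameters of the finite cover, so smallness is what makes compactness
  applicable.\<close>

lemma eval_trm_cong:
  "(\<And>i. i \<in> fv_trm t \<Longrightarrow> v i = w i) \<Longrightarrow> eval_trm M v t = eval_trm M w t"
proof (induction t)
  case (Fn f ts)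
  have "map (eval_trm M v) ts = map (eval_trm M w) ts"
    using Fn by auto
  then show ?case by (simp del: map_eq_conv)
qed simp

lemma sat_cong:
  "(\<And>i. i \<in> fv \<phi> \<Longrightarrow> v i = w i) \<Longrightarrow> sat M v \<phi> = sat M w \<phi>"
proof (induction \<phi> arbitrary: v w)
  case (Eq s t)
  then show ?case
    using eval_trm_cong[of s v w M] eval_trm_cong[of t v w M] by simp
next
  case (Rel r ts)
  have "map (eval_trm M v) ts = map (eval_trm M w) ts"
    using Rel by (auto intro!: eval_trm_cong)
  then show ?case by (simp del: map_eq_conv)
next
  case (Neg \<phi>)
  then show ?case by (metis fv.simps(3) sat.simps(3))
next
  case (Conj \<phi> \<psi>)
  then have "sat M v \<phi> = sat M w \<phi>" "sat M v \<psi> = sat M w \<psi>"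
    by (metis UnCI fv.simps(4))+
  then show ?case by simp
next
  case (Ex x \<phi>)
  have "sat M (v(x := a)) \<phi> = sat M (w(x := a)) \<phi>" for a
    by (rule Ex.IH) (use Ex.prems in auto)
  then show ?case by simp
qed

lemma finite_fv_trm: "finite (fv_trm t)"
  by (induction t) auto

lemma finite_fv: "finite (fv \<phi>)"
  by (induction \<phi>) (auto simp: finite_fv_trm)

lemma eval_trm_closed:
  assumes "is_structure M" "wf_trm M t" "range v \<subseteq> univ M"
  shows "eval_trm M v t \<in> univ M"
  using assms(2)
proof (induction t)
  case (Var i)
  then show ?case using assms(3) by auto
next
  case (Fn f ts)
  then have "map (eval_trm M v) ts \<in> tuples M (length ts)"
    by (auto simp: tuples_def)
  then show ?case
    using Fn.prems assms(1) unfolding is_structure_def by fastforce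
qed

section \<open>Renaming and identifying variables\<close>

primrec rename_trm :: "(nat \<Rightarrow> nat) \<Rightarrow> 'f trm \<Rightarrow> 'f trm" where
  "rename_trm g (Var i) = Var (g i)"
| "rename_trm g (Fn f ts) = Fn f (map (rename_trm g) ts)"

text \<open>Bound variables are renamed as well, so an injective \<open>g\<close> causes no capture;
  identification of variables is left to quantified equations.\<close>

primrec rename :: "(nat \<Rightarrow> nat) \<Rightarrow> ('f, 'r) fm \<Rightarrow> ('f, 'r) fm" where
  "rename g (Eq s t) = Eq (rename_trm g s) (rename_trm g t)"
| "rename g (Rel r ts) = Rel r (map (rename_trm g) ts)"
| "rename g (Neg \<phi>) = Neg (rename g \<phi>)"
| "rename g (Conj \<phi> \<psi>) = Conj (rename g \<phi>) (rename g \<psi>)"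
| "rename g (Ex x \<phi>) = Ex (g x) (rename g \<phi>)"

lemma wf_rename_trm: "wf_trm M (rename_trm g t) = wf_trm M t"
  by (induction t) auto

lemma wf_rename: "wf_fm M (rename g \<phi>) = wf_fm M \<phi>"
  by (induction \<phi>) (auto simp: wf_rename_trm)

lemma fv_rename_trm: "fv_trm (rename_trm g t) = g ` fv_trm t"
  by (induction t) auto

lemma fv_rename: "inj g \<Longrightarrow> fv (rename g \<phi>) = g ` fv \<phi>"
  by (induction \<phi>) (auto simp: fv_rename_trm inj_eq)

lemma eval_rename_trm: "eval_trm M v (rename_trm g t) = eval_trm M (v \<circ> g) t"
proof (induction t)
  case (Fn f ts)
  have "map (eval_trm M v) (map (rename_trm g) ts) = map (eval_trm M (v \<circ> g)) ts"
    using Fn by (auto simp: comp_def)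
  then show ?case by (simp add: comp_def del: map_eq_conv map_map)
qed simp

lemma sat_rename: "inj g \<Longrightarrow> sat M v (rename g \<phi>) = sat M (v \<circ> g) \<phi>"
proof (induction \<phi> arbitrary: v)
  case (Ex x \<phi>)
  have "(v(g x := a)) \<circ> g = (v \<circ> g)(x := a)" for a
    using Ex.prems by (auto simp: fun_eq_iff inj_eq)
  then show ?case using Ex.IH[OF Ex.prems] by (simp only: rename.simps sat.simps)
qed (auto simp: eval_rename_trm comp_def)

text \<open>Substitution that leaves the formula alone: each variable of \<open>S\<close> is
  quantified and equated with its target, and the targets avoid \<open>S\<close>. Values must lie in
  the universe because the quantifier ranges over it.\<close>

lemma sat_subst_vars:
  assumes "finite S" "\<forall>z\<in>S. g z \<notin> S" "wf_fm M \<phi>"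
  shows "\<exists>\<psi>. wf_fm M \<psi> \<and> fv \<psi> \<subseteq> (fv \<phi> - S) \<union> g ` S \<and>
    (\<forall>v. range v \<subseteq> univ M \<longrightarrow> sat M v \<psi> = sat M (\<lambda>i. if i \<in> S then v (g i) else v i) \<phi>)"
  using assms
proof (induction S rule: finite_induct)
  case empty
  then show ?case by (intro exI[of _ \<phi>]) simp
next
  case (insert x S)
  then obtain \<psi> where \<psi>: "wf_fm M \<psi>" "fv \<psi> \<subseteq> (fv \<phi> - S) \<union> g ` S"
    "\<And>v. range v \<subseteq> univ M \<Longrightarrow> sat M v \<psi> = sat M (\<lambda>i. if i \<in> S then v (g i) else v i) \<phi>"
    by auto
  let ?\<psi> = "Ex x (Conj (Eq (Var x) (Var (g x))) \<psi>)"
  have gx: "g x \<noteq> x" "\<And>z. z \<in> S \<Longrightarrow> g z \<noteq> x" using insert.prems by auto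
  have "sat M v ?\<psi> = sat M (\<lambda>i. if i \<in> insert x S then v (g i) else v i) \<phi>"
    if v: "range v \<subseteq> univ M" for v
  proof -
    have "sat M v ?\<psi> = sat M (v(x := v (g x))) \<psi>"
      using v gx by (auto simp: image_subset_iff)
    also have "\<dots> = sat M (\<lambda>i. if i \<in> S then (v(x := v (g x))) (g i) else (v(x := v (g x))) i) \<phi>"
      by (rule \<psi>(3)) (use v in auto)
    also have "(\<lambda>i. if i \<in> S then (v(x := v (g x))) (g i) else (v(x := v (g x))) i)
      = (\<lambda>i. if i \<in> insert x S then v (g i) else v i)"
      using gx insert.hyps by (auto simp: fun_eq_iff)
    finally show ?thesis .
  qed
  then show ?case using \<psi>(1,2) gx by (intro exI[of _ ?\<psi>]) auto
qed

text \<open>Shifting all variables out of the way first makes the identifications capture-free.\<close>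

lemma sat_reindex:
  assumes "wf_fm M \<phi>"
  shows "\<exists>\<psi>. wf_fm M \<psi> \<and> fv \<psi> \<subseteq> g ` fv \<phi> \<and>
    (\<forall>v. range v \<subseteq> univ M \<longrightarrow> sat M v \<psi> = sat M (v \<circ> g) \<phi>)"
proof -
  obtain K where K: "\<And>i. i \<in> fv \<phi> \<Longrightarrow> g i < K"
    using finite_nat_bounded[of "g ` fv \<phi>"] finite_fv[of \<phi>] by auto
  define \<phi>' where "\<phi>' = rename (\<lambda>i. i + K) \<phi>"
  have inj: "inj (\<lambda>i::nat. i + K)" by (simp add: inj_def)
  define S where "S = (\<lambda>i. i + K) ` fv \<phi>"
  have "\<exists>\<psi>. wf_fm M \<psi> \<and> fv \<psi> \<subseteq> (fv \<phi>' - S) \<union> (\<lambda>i. g (i - K)) ` S \<and>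
    (\<forall>v. range v \<subseteq> univ M \<longrightarrow>
      sat M v \<psi> = sat M (\<lambda>i. if i \<in> S then v (g (i - K)) else v i) \<phi>')"
    by (rule sat_subst_vars)
      (use K assms in \<open>fastforce simp: S_def finite_fv \<phi>'_def wf_rename\<close>)+
  then obtain \<psi> where \<psi>: "wf_fm M \<psi>" "fv \<psi> \<subseteq> (fv \<phi>' - S) \<union> (\<lambda>i. g (i - K)) ` S"
    "\<And>v. range v \<subseteq> univ M \<Longrightarrow>
      sat M v \<psi> = sat M (\<lambda>i. if i \<in> S then v (g (i - K)) else v i) \<phi>'"
    by blast
  have "sat M v \<psi> = sat M (v \<circ> g) \<phi>" if "range v \<subseteq> univ M" for v
    unfolding \<psi>(3)[OF that] \<phi>'_def sat_rename[OF inj]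
    by (rule sat_cong) (auto simp: S_def)
  moreover have "fv \<psi> \<subseteq> g ` fv \<phi>"
    using \<psi>(2) by (auto simp: \<phi>'_def fv_rename[OF inj] S_def)
  ultimately show ?thesis using \<psi>(1) by blast
qed

section \<open>Satisfaction under automorphisms\<close>

lemma eval_trm_automorphism:
  assumes "is_structure M" "automorphism M \<sigma>" "range v \<subseteq> univ M" "wf_trm M t"
  shows "eval_trm M (\<sigma> \<circ> v) t = \<sigma> (eval_trm M v t)"
  using assms(4)
proof (induction t)
  case (Var i)
  then show ?case by simp
next
  case (Fn f ts)
  let ?a = "map (eval_trm M v) ts"
  have "?a \<in> tuples M (length ts)"
    using Fn.prems eval_trm_closed[OF assms(1) _ assms(3)] by (auto simp: tuples_def)
  then have "\<sigma> (fint M f ?a) = fint M f (map \<sigma> ?a)"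
    using Fn.prems assms(2) unfolding automorphism_def by fastforce
  moreover have "map (eval_trm M (\<sigma> \<circ> v)) ts = map \<sigma> ?a"
    using Fn by (simp add: comp_def)
  ultimately show ?case by (simp add: comp_def del: map_map map_eq_conv)
qed

lemma sat_automorphism:
  assumes "is_structure M" "automorphism M \<sigma>" "range v \<subseteq> univ M" "wf_fm M \<phi>"
  shows "sat M (\<sigma> \<circ> v) \<phi> = sat M v \<phi>"
  using assms(3,4)
proof (induction \<phi> arbitrary: v)
  case (Eq s t)
  have "eval_trm M v s \<in> univ M" "eval_trm M v t \<in> univ M"
    using eval_trm_closed[OF assms(1)] Eq by auto
  moreover have "inj_on \<sigma> (univ M)" using assms(2) by (auto simp: automorphism_def bij_betw_def)
  ultimately show ?case
    using eval_trm_automorphism[OF assms(1,2) Eq(1)] Eq(2) by (simp add: inj_on_eq_iff comp_def)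
next
  case (Rel r ts)
  let ?a = "map (eval_trm M v) ts"
  have "?a \<in> tuples M (length ts)"
    using Rel eval_trm_closed[OF assms(1) _ Rel(1)] by (auto simp: tuples_def)
  then have "rint M r ?a = rint M r (map \<sigma> ?a)"
    using Rel assms(2) unfolding automorphism_def by fastforce
  moreover have "map (eval_trm M (\<sigma> \<circ> v)) ts = map \<sigma> ?a"
    using eval_trm_automorphism[OF assms(1,2) Rel(1)] Rel(2) by (simp add: comp_def)
  ultimately show ?case by (simp add: comp_def del: map_map map_eq_conv)
next
  case (Ex x \<phi>)
  have bij: "\<sigma> ` univ M = univ M" using assms(2) by (auto simp: automorphism_def bij_betw_def)
  have *: "sat M ((\<sigma> \<circ> v)(x := \<sigma> a)) \<phi> = sat M (v(x := a)) \<phi>" if "a \<in> univ M" for a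
  proof -
    have "(\<sigma> \<circ> v)(x := \<sigma> a) = \<sigma> \<circ> (v(x := a))" by (auto simp: fun_eq_iff)
    moreover have "sat M (\<sigma> \<circ> (v(x := a))) \<phi> = sat M (v(x := a)) \<phi>"
      by (rule Ex.IH) (use that Ex.prems in auto)
    ultimately show ?thesis by simp
  qed
  have "(\<exists>a\<in>univ M. sat M ((\<sigma> \<circ> v)(x := a)) \<phi>) = (\<exists>a\<in>univ M. sat M ((\<sigma> \<circ> v)(x := \<sigma> a)) \<phi>)"
    using bij by (metis (no_types, lifting) image_iff)
  then show ?case using * by (simp only: sat.simps) blast
qed auto

text \<open>Looking up a list beyond its length gives arbitrary values, whereas automorphisms and
  reindexing need assignments into the universe; values off the free variables may be
  repaired.\<close>

lemma total_assignment:
  assumes "is_structure M" "v ` S \<subseteq> univ M"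
  obtains w where "range w \<subseteq> univ M" "\<And>i. i \<in> S \<Longrightarrow> w i = v i"
proof -
  obtain u where "u \<in> univ M" using assms(1) by (auto simp: is_structure_def)
  then show thesis using assms(2) by (intro that[of "\<lambda>i. if i \<in> S then v i else u"]) auto
qed

lemma sat_automorphism_fv:
  assumes "is_structure M" "automorphism M \<sigma>" "v ` fv \<phi> \<subseteq> univ M" "wf_fm M \<phi>"
  shows "sat M (\<sigma> \<circ> v) \<phi> = sat M v \<phi>"
proof -
  obtain w where w: "range w \<subseteq> univ M" "\<And>i. i \<in> fv \<phi> \<Longrightarrow> w i = v i"
    using total_assignment[OF assms(1,3)] by metis
  have "sat M (\<sigma> \<circ> v) \<phi> = sat M (\<sigma> \<circ> w) \<phi>" by (rule sat_cong) (simp add: w)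
  also have "\<dots> = sat M w \<phi>" using sat_automorphism[OF assms(1,2) w(1) assms(4)] .
  also have "\<dots> = sat M v \<phi>" by (rule sat_cong) (simp add: w)
  finally show ?thesis .
qed

lemma sat_reindex_fv:
  assumes "is_structure M" "wf_fm M \<phi>"
  obtains \<psi> where "wf_fm M \<psi>" "fv \<psi> \<subseteq> g ` fv \<phi>"
    "\<And>v. v ` g ` fv \<phi> \<subseteq> univ M \<Longrightarrow> sat M v \<psi> = sat M (v \<circ> g) \<phi>"
proof -
  obtain \<psi> where \<psi>: "wf_fm M \<psi>" "fv \<psi> \<subseteq> g ` fv \<phi>"
    "\<And>v. range v \<subseteq> univ M \<Longrightarrow> sat M v \<psi> = sat M (v \<circ> g) \<phi>"
    using sat_reindex[OF assms(2)] by metis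
  have "sat M v \<psi> = sat M (v \<circ> g) \<phi>" if "v ` g ` fv \<phi> \<subseteq> univ M" for v
  proof -
    obtain w where w: "range w \<subseteq> univ M" "\<And>i. i \<in> g ` fv \<phi> \<Longrightarrow> w i = v i"
      using total_assignment[OF assms(1) \<open>v ` g ` fv \<phi> \<subseteq> univ M\<close>] by metis
    have "sat M v \<psi> = sat M w \<psi>" by (rule sat_cong) (use w \<psi>(2) in auto)
    also have "\<dots> = sat M (w \<circ> g) \<phi>" by (rule \<psi>(3)[OF w(1)])
    also have "\<dots> = sat M (v \<circ> g) \<phi>" by (rule sat_cong) (simp add: w)
    finally show ?thesis .
  qed
  then show thesis using \<psi>(1,2) that by blast
qed

section \<open>Definable sets of tuples\<close>

lemma in_tuples: "a \<in> tuples M k \<longleftrightarrow> length a = k \<and> set a \<subseteq> univ M"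
  by (simp add: tuples_def)

lemma append_in_tuples:
  "length a = k \<Longrightarrow> a @ b \<in> tuples M (k + m) \<longleftrightarrow> a \<in> tuples M k \<and> b \<in> tuples M m"
  by (auto simp: tuples_def)

lemma in_tuples_add_cases:
  assumes "c \<in> tuples M (k + m)"
  obtains a b where "c = a @ b" "a \<in> tuples M k" "b \<in> tuples M m"
proof
  show "c = take k c @ drop k c" by simp
  show "take k c \<in> tuples M k" "drop k c \<in> tuples M m"
    using assms set_take_subset[of k c] set_drop_subset[of k c] by (auto simp: tuples_def)
qed

lemma map_nth_in_tuples:
  "\<lbrakk>x \<in> tuples M k; \<And>i. i < m \<Longrightarrow> g i < k\<rbrakk> \<Longrightarrow> map (\<lambda>i. x ! g i) [0..<m] \<in> tuples M m"
  by (force simp: tuples_def)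

text \<open>From here on the set stands for the formula: closure properties replace syntactic
  constructions, and a complete type over \<open>B\<close> is the family of
  \<open>B\<close>-definable sets containing a tuple.\<close>

definition definable :: "('a, 'f, 'r) struct \<Rightarrow> nat \<Rightarrow> 'a set \<Rightarrow> 'a list set \<Rightarrow> bool" where
  "definable M k B X \<longleftrightarrow> (\<exists>\<delta>\<in>pformulas M k B. X = realizations M k {\<delta>})"

lemma definable_subset_tuples: "definable M k B X \<Longrightarrow> X \<subseteq> tuples M k"
  by (auto simp: definable_def realizations_def)

lemma definable_mono: "definable M k B X \<Longrightarrow> B \<subseteq> B' \<Longrightarrow> definable M k B' X"
  unfolding definable_def pformulas_def by blast

lemma definable_finite_support:
  assumes "definable M k (A \<union> B) X"
  obtains b where "set b \<subseteq> B" "definable M k (A \<union> set b) X"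
proof -
  obtain \<phi> c where \<delta>: "(\<phi>, c) \<in> pformulas M k (A \<union> B)" "X = realizations M k {(\<phi>, c)}"
    using assms by (auto simp: definable_def)
  have "(\<phi>, c) \<in> pformulas M k (A \<union> set (filter (\<lambda>x. x \<in> B) c))"
    using \<delta>(1) by (auto simp: pformulas_def)
  then show thesis
    using \<delta>(2) by (intro that[of "filter (\<lambda>x. x \<in> B) c"]) (auto simp: definable_def)
qed

text \<open>Each variable is read as a coordinate of the tuple (\<open>Inl\<close>) or as a constant
  parameter (\<open>Inr\<close>). This frees the closure proofs from the fixed layout of
  \<open>pformulas\<close>, in which coordinates precede parameters.\<close>

definition assignment :: "(nat \<Rightarrow> nat + 'a) \<Rightarrow> 'a list \<Rightarrow> nat \<Rightarrow> 'a" where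
  "assignment s x i = (case s i of Inl j \<Rightarrow> x ! j | Inr c \<Rightarrow> c)"

definition admissible :: "nat \<Rightarrow> 'a set \<Rightarrow> ('f, 'r) fm \<Rightarrow> (nat \<Rightarrow> nat + 'a) \<Rightarrow> bool" where
  "admissible k B \<phi> s \<longleftrightarrow> (\<forall>i\<in>fv \<phi>. case s i of Inl j \<Rightarrow> j < k | Inr c \<Rightarrow> c \<in> B)"

lemma definableE:
  assumes "definable M k B X"
  obtains \<phi> s where "wf_fm M \<phi>" "admissible k B \<phi> s"
    "\<And>x. x \<in> tuples M k \<Longrightarrow> x \<in> X \<longleftrightarrow> sat M (assignment s x) \<phi>"
proof -
  obtain \<phi> b where \<delta>: "(\<phi>, b) \<in> pformulas M k B" "X = realizations M k {(\<phi>, b)}"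
    using assms by (auto simp: definable_def)
  define s where "s = (\<lambda>i. if i < k then Inl i else Inr (b ! (i - k)))"
  have "admissible k B \<phi> s"
    using \<delta>(1) by (force simp: admissible_def s_def pformulas_def)
  moreover have "x \<in> X \<longleftrightarrow> sat M (assignment s x) \<phi>" if "x \<in> tuples M k" for x
  proof -
    have "sat M ((!) (x @ b)) \<phi> = sat M (assignment s x) \<phi>"
      by (rule sat_cong) (use that in \<open>auto simp: assignment_def s_def nth_append tuples_def\<close>)
    then show ?thesis using that by (simp add: \<delta>(2) realizations_def holds_def)
  qed
  ultimately show thesis using \<delta>(1) that by (auto simp: pformulas_def formulas_def)
qed

lemma list_index:
  obtains ix :: "'x \<Rightarrow> nat" where "\<And>c. c \<in> set b \<Longrightarrow> ix c < length b \<and> b ! ix c = c"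
proof -
  have "\<forall>c\<in>set b. \<exists>j. j < length b \<and> b ! j = c" by (simp add: in_set_conv_nth)
  then have "\<exists>ix. \<forall>c\<in>set b. ix c < length b \<and> b ! ix c = c" by (rule bchoice)
  then show thesis using that by auto
qed

locale monster_model =
  fixes M :: "('a, 'f, 'r) struct" and \<kappa> :: "'k rel"
  assumes monster: "monster M \<kappa>"
begin

abbreviation "U \<equiv> univ M"
abbreviation "tups \<equiv> tuples M"
abbreviation "dfn \<equiv> definable M"

lemma is_struct: "is_structure M"
  using monster by (simp add: monster_def)

text \<open>The way back to the layout of \<open>pformulas\<close>: the finitely many parameters
  that occur are listed after the \<open>k\<close> coordinates, and reindexing sends every variable
  to its place.\<close>

lemma definableI:
  assumes "wf_fm M \<phi>" "admissible k B \<phi> s" "B \<subseteq> U"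
    "X = {x \<in> tups k. sat M (assignment s x) \<phi>}"
  shows "dfn k B X"
proof -
  have "finite {c \<in> B. \<exists>i\<in>fv \<phi>. s i = Inr c}"
    by (rule finite_subset[of _ "(\<lambda>i. projr (s i)) ` fv \<phi>"])
      (force simp: finite_fv)+
  then obtain b where b: "set b = {c \<in> B. \<exists>i\<in>fv \<phi>. s i = Inr c}" by (meson finite_list)
  obtain ix where ix: "\<And>c. c \<in> set b \<Longrightarrow> ix c < length b \<and> b ! ix c = c"
    using list_index by blast
  define g where "g i = (case s i of Inl j \<Rightarrow> j | Inr c \<Rightarrow> k + ix c)" for i
  have g: "g i < k + length b" "x \<in> tups k \<Longrightarrow> (x @ b) ! g i = assignment s x i"
    if "i \<in> fv \<phi>" for i x
  proof -
    have "case s i of Inl j \<Rightarrow> j < k | Inr c \<Rightarrow> c \<in> set b"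
      using that assms(2) by (auto simp: admissible_def b split: sum.splits)
    then show "g i < k + length b" "x \<in> tups k \<Longrightarrow> (x @ b) ! g i = assignment s x i"
      using ix by (auto simp: g_def assignment_def nth_append tuples_def split: sum.splits)
  qed
  obtain \<psi> where \<psi>: "wf_fm M \<psi>" "fv \<psi> \<subseteq> g ` fv \<phi>"
    "\<And>v. v ` g ` fv \<phi> \<subseteq> univ M \<Longrightarrow> sat M v \<psi> = sat M (v \<circ> g) \<phi>"
    using sat_reindex_fv[OF is_struct assms(1)] by metis
  have "(\<psi>, b) \<in> pformulas M k B"
    using \<psi>(1,2) g b by (auto simp: pformulas_def formulas_def)
  moreover have "holds M x (\<psi>, b) = sat M (assignment s x) \<phi>" if x: "x \<in> tups k" for x
  proof -
    have "set (x @ b) \<subseteq> U" "length (x @ b) = k + length b"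
      using x b assms(3) by (auto simp: tuples_def)
    then have "(x @ b) ! j \<in> U" if "j < k + length b" for j
      using that nth_mem[of j "x @ b"] by auto
    then have "(!) (x @ b) ` g ` fv \<phi> \<subseteq> U" using g(1) by blast
    then have "sat M ((!) (x @ b)) \<psi> = sat M ((!) (x @ b) \<circ> g) \<phi>" by (rule \<psi>(3))
    also have "\<dots> = sat M (assignment s x) \<phi>"
      by (rule sat_cong) (use g x in simp)
    finally show ?thesis by (simp add: holds_def)
  qed
  ultimately show ?thesis
    unfolding definable_def assms(4) realizations_def by (intro bexI[of _ "(\<psi>, b)"]) auto
qed

lemma definable_tuples: "dfn k {} (tups k)"
\<comment> \<open>A sentence is chosen since for \<open>k = 0\<close> no free variable could be read
  as a coordinate.\<close>
proof (rule definableI[of "Ex 0 (Eq (Var 0) (Var 0))" _ _ "\<lambda>i. Inl i"])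
  show "tups k = {x \<in> tups k. sat M (assignment (\<lambda>i. Inl i) x) (Ex 0 (Eq (Var 0) (Var 0)))}"
    using is_struct by (auto simp: is_structure_def)
qed (auto simp: admissible_def)

lemma definable_complement:
  assumes "dfn k B X" "B \<subseteq> U"
  shows "dfn k B (tups k - X)"
proof -
  obtain \<phi> s where "wf_fm M \<phi>" "admissible k B \<phi> s"
    "\<And>x. x \<in> tups k \<Longrightarrow> x \<in> X \<longleftrightarrow> sat M (assignment s x) \<phi>"
    using definableE[OF assms(1)] by metis
  then show ?thesis
    using assms(2) by (intro definableI[of "Neg \<phi>" _ _ s]) (auto simp: admissible_def)
qed

lemma definable_Int:
  assumes "dfn k B X" "dfn k B Y" "B \<subseteq> U"
  shows "dfn k B (X \<inter> Y)"
proof -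
  obtain \<phi> s where \<phi>: "wf_fm M \<phi>" "admissible k B \<phi> s"
    "\<And>x. x \<in> tups k \<Longrightarrow> x \<in> X \<longleftrightarrow> sat M (assignment s x) \<phi>"
    using definableE[OF assms(1)] by metis
  obtain \<psi> t where \<psi>: "wf_fm M \<psi>" "admissible k B \<psi> t"
    "\<And>x. x \<in> tups k \<Longrightarrow> x \<in> Y \<longleftrightarrow> sat M (assignment t x) \<psi>"
    using definableE[OF assms(2)] by metis
  \<comment> \<open>Even variables carry one formula and odd variables the other, so that the two
    readings \<open>s\<close> and \<open>t\<close> coexist.\<close>
  have inj: "inj (\<lambda>i::nat. 2 * i)" "inj (\<lambda>i::nat. 2 * i + 1)" by (auto simp: inj_def)
  define u where "u i = (if even i then s (i div 2) else t (i div 2))" for i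
  have u: "assignment u x \<circ> (\<lambda>i. 2 * i) = assignment s x"
    "assignment u x \<circ> (\<lambda>i. 2 * i + 1) = assignment t x" for x
    by (auto simp: assignment_def u_def fun_eq_iff)
  let ?\<chi> = "Conj (rename (\<lambda>i. 2 * i) \<phi>) (rename (\<lambda>i. 2 * i + 1) \<psi>)"
  show ?thesis
  proof (rule definableI[of ?\<chi> _ _ u])
    show "admissible k B ?\<chi> u"
      using \<phi>(2) \<psi>(2) by (auto simp: admissible_def fv_rename[OF inj(1)]
        fv_rename[OF inj(2), simplified] u_def)
    show "X \<inter> Y = {x \<in> tups k. sat M (assignment u x) ?\<chi>}"
      using \<phi>(3) \<psi>(3) definable_subset_tuples[OF assms(1)]
      by (auto simp: sat_rename[OF inj(1)] sat_rename[OF inj(2)] u simp del: One_nat_def)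
  qed (use \<phi>(1) \<psi>(1) assms(3) in \<open>auto simp: wf_rename\<close>)
qed

lemma definable_INT:
  assumes "finite I" "\<And>i. i \<in> I \<Longrightarrow> dfn k B (X i)" "B \<subseteq> U"
  shows "dfn k B (tups k \<inter> (\<Inter>i\<in>I. X i))"
  using assms(1,2)
proof (induction I rule: finite_induct)
  case empty
  then show ?case using definable_mono[OF definable_tuples] by simp
next
  case (insert i I)
  then have "dfn k B (X i \<inter> (tups k \<inter> (\<Inter>i\<in>I. X i)))"
    using assms(3) definable_Int by simp
  then show ?case by (simp add: Int_left_commute)
qed

lemma definable_reindex:
  assumes "dfn m B X" "\<And>i. i < m \<Longrightarrow> g i < k" "B \<subseteq> U"
  shows "dfn k B {x \<in> tups k. map (\<lambda>i. x ! g i) [0..<m] \<in> X}"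
proof -
  obtain \<phi> s where \<phi>: "wf_fm M \<phi>" "admissible m B \<phi> s"
    "\<And>x. x \<in> tups m \<Longrightarrow> x \<in> X \<longleftrightarrow> sat M (assignment s x) \<phi>"
    using definableE[OF assms(1)] by metis
  let ?s = "map_sum g id \<circ> s"
  have *: "sat M (assignment s (map (\<lambda>i. x ! g i) [0..<m])) \<phi> = sat M (assignment ?s x) \<phi>" for x
    by (rule sat_cong)
      (use \<phi>(2) in \<open>auto simp: assignment_def admissible_def split: sum.splits\<close>)
  show ?thesis
  proof (rule definableI[of \<phi> _ _ ?s])
    show "admissible k B \<phi> ?s"
      unfolding admissible_def
    proof
      fix i assume "i \<in> fv \<phi>"
      then have "case s i of Inl j \<Rightarrow> j < m | Inr c \<Rightarrow> c \<in> B" using \<phi>(2) by (simp add: admissible_def)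
      then show "case ?s i of Inl j \<Rightarrow> j < k | Inr c \<Rightarrow> c \<in> B"
        using assms(2) by (cases "s i") auto
    qed
    show "{x \<in> tups k. map (\<lambda>i. x ! g i) [0..<m] \<in> X} = {x \<in> tups k. sat M (assignment ?s x) \<phi>}"
      using \<phi>(3)[OF map_nth_in_tuples] assms(2) * by auto
  qed (use \<phi> assms in auto)
qed

lemma definable_fibre:
  assumes "dfn (k + m) B Y" "b \<in> tups m" "B \<subseteq> U"
  shows "dfn k (B \<union> set b) {x \<in> tups k. x @ b \<in> Y}"
proof -
  obtain \<phi> s where \<phi>: "wf_fm M \<phi>" "admissible (k + m) B \<phi> s"
    "\<And>x. x \<in> tups (k + m) \<Longrightarrow> x \<in> Y \<longleftrightarrow> sat M (assignment s x) \<phi>"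
    using definableE[OF assms(1)] by metis
  define t where "t i = (case s i of Inl j \<Rightarrow> if j < k then Inl j else Inr (b ! (j - k)) | Inr c \<Rightarrow> Inr c)" for i
  have *: "sat M (assignment s (x @ b)) \<phi> = sat M (assignment t x) \<phi>" if "x \<in> tups k" for x
    by (rule sat_cong)
      (use \<phi>(2) that in \<open>auto simp: assignment_def admissible_def t_def nth_append tuples_def split: sum.splits\<close>)
  show ?thesis
  proof (rule definableI[of \<phi> _ _ t])
    show "admissible k (B \<union> set b) \<phi> t"
      unfolding admissible_def
    proof
      fix i assume "i \<in> fv \<phi>"
      then have "case s i of Inl j \<Rightarrow> j < k + m | Inr c \<Rightarrow> c \<in> B" using \<phi>(2) by (simp add: admissible_def)
      then show "case t i of Inl j \<Rightarrow> j < k | Inr c \<Rightarrow> c \<in> B \<union> set b"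
        using assms(2) by (auto simp: t_def tuples_def split: sum.splits)
    qed
    show "{x \<in> tups k. x @ b \<in> Y} = {x \<in> tups k. sat M (assignment t x) \<phi>}"
      using \<phi>(3) * assms(2) by (auto simp: append_in_tuples in_tuples)
  qed (use \<phi> assms in \<open>auto simp: tuples_def\<close>)
qed

text \<open>Parameters become further coordinates of a set over the smaller base, the form in which
  they can be varied.\<close>

lemma definable_as_fibre:
  assumes "dfn k (B \<union> set b) X" "B \<subseteq> U" "set b \<subseteq> U"
  obtains Y where "dfn (k + length b) B Y" "X = {x \<in> tups k. x @ b \<in> Y}"
proof -
  obtain \<phi> s where \<phi>: "wf_fm M \<phi>" "admissible k (B \<union> set b) \<phi> s"
    "\<And>x. x \<in> tups k \<Longrightarrow> x \<in> X \<longleftrightarrow> sat M (assignment s x) \<phi>"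
    using definableE[OF assms(1)] by metis
  obtain ix where ix: "\<And>c. c \<in> set b \<Longrightarrow> ix c < length b \<and> b ! ix c = c"
    using list_index by blast
  define t where "t i = (case s i of Inl j \<Rightarrow> Inl j | Inr c \<Rightarrow> if c \<in> set b then Inl (k + ix c) else Inr c)" for i
  have *: "sat M (assignment t (x @ b)) \<phi> = sat M (assignment s x) \<phi>" if "x \<in> tups k" for x
  proof (rule sat_cong)
    fix i assume "i \<in> fv \<phi>"
    then have "case s i of Inl j \<Rightarrow> j < k | Inr c \<Rightarrow> c \<in> B \<union> set b"
      using \<phi>(2) by (simp add: admissible_def)
    then show "assignment t (x @ b) i = assignment s x i"
      using that ix by (cases "s i") (auto simp: assignment_def t_def nth_append tuples_def)
  qed
  define Y where "Y = {y \<in> tups (k + length b). sat M (assignment t y) \<phi>}"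
  have "dfn (k + length b) B Y"
  proof (rule definableI[of \<phi> _ _ t])
    show "admissible (k + length b) B \<phi> t"
      unfolding admissible_def
    proof
      fix i assume "i \<in> fv \<phi>"
      then have "case s i of Inl j \<Rightarrow> j < k | Inr c \<Rightarrow> c \<in> B \<union> set b" using \<phi>(2) by (simp add: admissible_def)
      then show "case t i of Inl j \<Rightarrow> j < k + length b | Inr c \<Rightarrow> c \<in> B"
        using ix by (auto simp: t_def split: sum.splits)
    qed
  qed (use \<phi> assms in \<open>auto simp: Y_def\<close>)
  moreover have "X = {x \<in> tups k. x @ b \<in> Y}"
  proof -
    have "x @ b \<in> Y \<longleftrightarrow> x \<in> X" if "x \<in> tups k" for x
      using \<phi>(3)[OF that] *[OF that] assms(3) that by (auto simp: Y_def tuples_def)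
    then show ?thesis using definable_subset_tuples[OF assms(1)] by blast
  qed
  ultimately show thesis using that by blast
qed

lemma definable_project_last:
  assumes "dfn (Suc k) B X" "B \<subseteq> U"
  shows "dfn k B {x \<in> tups k. \<exists>a\<in>U. x @ [a] \<in> X}"
proof -
  \<comment> \<open>The raw layout is used here because the variable to be quantified must literally
    be \<open>k\<close>.\<close>
  obtain \<phi> b where \<delta>: "(\<phi>, b) \<in> pformulas M (Suc k) B" "X = realizations M (Suc k) {(\<phi>, b)}"
    using assms by (auto simp: definable_def)
  define s where "s i = (if i < k then Inl i else Inr (b ! (i - Suc k)))" for i
  have *: "sat M ((assignment s x)(k := a)) \<phi> \<longleftrightarrow> x @ [a] \<in> X" if "x \<in> tups k" "a \<in> U" for x a
  proof -
    have "sat M ((assignment s x)(k := a)) \<phi> = sat M ((!) (x @ [a] @ b)) \<phi>"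
      by (rule sat_cong)
        (use that in \<open>auto simp: assignment_def s_def nth_append tuples_def nth_Cons'\<close>)
    then show ?thesis using that by (auto simp: \<delta>(2) realizations_def holds_def tuples_def)
  qed
  show ?thesis
  proof (rule definableI[of "Ex k \<phi>" _ _ s])
    show "wf_fm M (Ex k \<phi>)" using \<delta>(1) by (auto simp: pformulas_def formulas_def)
    show "admissible k B (Ex k \<phi>) s"
      unfolding admissible_def
    proof
      fix i assume i: "i \<in> fv (Ex k \<phi>)"
      then have "i < Suc k + length b" "i \<noteq> k" using \<delta>(1) by (auto simp: pformulas_def)
      then have "i < k \<or> i - Suc k < length b" by auto
      moreover have "set b \<subseteq> B" using \<delta>(1) by (auto simp: pformulas_def)
      ultimately show "case s i of Inl j \<Rightarrow> j < k | Inr c \<Rightarrow> c \<in> B"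
        using \<open>i \<noteq> k\<close> by (auto simp: s_def)
    qed
    show "{x \<in> tups k. \<exists>a\<in>U. x @ [a] \<in> X} = {x \<in> tups k. sat M (assignment s x) (Ex k \<phi>)}"
      using * by auto
  qed (rule assms(2))
qed

lemma definable_project:
  assumes "dfn (k + m) B X" "B \<subseteq> U"
  shows "dfn k B {x \<in> tups k. \<exists>y\<in>tups m. x @ y \<in> X}"
  using assms(1)
proof (induction m arbitrary: X)
  case 0
  have "{x \<in> tups k. \<exists>y\<in>tups 0. x @ y \<in> X} = X"
    using definable_subset_tuples[OF 0] by (auto simp: tuples_def)
  then show ?case using 0 by simp
next
  case (Suc m)
  let ?X = "{x \<in> tups (k + m). \<exists>a\<in>U. x @ [a] \<in> X}"
  have "dfn k B {x \<in> tups k. \<exists>y\<in>tups m. x @ y \<in> ?X}"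
    by (rule Suc.IH) (use Suc.prems definable_project_last assms(2) in simp)
  moreover have "{x \<in> tups k. \<exists>y\<in>tups m. x @ y \<in> ?X} = {x \<in> tups k. \<exists>y\<in>tups (Suc m). x @ y \<in> X}"
  proof (intro Collect_cong conj_cong refl)
    fix x assume x: "x \<in> tups k"
    show "(\<exists>y\<in>tups m. x @ y \<in> ?X) = (\<exists>y\<in>tups (Suc m). x @ y \<in> X)"
    proof
      assume "\<exists>y\<in>tups m. x @ y \<in> ?X"
      then obtain y a where "y \<in> tups m" "a \<in> U" "x @ y @ [a] \<in> X" by auto
      then show "\<exists>y\<in>tups (Suc m). x @ y \<in> X"
        by (intro bexI[of _ "y @ [a]"]) (auto simp: tuples_def)
    next
      assume "\<exists>y\<in>tups (Suc m). x @ y \<in> X"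
      then obtain y where y: "y \<in> tups (m + 1)" "x @ y \<in> X" by auto
      then obtain z w where "y = z @ w" "z \<in> tups m" "w \<in> tups 1"
        using in_tuples_add_cases by blast
      moreover then obtain a where "w = [a]" "a \<in> U" by (auto simp: tuples_def length_Suc_conv)
      ultimately show "\<exists>y\<in>tups m. x @ y \<in> ?X"
        using y(2) x by (intro bexI[of _ z]) (auto simp: tuples_def)
    qed
  qed
  ultimately show ?case by simp
qed

lemma definable_coordinate_eq:
  assumes "i < k" "j < k"
  shows "dfn k {} {x \<in> tups k. x ! i = x ! j}"
  by (rule definableI[of "Eq (Var i) (Var j)" _ _ Inl])
    (use assms in \<open>auto simp: admissible_def assignment_def\<close>)

lemma definable_coordinate_const:
  assumes "i < k" "c \<in> B" "B \<subseteq> U"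
  shows "dfn k B {x \<in> tups k. x ! i = c}"
  by (rule definableI[of "Eq (Var 0) (Var 1)" _ _ "\<lambda>j. if j = 0 then Inl i else Inr c"])
    (use assms in \<open>auto simp: admissible_def assignment_def\<close>)

lemma tp_eq_iff:
  assumes "a \<in> tups k" "b \<in> tups k"
  shows "tp M a B = tp M b B \<longleftrightarrow> (\<forall>X. dfn k B X \<longrightarrow> (a \<in> X \<longleftrightarrow> b \<in> X))"
proof
  assume eq: "tp M a B = tp M b B"
  show "\<forall>X. dfn k B X \<longrightarrow> (a \<in> X \<longleftrightarrow> b \<in> X)"
  proof (intro allI impI)
    fix X assume "dfn k B X"
    then obtain \<delta> where "\<delta> \<in> pformulas M k B" "X = realizations M k {\<delta>}"
      by (auto simp: definable_def)
    then show "a \<in> X \<longleftrightarrow> b \<in> X"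
      using eq assms unfolding tp_def by (auto simp: realizations_def tuples_def)
  qed
next
  assume *: "\<forall>X. dfn k B X \<longrightarrow> (a \<in> X \<longleftrightarrow> b \<in> X)"
  have "holds M a \<delta> = holds M b \<delta>" if "\<delta> \<in> pformulas M k B" for \<delta>
    using *[rule_format, of "realizations M k {\<delta>}"] that assms
    by (auto simp: definable_def realizations_def)
  then show "tp M a B = tp M b B"
    using assms by (auto simp: tp_def tuples_def)
qed

end

section \<open>Ultrafilters and Ramsey's theorem\<close>

definition ultrafilter :: "'x filter \<Rightarrow> bool" where
  "ultrafilter F \<longleftrightarrow> F \<noteq> bot \<and> (\<forall>P. eventually P F \<or> eventually (\<lambda>x. \<not> P x) F)"

lemma ultrafilter_not: "ultrafilter F \<Longrightarrow> eventually (\<lambda>x. \<not> P x) F \<longleftrightarrow> \<not> eventually P F"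
proof
  assume "ultrafilter F" "eventually (\<lambda>x. \<not> P x) F"
  then show "\<not> eventually P F"
    using eventually_conj[of P F "\<lambda>x. \<not> P x"] by (auto simp: ultrafilter_def)
qed (auto simp: ultrafilter_def)

lemma ultrafilter_extension:
  fixes S :: "'x set set"
  assumes "\<And>T. finite T \<Longrightarrow> T \<subseteq> S \<Longrightarrow> \<Inter>T \<noteq> {}"
  obtains F where "ultrafilter F" "\<And>X. X \<in> S \<Longrightarrow> eventually (\<lambda>x. x \<in> X) F"
proof -
  let ?fip = "\<lambda>S :: 'x set set. \<forall>T. finite T \<longrightarrow> T \<subseteq> S \<longrightarrow> \<Inter>T \<noteq> {}"
  let ?A = "{S'. S \<subseteq> S' \<and> ?fip S'}"
  have "\<exists>S'\<in>?A. \<forall>X\<in>?A. S' \<subseteq> X \<longrightarrow> X = S'"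
  proof (rule subset_Zorn_nonempty)
    show "?A \<noteq> {}" using assms by blast
    fix \<C> assume \<C>: "\<C> \<noteq> {}" "subset.chain ?A \<C>"
    have "?fip (\<Union>\<C>)"
    proof (intro allI impI)
      fix T assume T: "finite T" "T \<subseteq> \<Union>\<C>"
      obtain C where "C \<in> \<C>" "T \<subseteq> C"
        using finite_subset_Union_chain[OF T \<C>] by blast
      then show "\<Inter>T \<noteq> {}" using \<C>(2) T(1) by (auto simp: subset.chain_def)
    qed
    moreover obtain C where "C \<in> \<C>" using \<C>(1) by blast
    then have "S \<subseteq> \<Union>\<C>" using \<C>(2) unfolding subset.chain_def by blast
    ultimately show "\<Union>\<C> \<in> ?A" by simp
  qed
  then obtain S' where S': "S \<subseteq> S'" "?fip S'" and max: "\<And>X. S \<subseteq> X \<Longrightarrow> ?fip X \<Longrightarrow> S' \<subseteq> X \<Longrightarrow> X = S'"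
    by auto
  define F where "F = (INF X\<in>S'. principal X)"
  have ev: "eventually (\<lambda>x. x \<in> X) F" if "X \<in> S'" for X
    unfolding F_def by (rule eventually_INF1[OF that]) (simp add: eventually_principal)
  have bot: "F \<noteq> bot"
    unfolding F_def
  proof (rule INF_filter_not_bot)
    fix T assume "T \<subseteq> S'" "finite T"
    then show "(INF X\<in>T. principal X) \<noteq> bot"
      using S'(2) by (simp add: INF_principal_finite principal_eq_bot_iff)
  qed
  \<comment> \<open>If neither set could be added, two finite subfamilies would exclude them, and
    the union of these would have empty intersection.\<close>
  have "Collect P \<in> S' \<or> - Collect P \<in> S'" for P
  proof (rule ccontr)
    assume *: "\<not> (Collect P \<in> S' \<or> - Collect P \<in> S')"
    have "\<exists>T. finite T \<and> T \<subseteq> S' \<and> X \<inter> \<Inter>T = {}" if "X \<notin> S'" for X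
    proof -
      have "\<not> ?fip (insert X S')" using max[of "insert X S'"] S'(1) that by blast
      then obtain T where "finite T" "T \<subseteq> insert X S'" "\<Inter>T = {}" by blast
      then show ?thesis by (intro exI[of _ "T - {X}"]) auto
    qed
    then obtain T1 T2 where "finite T1" "T1 \<subseteq> S'" "Collect P \<inter> \<Inter>T1 = {}"
      "finite T2" "T2 \<subseteq> S'" "- Collect P \<inter> \<Inter>T2 = {}" using * by meson
    then have "finite (T1 \<union> T2)" "T1 \<union> T2 \<subseteq> S'" "\<Inter>(T1 \<union> T2) = {}" by blast+
    then show False using S'(2) by blast
  qed
  then have "eventually P F \<or> eventually (\<lambda>x. \<not> P x) F" for P
    using ev[of "Collect P"] ev[of "- Collect P"] by auto
  then have "ultrafilter F" using bot by (simp add: ultrafilter_def)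
  then show thesis using ev S'(1) that by blast
qed

lemma sorted_wrt_map_strict_mono:
  assumes "strict_mono h" "sorted_wrt (<) is"
  shows "sorted_wrt (<) (map h is)"
  unfolding sorted_wrt_map
  by (rule sorted_wrt_mono_rel[OF _ assms(2)]) (use assms(1) in \<open>auto simp: strict_mono_def\<close>)

lemma Ramsey_increasing:
  fixes P :: "nat list \<Rightarrow> bool"
  obtains h :: "nat \<Rightarrow> nat" where "strict_mono h"
    "\<And>is js. \<lbrakk>sorted_wrt (<) is; sorted_wrt (<) js; length is = l; length js = l\<rbrakk>
      \<Longrightarrow> P (map h is) = P (map h js)"
proof -
  \<comment> \<open>Increasing lists are coded by their sets of entries, which brings Ramsey's
    theorem for \<open>l\<close>-element sets to bear.\<close>
  let ?f = "\<lambda>X. if P (sorted_list_of_set X) then 1 else 0 :: nat"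
  obtain Y t where Y: "infinite Y" "\<And>X. \<lbrakk>X \<subseteq> Y; finite X; card X = l\<rbrakk> \<Longrightarrow> ?f X = t"
  proof -
    have "\<forall>X. X \<subseteq> UNIV \<and> finite X \<and> card X = l \<longrightarrow> ?f X < 2" by simp
    from Ramsey[OF _ this] show thesis using that by (metis infinite_UNIV_nat)
  qed
  let ?h = "enumerate Y"
  have mono: "strict_mono ?h" using Y(1) by (simp add: strict_mono_enumerate)
  have "P (map ?h is) \<longleftrightarrow> t = 1" if "sorted_wrt (<) is" "length is = l" for "is"
  proof -
    have s: "sorted_wrt (<) (map ?h is)" using sorted_wrt_map_strict_mono[OF mono that(1)] .
    have "sorted_list_of_set (set (map ?h is)) = map ?h is"
      using s strict_sorted_iff by (intro sorted_list_of_set.idem_if_sorted_distinct) blast+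
    moreover have "card (set (map ?h is)) = l"
      using s that(2) strict_sorted_iff distinct_card by (metis length_map)
    moreover have "set (map ?h is) \<subseteq> Y" using Y(1) by (auto simp: enumerate_in_set)
    ultimately show ?thesis using Y(2)[of "set (map ?h is)"] by (auto split: if_splits)
  qed
  then show thesis using that mono by blast
qed

text \<open>Successive thinning: homogeneity already achieved survives passing to a
  subsequence.\<close>

lemma finitely_many_Ramsey_increasing:
  fixes P :: "'x \<Rightarrow> nat list \<Rightarrow> bool"
  assumes "finite T"
  obtains h :: "nat \<Rightarrow> nat" where "strict_mono h"
    "\<And>t is js. \<lbrakk>t \<in> T; sorted_wrt (<) is; sorted_wrt (<) js; length is = l t; length js = l t\<rbrakk>
      \<Longrightarrow> P t (map h is) = P t (map h js)"
proof -
  have "\<exists>h :: nat \<Rightarrow> nat. strict_mono h \<and> (\<forall>t is js. t \<in> T \<longrightarrow> sorted_wrt (<) is \<longrightarrow>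
    sorted_wrt (<) js \<longrightarrow> length is = l t \<longrightarrow> length js = l t \<longrightarrow> P t (map h is) = P t (map h js))"
    using assms
  proof (induction T rule: finite_induct)
    case empty
    show ?case by (intro exI[of _ id]) (simp add: strict_mono_def)
  next
    case (insert t T)
    then obtain h :: "nat \<Rightarrow> nat" where h: "strict_mono h"
      "\<And>t is js. \<lbrakk>t \<in> T; sorted_wrt (<) is; sorted_wrt (<) js; length is = l t; length js = l t\<rbrakk>
      \<Longrightarrow> P t (map h is) = P t (map h js)" by blast
    obtain g :: "nat \<Rightarrow> nat" where g: "strict_mono g"
      "\<And>is js. \<lbrakk>sorted_wrt (<) is; sorted_wrt (<) js; length is = l t; length js = l t\<rbrakk>
      \<Longrightarrow> P t (map h (map g is)) = P t (map h (map g js))"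
      using Ramsey_increasing[of "l t" "\<lambda>is. P t (map h is)"] by blast
    show ?case
    proof (intro exI[of _ "h \<circ> g"] conjI allI impI)
      show "strict_mono (h \<circ> g)" using h(1) g(1) by (simp add: strict_mono_o)
      fix u and "is" js :: "nat list" assume "u \<in> insert t T" "sorted_wrt (<) is" "sorted_wrt (<) js"
        "length is = l u" "length js = l u"
      then show "P u (map (h \<circ> g) is) = P u (map (h \<circ> g) js)"
        using g(2)[of "is" js] h(2)[of u "map g is" "map g js"] sorted_wrt_map_strict_mono[OF g(1)]
        by auto
    qed
  qed
  then show thesis using that by blast
qed

text \<open>Dependent choice in the form the recursive constructions below take: the next element
  may depend on all earlier ones.\<close>

lemma sequence_of_prefixes:
  assumes "P []" "\<And>w. P w \<Longrightarrow> \<exists>a. P (w @ [a])"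
  obtains v :: "nat \<Rightarrow> 'x" where "\<And>n. P (map v [0..<n])"
proof -
  have "\<exists>W. \<forall>n. (P (W n) \<and> length (W n) = n) \<and> (\<exists>a. W (Suc n) = W n @ [a])"
    by (rule dependent_nat_choice) (use assms in fastforce)+
  then obtain W where W: "\<And>n. P (W n)" "\<And>n. length (W n) = n" "\<And>n. \<exists>a. W (Suc n) = W n @ [a]"
    by blast
  have "map (\<lambda>i. last (W (Suc i))) [0..<n] = W n" for n
  proof (induction n)
    case 0
    then show ?case using W(2)[of 0] by simp
  next
    case (Suc n)
    then show ?case using W(3)[of n] by auto
  qed
  then show thesis using W(1) that by metis
qed

section \<open>Automorphisms\<close>

context monster_model
begin

definition Aut :: "'a set \<Rightarrow> ('a \<Rightarrow> 'a) set" where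
  "Aut A = {\<sigma>. automorphism M \<sigma> \<and> (\<forall>x\<in>A. \<sigma> x = x)}"

lemma Aut_antimono: "A \<subseteq> B \<Longrightarrow> Aut B \<subseteq> Aut A"
  by (auto simp: Aut_def)

lemma Aut_in_U: "\<sigma> \<in> Aut A \<Longrightarrow> x \<in> U \<Longrightarrow> \<sigma> x \<in> U"
  by (auto simp: Aut_def automorphism_def bij_betw_def)

lemma Aut_fix: "\<sigma> \<in> Aut A \<Longrightarrow> set x \<subseteq> A \<Longrightarrow> map \<sigma> x = x"
  by (auto simp: Aut_def intro: map_idI)

lemma Aut_tuples: "\<sigma> \<in> Aut A \<Longrightarrow> x \<in> tups k \<Longrightarrow> map \<sigma> x \<in> tups k"
  by (auto simp: tuples_def Aut_in_U)

lemma Aut_comp: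
  assumes "\<sigma> \<in> Aut A" "\<tau> \<in> Aut A"
  shows "\<sigma> \<circ> \<tau> \<in> Aut A"
proof -
  have "\<sigma> (\<tau> (fint M f a)) = fint M f (map (\<sigma> \<circ> \<tau>) a)"
    if "(f, n) \<in> funs M" "a \<in> tups n" for f n a
  proof -
    have "\<tau> (fint M f a) = fint M f (map \<tau> a)"
      "\<sigma> (fint M f (map \<tau> a)) = fint M f (map \<sigma> (map \<tau> a))"
      using assms that Aut_tuples[OF assms(2) that(2)] unfolding Aut_def automorphism_def by blast+
    then show ?thesis by simp
  qed
  moreover have "rint M r a = rint M r (map (\<sigma> \<circ> \<tau>) a)"
    if "(r, n) \<in> rels M" "a \<in> tups n" for r n a
  proof -
    have "rint M r a = rint M r (map \<tau> a)"
      "rint M r (map \<tau> a) = rint M r (map \<sigma> (map \<tau> a))"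
      using assms that Aut_tuples[OF assms(2) that(2)] unfolding Aut_def automorphism_def by blast+
    then show ?thesis by simp
  qed
  moreover have "bij_betw (\<sigma> \<circ> \<tau>) U U"
    using assms bij_betw_trans unfolding Aut_def automorphism_def by blast
  ultimately show ?thesis using assms by (auto simp: Aut_def automorphism_def comp_def)
qed

text \<open>Members of \<open>Aut\<close> are total functions that are bijective just on the
  universe, so the inverse is described by its equations there.\<close>

lemma Aut_inverse:
  assumes "\<sigma> \<in> Aut A" "A \<subseteq> U"
  obtains \<tau> where "\<tau> \<in> Aut A" "\<And>x. x \<in> U \<Longrightarrow> \<tau> (\<sigma> x) = x" "\<And>x. x \<in> U \<Longrightarrow> \<sigma> (\<tau> x) = x"
    "\<And>x k. x \<in> tups k \<Longrightarrow> map \<tau> (map \<sigma> x) = x" "\<And>x k. x \<in> tups k \<Longrightarrow> map \<sigma> (map \<tau> x) = x"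
proof -
  have bij: "bij_betw \<sigma> U U" using assms by (simp add: Aut_def automorphism_def)
  define \<tau> where "\<tau> = inv_into U \<sigma>"
  have \<tau>: "\<tau> (\<sigma> x) = x" "\<sigma> (\<tau> x) = x" "\<tau> x \<in> U" if "x \<in> U" for x
    using bij that unfolding \<tau>_def
    by (auto simp: bij_betw_def inv_into_f_f f_inv_into_f inv_into_into)
  have m: "map \<tau> (map \<sigma> x) = x" "map \<sigma> (map \<tau> x) = x" "map \<tau> x \<in> tups k" if "x \<in> tups k" for x k
    using that \<tau> by (auto simp: tuples_def subset_iff intro!: map_idI)
  have "\<tau> (fint M f a) = fint M f (map \<tau> a)" if "(f, n) \<in> funs M" "a \<in> tups n" for f n a
  proof -
    have "\<sigma> (fint M f (map \<tau> a)) = fint M f (map \<sigma> (map \<tau> a))"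
      using assms(1) that m(3) unfolding Aut_def automorphism_def by blast
    then have "\<sigma> (fint M f (map \<tau> a)) = fint M f a" using m(2)[OF that(2)] by simp
    moreover have "fint M f (map \<tau> a) \<in> U"
      using is_struct that m(3) unfolding is_structure_def by blast
    ultimately show ?thesis using \<tau>(1) by metis
  qed
  moreover have "rint M r a = rint M r (map \<tau> a)" if "(r, n) \<in> rels M" "a \<in> tups n" for r n a
  proof -
    have "rint M r (map \<tau> a) = rint M r (map \<sigma> (map \<tau> a))"
      using assms(1) that m(3) unfolding Aut_def automorphism_def by blast
    then show ?thesis using m(2)[OF that(2)] by simp
  qed
  moreover have "bij_betw \<tau> U U" unfolding \<tau>_def by (rule bij_betw_inv_into[OF bij])
  moreover have "\<tau> x = x" if "x \<in> A" for x
    using \<tau>(1)[of x] assms that by (auto simp: Aut_def)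
  ultimately have "\<tau> \<in> Aut A" by (auto simp: Aut_def automorphism_def)
  then show thesis using that \<tau> m by blast
qed

lemma definable_invariant:
  assumes "dfn k B X" "B \<subseteq> U" "\<sigma> \<in> Aut B" "x \<in> tups k"
  shows "map \<sigma> x \<in> X \<longleftrightarrow> x \<in> X"
proof -
  obtain \<phi> s where \<phi>: "wf_fm M \<phi>" "admissible k B \<phi> s"
    "\<And>x. x \<in> tups k \<Longrightarrow> x \<in> X \<longleftrightarrow> sat M (assignment s x) \<phi>"
    using definableE[OF assms(1)] by metis
  have *: "case s i of Inl j \<Rightarrow> j < k | Inr c \<Rightarrow> c \<in> B" if "i \<in> fv \<phi>" for i
    using \<phi>(2) that by (simp add: admissible_def)
  have "sat M (assignment s (map \<sigma> x)) \<phi> = sat M (\<sigma> \<circ> assignment s x) \<phi>"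
  proof (rule sat_cong)
    fix i assume "i \<in> fv \<phi>"
    then show "assignment s (map \<sigma> x) i = (\<sigma> \<circ> assignment s x) i"
      using *[of i] assms(3,4) by (auto simp: assignment_def tuples_def Aut_def split: sum.splits)
  qed
  also have "\<dots> = sat M (assignment s x) \<phi>"
  proof (rule sat_automorphism_fv[OF is_struct])
    show "assignment s x ` fv \<phi> \<subseteq> U"
      using * assms(2,4) by (fastforce simp: assignment_def tuples_def split: sum.splits)
  qed (use assms(3) \<phi>(1) in \<open>auto simp: Aut_def\<close>)
  finally show ?thesis using \<phi>(3) assms(4) Aut_tuples[OF assms(3,4)] by simp
qed

text \<open>The dictionary between two views of conjugates: moving a set by an automorphism over
  \<open>B\<close> is moving the parameters of its defining formula.\<close>

lemma image_fibre:
  assumes "dfn (k + m) B Y" "B \<subseteq> U" "\<sigma> \<in> Aut B" "b \<in> tups m"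
  shows "map \<sigma> ` {x \<in> tups k. x @ b \<in> Y} = {x \<in> tups k. x @ map \<sigma> b \<in> Y}"
proof -
  obtain \<tau> where \<tau>: "\<tau> \<in> Aut B" "\<And>x k. x \<in> tups k \<Longrightarrow> map \<sigma> (map \<tau> x) = x"
    using Aut_inverse[OF assms(3,2)] by metis
  have *: "map \<sigma> x @ map \<sigma> b \<in> Y \<longleftrightarrow> x @ b \<in> Y" if "x \<in> tups k" for x
    using definable_invariant[OF assms(1-3), of "x @ b"] that assms(4)
    by (simp add: append_in_tuples in_tuples)
  show ?thesis
  proof (intro equalityI subsetI)
    fix y assume y: "y \<in> {x \<in> tups k. x @ map \<sigma> b \<in> Y}"
    then have "map \<tau> y @ b \<in> Y" using *[of "map \<tau> y"] \<tau>(2)[of y] Aut_tuples[OF \<tau>(1)] by auto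
    then show "y \<in> map \<sigma> ` {x \<in> tups k. x @ b \<in> Y}"
      using y \<tau>(2)[of y k] Aut_tuples[OF \<tau>(1)] by (intro image_eqI[of _ _ "map \<tau> y"]) auto
  qed (use * Aut_tuples[OF assms(3)] in auto)
qed

lemma image_definable_fixed:
  assumes "dfn k B X" "B \<subseteq> U" "\<sigma> \<in> Aut B"
  shows "map \<sigma> ` X = X"
proof -
  have "dfn (k + 0) B X" using assms(1) by simp
  from image_fibre[OF this assms(2,3), of "[]"] definable_subset_tuples[OF assms(1)]
  show ?thesis by (auto simp: tuples_def Int_absorb1 Collect_conj_eq)
qed

lemma image_Int_tuples:
  assumes "\<sigma> \<in> Aut A" "X \<subseteq> tups k" "Y \<subseteq> tups k"
  shows "map \<sigma> ` (X \<inter> Y) = map \<sigma> ` X \<inter> map \<sigma> ` Y"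
proof -
  have "\<sigma> \<in> Aut {}" using assms(1) by (auto simp: Aut_def)
  then obtain \<tau> where "\<And>x k. x \<in> tups k \<Longrightarrow> map \<tau> (map \<sigma> x) = x"
    using Aut_inverse[of \<sigma> "{}"] by (metis empty_subsetI)
  then have "inj_on (map \<sigma>) (tups k)" by (metis inj_onI)
  then show ?thesis using assms(2,3) by (rule inj_on_image_Int)
qed

section \<open>Homogeneity and compactness\<close>

abbreviation "sm \<equiv> small M \<kappa>"

text \<open>Makes \<open>\<kappa>\<close> uncountable, so that countable sets of parameters are
  small.\<close>

lemma infinite_formulas: "infinite (formulas M)"
proof -
  have "inj (\<lambda>i. Eq (Var i) (Var i) :: ('f, 'r) fm)" by (simp add: inj_def)
  moreover have "range (\<lambda>i. Eq (Var i) (Var i) :: ('f, 'r) fm) \<subseteq> formulas M"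
    by (auto simp: formulas_def)
  ultimately show ?thesis using finite_subset range_inj_infinite by blast
qed

lemma Card_order_kappa: "Card_order \<kappa>"
  using monster by (simp add: monster_def)

lemma formulas_less_kappa: "|formulas M| <o \<kappa>"
  using monster by (simp add: monster_def)

lemma infinite_Field_kappa: "infinite (Field \<kappa>)"
proof -
  have "|formulas M| <o |Field \<kappa>|"
    using formulas_less_kappa card_of_Field_ordIso[OF Card_order_kappa] ordIso_symmetric
      ordLess_ordIso_trans by blast
  then show ?thesis
    using infinite_formulas card_of_ordLeq_infinite ordLess_imp_ordLeq by blast
qed

lemma small_subset_U: "sm A \<Longrightarrow> A \<subseteq> U"
  by (simp add: small_def)

lemma small_Un: "sm A \<Longrightarrow> sm B \<Longrightarrow> sm (A \<union> B)"
  unfolding small_def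
  using card_of_Un_ordLess_infinite_Field[OF infinite_Field_kappa Card_order_kappa] by auto

lemma small_subset: "sm A \<Longrightarrow> B \<subseteq> A \<Longrightarrow> sm B"
  unfolding small_def using card_of_mono1 ordLeq_ordLess_trans by blast

lemma small_countable:
  assumes "range (f :: nat \<Rightarrow> 'a) \<subseteq> U"
  shows "sm (range f)"
proof -
  have "|range f| \<le>o |UNIV :: nat set|" by (rule card_of_image)
  also have "|UNIV :: nat set| \<le>o |formulas M|"
    using infinite_formulas infinite_iff_card_of_nat by blast
  finally show ?thesis
    using assms formulas_less_kappa ordLeq_ordLess_trans by (auto simp: small_def)
qed

lemma small_finite:
  assumes "finite A" "A \<subseteq> U"
  shows "sm A"
proof -
  have "|A| <o |formulas M|"
    using infinite_formulas assms(1) finite_iff_ordLess_natLeq infinite_iff_natLeq_ordLeq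
      ordLess_ordLeq_trans by metis
  then show ?thesis
    using assms formulas_less_kappa ordLess_transitive by (auto simp: small_def)
qed

lemma small_Un_set: "sm A \<Longrightarrow> set b \<subseteq> U \<Longrightarrow> sm (A \<union> set b)"
  by (rule small_Un) (auto intro: small_finite)

text \<open>The one-sided hypothesis is equality of types, because complements of definable sets are
  definable.\<close>

lemma Aut_exists:
  assumes "a \<in> tups k" "b \<in> tups k" "sm A"
    and *: "\<And>X. dfn k A X \<Longrightarrow> a \<in> X \<Longrightarrow> b \<in> X"
  obtains \<sigma> where "\<sigma> \<in> Aut A" "map \<sigma> a = b"
proof -
  have A: "A \<subseteq> U" using assms(3) by (rule small_subset_U)
  have len: "length a = k" "length b = k" using assms by (auto simp: tuples_def)
  have iff: "a \<in> X \<longleftrightarrow> b \<in> X" if "dfn k A X" for X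
    using *[OF that] *[OF definable_complement[OF that A]] assms(1,2) by blast
  obtain ix where ix: "\<And>c. c \<in> set a \<Longrightarrow> ix c < length a \<and> a ! ix c = c"
    using list_index by blast
  \<comment> \<open>\<open>a\<close> may repeat entries or meet \<open>A\<close>. That
    \<open>g\<close> still sends \<open>a ! i\<close> to \<open>b ! i\<close> follows from the
    definability of the equations \<open>x ! i = x ! j\<close> and \<open>x ! i = c\<close>.\<close>
  define g where "g c = (if c \<in> A then c else b ! ix c)" for c
  have ga: "g (a ! i) = b ! i" if i: "i < k" for i
  proof (cases "a ! i \<in> A")
    case True
    then show ?thesis
      using *[OF definable_coordinate_const[OF i True A]] assms(1) by (simp add: g_def)
  next
    case False
    let ?j = "ix (a ! i)"
    have j: "?j < k" "a ! ?j = a ! i" using ix[of "a ! i"] i len by auto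
    have "dfn k A {x \<in> tups k. x ! ?j = x ! i}"
      using definable_mono[OF definable_coordinate_eq[OF j(1) i]] by blast
    from *[OF this] show ?thesis using j assms(1) False by (simp add: g_def)
  qed
  have "elementary_map M (A \<union> set a) g"
    unfolding elementary_map_def
  proof (intro conjI allI impI)
    have "g c \<in> U" if "c \<in> A \<union> set a" for c
    proof (cases "c \<in> A")
      case False
      then have "b ! ix c \<in> set b" using that ix[of c] len by auto
      then show ?thesis using False assms(2) by (auto simp: g_def tuples_def)
    qed (use A in \<open>auto simp: g_def\<close>)
    then show "g ` (A \<union> set a) \<subseteq> U" by blast
    fix e assume e: "set e \<subseteq> A \<union> set a"
    have "holds M (map g e) (\<phi>, []) = holds M e (\<phi>, [])" if \<phi>: "(\<phi>, []) \<in> pformulas M (length e) {}" for \<phi>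
    proof -
      \<comment> \<open>Truth at \<open>e\<close> is rewritten as membership of \<open>a\<close> in
        an \<open>A\<close>-definable set: entries in \<open>A\<close> become constants, the others
        coordinates of \<open>a\<close>.\<close>
      define s where "s i = (if e ! i \<in> A then Inr (e ! i) else Inl (ix (e ! i)))" for i
      have adm: "admissible k A \<phi> s"
        unfolding admissible_def
      proof
        fix i assume "i \<in> fv \<phi>"
        then have "i < length e" using \<phi> by (auto simp: pformulas_def)
        then have "e ! i \<in> A \<union> set a" using e nth_mem by blast
        then show "case s i of Inl j \<Rightarrow> j < k | Inr c \<Rightarrow> c \<in> A"
          using ix[of "e ! i"] len by (cases "e ! i \<in> A") (simp_all add: s_def)
      qed
      let ?X = "{x \<in> tups k. sat M (assignment s x) \<phi>}"
      have "dfn k A ?X"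
        using \<phi> by (intro definableI[OF _ adm A]) (auto simp: pformulas_def formulas_def)
      then have "a \<in> ?X \<longleftrightarrow> b \<in> ?X" by (rule iff)
      then have "sat M (assignment s a) \<phi> = sat M (assignment s b) \<phi>" using assms by simp
      moreover have "sat M (assignment s a) \<phi> = sat M ((!) e) \<phi>"
      proof (rule sat_cong)
        fix i assume "i \<in> fv \<phi>"
        then have "i < length e" using \<phi> by (auto simp: pformulas_def)
        then have "e ! i \<in> A \<union> set a" using e nth_mem by blast
        then show "assignment s a i = e ! i" using ix by (auto simp: s_def assignment_def)
      qed
      moreover have "sat M (assignment s b) \<phi> = sat M ((!) (map g e)) \<phi>"
      proof (rule sat_cong)
        fix i assume "i \<in> fv \<phi>"
        then have "i < length e" using \<phi> by (auto simp: pformulas_def)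
        then show "assignment s b i = map g e ! i" by (simp add: s_def assignment_def g_def)
      qed
      ultimately show ?thesis by (simp add: holds_def)
    qed
    then show "tp M (map g e) {} = tp M e {}"
      unfolding tp_def by (auto simp: pformulas_def)
  qed
  moreover have "sm (A \<union> set a)" using small_Un_set assms(1,3) by (simp add: tuples_def)
  ultimately obtain \<sigma> where \<sigma>: "automorphism M \<sigma>" "\<And>c. c \<in> A \<union> set a \<Longrightarrow> \<sigma> c = g c"
    using monster unfolding monster_def strongly_homogeneous_def small_def by metis
  have "\<sigma> \<in> Aut A" using \<sigma> by (auto simp: Aut_def g_def)
  moreover have "map \<sigma> a = b"
    by (rule nth_equalityI) (use len \<sigma>(2) ga in auto)
  ultimately show thesis using that by blast
qed

lemma tp_eq_Aut:
  assumes "a \<in> tups k" "b \<in> tups k" "sm A"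
  shows "tp M a A = tp M b A \<longleftrightarrow> (\<exists>\<sigma>\<in>Aut A. map \<sigma> a = b)"
proof
  assume "tp M a A = tp M b A"
  then show "\<exists>\<sigma>\<in>Aut A. map \<sigma> a = b"
    using Aut_exists[OF assms] tp_eq_iff[OF assms(1,2)] by metis
next
  assume "\<exists>\<sigma>\<in>Aut A. map \<sigma> a = b"
  then show "tp M a A = tp M b A"
    using definable_invariant[OF _ small_subset_U[OF assms(3)] _ assms(1)] tp_eq_iff[OF assms(1,2)]
    by blast
qed

text \<open>The limit of \<open>f\<close> along \<open>F\<close> is a complete type in countably many variables; since saturation
  only speaks of finitely many variables, it is realized one coordinate at a time, homogeneity moving
  each new realization onto the old one.\<close>

lemma realize_limit_type_nat:
  assumes F: "ultrafilter F" and f: "\<And>x i. f x i \<in> U" and A: "sm A"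
  obtains v :: "nat \<Rightarrow> 'a" where "\<And>i. v i \<in> U"
    "\<And>k X. dfn k A X \<Longrightarrow> map v [0..<k] \<in> X \<longleftrightarrow> eventually (\<lambda>x. map (f x) [0..<k] \<in> X) F"
proof -
  have AU: "A \<subseteq> U" using A by (rule small_subset_U)
  define lim where "lim w \<longleftrightarrow> w \<in> tups (length w) \<and> (\<forall>X. dfn (length w) A X \<longrightarrow>
    (w \<in> X \<longleftrightarrow> eventually (\<lambda>x. map (f x) [0..<length w] \<in> X) F))" for w
  have ex: "\<exists>w. length w = k \<and> lim w" for k
  proof -
    have fk: "map (f x) [0..<k] \<in> tups k" for x using f by (auto simp: tuples_def)
    define q where "q = {\<delta> \<in> pformulas M k A. eventually (\<lambda>x. holds M (map (f x) [0..<k]) \<delta>) F}"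
    have "realizations M k p\<^sub>0 \<noteq> {}" if "p\<^sub>0 \<subseteq> q" "finite p\<^sub>0" for p\<^sub>0
    proof -
      have "eventually (\<lambda>x. \<forall>\<delta>\<in>p\<^sub>0. holds M (map (f x) [0..<k]) \<delta>) F"
        using that by (intro eventually_ball_finite) (auto simp: q_def)
      then have "\<exists>x. \<forall>\<delta>\<in>p\<^sub>0. holds M (map (f x) [0..<k]) \<delta>"
        using F eventually_happens' unfolding ultrafilter_def by blast
      then show ?thesis using fk by (auto simp: realizations_def)
    qed
    moreover have "(\<phi>, b) \<in> q \<or> (Neg \<phi>, b) \<in> q" if "(\<phi>, b) \<in> pformulas M k A" for \<phi> b
    proof -
      have "(Neg \<phi>, b) \<in> pformulas M k A" using that by (auto simp: pformulas_def formulas_def)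
      moreover have "holds M w (Neg \<phi>, b) \<longleftrightarrow> \<not> holds M w (\<phi>, b)" for w by (simp add: holds_def)
      ultimately show ?thesis using that F by (auto simp: q_def ultrafilter_def)
    qed
    ultimately have q: "q \<in> types M k A" by (auto simp: types_def q_def)
    then have "realizations M k q \<noteq> {}"
      using monster A unfolding monster_def saturated_def small_def by blast
    then obtain w where w: "w \<in> tups k" "\<And>\<delta>. \<delta> \<in> q \<Longrightarrow> holds M w \<delta>" by (auto simp: realizations_def)
    have "w \<in> X" if X: "dfn k A X" "eventually (\<lambda>x. map (f x) [0..<k] \<in> X) F" for X
    proof -
      obtain \<delta> where \<delta>: "\<delta> \<in> pformulas M k A" "X = realizations M k {\<delta>}" using X unfolding definable_def by blast
      then have "\<delta> \<in> q" using X(2) by (auto simp: q_def realizations_def elim: eventually_mono)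
      then show ?thesis using w \<delta> by (auto simp: realizations_def)
    qed
    moreover have "eventually (\<lambda>x. map (f x) [0..<k] \<in> X) F" if X: "dfn k A X" "w \<in> X" for X
    proof (rule ccontr)
      assume "\<not> ?thesis"
      then have "eventually (\<lambda>x. map (f x) [0..<k] \<in> tups k - X) F"
        using ultrafilter_not[OF F] fk by simp
      then have "w \<in> tups k - X" using calculation definable_complement[OF X(1) AU] by blast
      then show False using X(2) by blast
    qed
    ultimately show ?thesis
      using w(1) by (intro exI[of _ w]) (auto simp: lim_def tuples_def)
  qed
  have step: "\<exists>a. lim (w @ [a])" if w: "lim w" for w
  proof -
    define k where "k = length w"
    obtain w' where w': "length w' = Suc k" "lim w'" using ex by blast
    let ?u = "take k w'"
    have wk: "w \<in> tups k" using w by (simp add: lim_def k_def)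
    have w't: "w' \<in> tups (Suc k)" using w' by (simp add: lim_def)
    have u: "?u \<in> tups k" using w't set_take_subset[of k w'] by (auto simp: tuples_def)
    have tk: "map (\<lambda>i. y ! i) [0..<k] = take k y" if "length y = Suc k" for y :: "'a list"
      using that by (intro nth_equalityI) auto
    have "w \<in> X" if X: "dfn k A X" "?u \<in> X" for X
    proof -
      let ?Y = "{y \<in> tups (Suc k). map (\<lambda>i. y ! id i) [0..<k] \<in> X}"
      have "dfn (Suc k) A ?Y" by (rule definable_reindex[OF X(1) _ AU]) simp
      moreover have "w' \<in> ?Y" using X(2) tk[of w'] w'(1) w't by simp
      ultimately have "eventually (\<lambda>x. map (f x) [0..<Suc k] \<in> ?Y) F"
        using w'(2) unfolding lim_def w'(1) by blast
      then have "eventually (\<lambda>x. map (f x) [0..<k] \<in> X) F"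
        by (rule eventually_mono) (use tk in \<open>auto simp del: upt_Suc simp: take_map\<close>)
      then show ?thesis using w X(1) by (simp add: lim_def k_def)
    qed
    then obtain \<sigma> where \<sigma>: "\<sigma> \<in> Aut A" "map \<sigma> ?u = w" using Aut_exists[OF u wk A] by metis
    have "w' = ?u @ [w' ! k]" using w'(1) by (metis lessI take_Suc_conv_app_nth take_all_iff order_refl)
    then have "map \<sigma> w' = w @ [\<sigma> (w' ! k)]" using \<sigma>(2) by (metis list.simps(8,9) map_append)
    moreover have "lim (map \<sigma> w')"
      using w'(2) definable_invariant[OF _ AU \<sigma>(1)] Aut_tuples[OF \<sigma>(1)]
      unfolding lim_def by auto
    ultimately show ?thesis by auto
  qed
  have "lim []" using ex[of 0] by auto
  then obtain v where v: "\<And>n. lim (map v [0..<n])" using sequence_of_prefixes[of lim] step by metis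
  have "v i \<in> U" for i using v[of "Suc i"] by (simp add: lim_def tuples_def)
  moreover have "map v [0..<k] \<in> X \<longleftrightarrow> eventually (\<lambda>x. map (f x) [0..<k] \<in> X) F"
    if "dfn k A X" for k X
    using v[of k] that unfolding lim_def by simp
  ultimately show thesis using that by blast
qed

text \<open>Arbitrary countable index types allow sequences of tuples, indexed by
  \<open>nat \<times> nat\<close>, and trees of tuples, indexed by
  \<open>nat list \<times> nat\<close>.\<close>

lemma realize_limit_type:
  fixes f :: "'x \<Rightarrow> 'i :: countable \<Rightarrow> 'a"
  assumes F: "ultrafilter F" and f: "\<And>x i. f x i \<in> U" and A: "sm A"
  obtains v :: "'i \<Rightarrow> 'a" where "\<And>i. v i \<in> U"
    "\<And>is X. dfn (length is) A X \<Longrightarrow> map v is \<in> X \<longleftrightarrow> eventually (\<lambda>x. map (f x) is \<in> X) F"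
proof -
  obtain v where v: "\<And>i. v i \<in> U" "\<And>k X. dfn k A X \<Longrightarrow> map v [0..<k] \<in> X \<longleftrightarrow>
    eventually (\<lambda>x. map (f x \<circ> from_nat) [0..<k] \<in> X) F"
    using realize_limit_type_nat[OF F _ A, of "\<lambda>x. f x \<circ> from_nat"] f by auto
  have "map (v \<circ> to_nat) is \<in> X \<longleftrightarrow> eventually (\<lambda>x. map (f x) is \<in> X) F"
    if X: "dfn (length is) A X" for "is" X
  proof -
    let ?m = "length is"
    obtain k where k: "\<And>i. i \<in> set is \<Longrightarrow> to_nat i < k"
      using finite_nat_bounded[of "to_nat ` set is"] by auto
    define g where "g j = to_nat (is ! j)" for j
    have gk: "g j < k" if "j < ?m" for j using k that by (simp add: g_def)
    let ?Y = "{y \<in> tups k. map (\<lambda>j. y ! g j) [0..<?m] \<in> X}"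
    have "dfn k A ?Y" by (rule definable_reindex[OF X gk small_subset_U[OF A]])
    from v(2)[OF this] have "map v [0..<k] \<in> ?Y \<longleftrightarrow>
      eventually (\<lambda>x. map (f x \<circ> from_nat) [0..<k] \<in> ?Y) F" .
    moreover have "map h [0..<k] \<in> ?Y \<longleftrightarrow> map (h \<circ> to_nat) is \<in> X" if "\<And>i. h i \<in> U" for h
    proof -
      have "map (\<lambda>j. map h [0..<k] ! g j) [0..<?m] = map (h \<circ> to_nat) is"
        by (rule nth_equalityI) (use gk in \<open>auto simp: g_def\<close>)
      moreover have "map h [0..<k] \<in> tups k" using that by (auto simp: tuples_def)
      ultimately show ?thesis by simp
    qed
    ultimately show ?thesis using v(1) f by (simp add: comp_def)
  qed
  then show thesis using that[of "v \<circ> to_nat"] v(1) by simp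
qed

text \<open>Compactness for small parameter sets: the limit of the identity along an ultrafilter
  that contains the family.\<close>

lemma realize_definable_sets:
  assumes "sm A" "\<And>X. X \<in> \<X> \<Longrightarrow> dfn k A X"
    and fip: "\<And>T. finite T \<Longrightarrow> T \<subseteq> \<X> \<Longrightarrow> tups k \<inter> \<Inter>T \<noteq> {}"
  obtains a where "a \<in> tups k" "\<And>X. X \<in> \<X> \<Longrightarrow> a \<in> X"
proof -
  obtain F where F: "ultrafilter F" "\<And>X. X \<in> insert (tups k) \<X> \<Longrightarrow> eventually (\<lambda>x. x \<in> X) F"
  proof (rule ultrafilter_extension[of "insert (tups k) \<X>"])
    fix T assume "finite T" "T \<subseteq> insert (tups k) \<X>"
    then show "\<Inter>T \<noteq> {}" using fip[of "T - {tups k}"] by auto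
  qed blast
  obtain u where u: "u \<in> U" using is_struct by (auto simp: is_structure_def)
  define f where "f x i = (if x \<in> tups k \<and> i < k then x ! i else u)" for x i
  have "f x i \<in> U" for x i using u by (auto simp: f_def tuples_def)
  then obtain v where v: "\<And>i. v i \<in> U"
    "\<And>k X. dfn k A X \<Longrightarrow> map v [0..<k] \<in> X \<longleftrightarrow> eventually (\<lambda>x. map (f x) [0..<k] \<in> X) F"
    using realize_limit_type_nat[OF F(1) _ assms(1), of f] by blast
  have "map v [0..<k] \<in> X" if X: "X \<in> \<X>" for X
  proof -
    have "map (f x) [0..<k] = x" if "x \<in> tups k" for x
      using that by (auto simp: f_def tuples_def intro!: nth_equalityI)
    moreover have "eventually (\<lambda>x. x \<in> X \<and> x \<in> tups k) F"
      using F(2)[of X] F(2)[of "tups k"] X eventually_conj by blast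
    ultimately have "eventually (\<lambda>x. map (f x) [0..<k] \<in> X) F"
      by (elim eventually_mono) auto
    then show ?thesis using v(2) assms(2) X by blast
  qed
  moreover have "map v [0..<k] \<in> tups k" using v(1) by (auto simp: tuples_def)
  ultimately show thesis using that by blast
qed

section \<open>Indiscernible sequences\<close>

lemma concat_map_in_tuples:
  assumes "\<And>i. i \<in> set is \<Longrightarrow> a i \<in> tups m"
  shows "concat (map a is) \<in> tups (length is * m)"
  using assms by (induction "is") (auto simp: tuples_def)

text \<open>The sequence is a limit of the subsequences \<open>a \<circ> h\<close>. By Ramsey's
  theorem an ultrafilter on increasing \<open>h\<close> can contain, for every length and every set
  \<open>X\<close>, all \<open>h\<close> homogeneous for \<open>X\<close>. The last conclusion is
  the Ehrenfeucht-Mostowski property: whatever holds of the new sequence holds somewhere in the old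
  one.\<close>

lemma indiscernible_extraction:
  fixes a :: "nat \<Rightarrow> 'a list"
  assumes a: "\<And>i. a i \<in> tups m" and A: "sm A"
  obtains a' :: "nat \<Rightarrow> 'a list" where "\<And>i. a' i \<in> tups m"
    "\<And>is js X. \<lbrakk>sorted_wrt (<) is; sorted_wrt (<) js; length js = length is; dfn (length is * m) A X;
        concat (map a' is) \<in> X\<rbrakk> \<Longrightarrow> concat (map a' js) \<in> X"
    "\<And>is X. \<lbrakk>sorted_wrt (<) is; dfn (length is * m) A X; concat (map a' is) \<in> X\<rbrakk>
      \<Longrightarrow> \<exists>js. sorted_wrt (<) js \<and> length js = length is \<and> concat (map a js) \<in> X"
proof -
  define H where "H t = {h :: nat \<Rightarrow> nat. strict_mono h \<and> (\<forall>is js. sorted_wrt (<) is \<longrightarrow>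
    sorted_wrt (<) js \<longrightarrow> length is = fst t \<longrightarrow> length js = fst t \<longrightarrow>
    (concat (map (a \<circ> h) is) \<in> snd t \<longleftrightarrow> concat (map (a \<circ> h) js) \<in> snd t))}" for t
  obtain F where F: "ultrafilter F" "\<And>t. eventually (\<lambda>h. h \<in> H t) F"
  proof (rule ultrafilter_extension[of "range H"])
    fix T assume T: "finite T" "T \<subseteq> range H"
    then obtain T' where T': "finite T'" "T = H ` T'" using finite_subset_image[OF T] by auto
    show "\<Inter>T \<noteq> {}"
    proof (rule finitely_many_Ramsey_increasing[OF T'(1), of fst "\<lambda>t is. concat (map a is) \<in> snd t"])
      fix h :: "nat \<Rightarrow> nat"
      assume h: "strict_mono h" "\<And>t is js. \<lbrakk>t \<in> T'; sorted_wrt (<) is; sorted_wrt (<) js;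
          length is = fst t; length js = fst t\<rbrakk>
        \<Longrightarrow> (concat (map a (map h is)) \<in> snd t) = (concat (map a (map h js)) \<in> snd t)"
      have "h \<in> H t" if "t \<in> T'" for t
        unfolding H_def mem_Collect_eq map_map[symmetric]
        by (intro conjI allI impI h(1)) (rule h(2)[OF that])
      then show ?thesis using T'(2) by blast
    qed
  qed blast
  obtain u where u: "u \<in> U" using is_struct by (auto simp: is_structure_def)
  define f where "f h = (\<lambda>(i, j). if j < m then a (h i) ! j else u)" for h :: "nat \<Rightarrow> nat"
  have "f h ij \<in> U" for h ij
    using a[of "h (fst ij)"] u by (auto simp: f_def tuples_def split: prod.split)
  then obtain v where v: "\<And>i. v i \<in> U"
    "\<And>is X. dfn (length is) A X \<Longrightarrow> map v is \<in> X \<longleftrightarrow> eventually (\<lambda>h. map (f h) is \<in> X) F"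
    using realize_limit_type[OF F(1) _ A, of f] by blast
  define a' where "a' i = map (\<lambda>j. v (i, j)) [0..<m]" for i
  define ix where "ix is = concat (map (\<lambda>i. map (Pair i) [0..<m]) is)" for "is" :: "nat list"
  have ix: "length (ix is) = length is * m" "map v (ix is) = concat (map a' is)"
    "map (f h) (ix is) = concat (map (a \<circ> h) is)" for "is" h
  proof -
    show "length (ix is) = length is * m" by (induction "is") (auto simp: ix_def)
    show "map v (ix is) = concat (map a' is)"
      by (induction "is") (auto simp: ix_def a'_def)
    have "map (\<lambda>j. f h (i, j)) [0..<m] = a (h i)" for i
      by (rule nth_equalityI) (use a[of "h i"] in \<open>auto simp: f_def tuples_def\<close>)
    then show "map (f h) (ix is) = concat (map (a \<circ> h) is)"
      by (induction "is") (auto simp: ix_def comp_def)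
  qed
  have lim: "concat (map a' is) \<in> X \<longleftrightarrow> eventually (\<lambda>h. concat (map (a \<circ> h) is) \<in> X) F"
    if "dfn (length is * m) A X" for "is" X
    using v(2)[of "ix is" X] that by (simp add: ix)
  have indisc: "concat (map a' is) \<in> X \<longleftrightarrow> concat (map a' js) \<in> X"
    if "is": "sorted_wrt (<) is" "sorted_wrt (<) js" "length js = length is"
      and X: "dfn (length is * m) A X" for "is" js X
  proof -
    have "eventually (\<lambda>h. concat (map (a \<circ> h) is) \<in> X \<longleftrightarrow> concat (map (a \<circ> h) js) \<in> X) F"
      using F(2)[of "(length is, X)"]
    proof (rule eventually_mono)
      fix h assume "h \<in> H (length is, X)"
      then show "concat (map (a \<circ> h) is) \<in> X \<longleftrightarrow> concat (map (a \<circ> h) js) \<in> X"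
        unfolding H_def mem_Collect_eq fst_conv snd_conv using "is" by blast
    qed
    then show ?thesis
      unfolding lim[OF X] lim[of js X, unfolded "is"(3), OF X] by (rule eventually_subst)
  qed
  have "\<exists>js. sorted_wrt (<) js \<and> length js = length is \<and> concat (map a js) \<in> X"
    if "is": "sorted_wrt (<) is" and X: "dfn (length is * m) A X" "concat (map a' is) \<in> X" for "is" X
  proof -
    \<comment> \<open>Membership in \<open>H (0, {})\<close> merely records that \<open>h\<close> is
      increasing.\<close>
    have "eventually (\<lambda>h. concat (map (a \<circ> h) is) \<in> X \<and> h \<in> H (0, {})) F"
      using lim[OF X(1)] X(2) F(2) eventually_conj by blast
    then obtain h where h: "concat (map (a \<circ> h) is) \<in> X" "h \<in> H (0, {})"
      using F(1) eventually_happens' unfolding ultrafilter_def by blast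
    then show ?thesis
      using sorted_wrt_map_strict_mono[of h "is"] "is"
      by (intro exI[of _ "map h is"]) (simp add: H_def)
  qed
  moreover have "a' i \<in> tups m" for i using v(1) by (auto simp: a'_def tuples_def)
  moreover note indisc[THEN iffD1]
  ultimately show thesis by (rule that[of a', rotated 2])
qed

text \<open>If \<open>e\<close> left a definable set containing \<open>b\<close>, so would some
  \<open>c j\<close>, although all \<open>c j\<close> are conjugate to \<open>b\<close>.\<close>

lemma extraction_conjugate:
  fixes c :: "nat \<Rightarrow> 'a list"
  assumes A: "sm A" and b: "b \<in> tups m" and e: "e \<in> tups m"
    and EM: "\<And>X. dfn m A X \<Longrightarrow> e \<in> X \<Longrightarrow> \<exists>j. c j \<in> X"
    and c: "\<And>j. \<exists>\<sigma>\<in>Aut A. map \<sigma> b = c j"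
  obtains \<tau> where "\<tau> \<in> Aut A" "map \<tau> b = e"
proof -
  have AU: "A \<subseteq> U" using small_subset_U[OF A] .
  have "e \<in> Z" if Z: "dfn m A Z" "b \<in> Z" for Z
  proof (rule ccontr)
    assume "e \<notin> Z"
    then have "\<exists>j. c j \<in> tups m - Z" using EM[OF definable_complement[OF Z(1) AU]] e by blast
    then obtain j where "c j \<notin> Z" by blast
    moreover obtain \<sigma> where "\<sigma> \<in> Aut A" "map \<sigma> b = c j" using c by blast
    ultimately show False using definable_invariant[OF Z(1) AU _ b] Z(2) by metis
  qed
  then show thesis using Aut_exists[OF b e A] that by blast
qed

lemma small_countable_set:
  assumes "countable S" "S \<subseteq> U"
  shows "sm S"
proof (cases "S = {}")
  case False
  then have "range (from_nat_into S) = S" using assms(1) by (rule range_from_nat_into)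
  then show ?thesis using small_countable[of "from_nat_into S"] assms(2) by simp
qed (simp add: small_finite)

lemma definable_swap:
  assumes "dfn (m + k) B X" "B \<subseteq> U"
  obtains Y where "dfn (k + m) B Y" "\<And>x b. x \<in> tups k \<Longrightarrow> b \<in> tups m \<Longrightarrow> x @ b \<in> Y \<longleftrightarrow> b @ x \<in> X"
proof
  define g where "g i = (if i < m then k + i else i - m)" for i
  let ?Y = "{y \<in> tups (k + m). map (\<lambda>i. y ! g i) [0..<m + k] \<in> X}"
  show "dfn (k + m) B ?Y"
    by (rule definable_reindex[OF assms(1) _ assms(2)]) (auto simp: g_def)
  fix x b assume xb: "x \<in> tups k" "b \<in> tups m"
  then have "map (\<lambda>i. (x @ b) ! g i) [0..<m + k] = b @ x"
    by (intro nth_equalityI) (auto simp: tuples_def g_def nth_append)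
  then show "x @ b \<in> ?Y \<longleftrightarrow> b @ x \<in> X" using xb by (simp add: append_in_tuples in_tuples)
qed

lemma definable_front_fibre:
  assumes "dfn (m + k) B X" "b \<in> tups m" "B \<subseteq> U"
  shows "dfn k (B \<union> set b) {x \<in> tups k. b @ x \<in> X}"
proof -
  obtain Y where Y: "dfn (k + m) B Y"
    "\<And>x b. x \<in> tups k \<Longrightarrow> b \<in> tups m \<Longrightarrow> x @ b \<in> Y \<longleftrightarrow> b @ x \<in> X"
    using definable_swap[OF assms(1,3)] by blast
  have "{x \<in> tups k. b @ x \<in> X} = {x \<in> tups k. x @ b \<in> Y}" using Y(2) assms(2) by blast
  then show ?thesis using definable_fibre[OF Y(1) assms(2,3)] by simp
qed

lemma nth_concat_blocks:
  assumes "\<forall>y\<in>set ys. length y = m" "i < length ys" "j < m"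
  shows "concat ys ! (i * m + j) = ys ! i ! j"
  using assms
proof (induction ys arbitrary: i)
  case (Cons y ys)
  then show ?case by (cases i) (auto simp: nth_append)
qed simp

text \<open>Consistency of \<open>l\<close> instances is itself a definable condition on the joined
  parameters; in this form indiscernibility, extraction and limits transfer it.\<close>

lemma definable_common_point:
  assumes "dfn (k + m) B Y" "B \<subseteq> U"
  obtains Z where "dfn (l * m) B Z"
    "\<And>ys. \<lbrakk>length ys = l; set ys \<subseteq> tups m\<rbrakk> \<Longrightarrow>
      concat ys \<in> Z \<longleftrightarrow> (\<exists>x\<in>tups k. \<forall>y\<in>set ys. x @ y \<in> Y)"
proof
  \<comment> \<open>Position of the \<open>j\<close>-th entry of \<open>x @ ys ! i\<close> inside
    \<open>concat ys @ x\<close>; the common \<open>x\<close> comes last so that projection removes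
    it.\<close>
  define g where "g i j = (if j < k then l * m + j else i * m + (j - k))" for i j
  have g: "g i j < l * m + k" if "i < l" "j < k + m" for i j
  proof (cases "j < k")
    case False
    then have "i * m + (j - k) < Suc i * m" using that by auto
    also have "\<dots> \<le> l * m" using that(1) mult_le_mono1 Suc_leI by blast
    finally show ?thesis using False by (simp add: g_def)
  qed (simp add: g_def)
  let ?V = "\<lambda>i. {w \<in> tups (l * m + k). map (\<lambda>j. w ! g i j) [0..<k + m] \<in> Y}"
  let ?W = "tups (l * m + k) \<inter> (\<Inter>i\<in>{..<l}. ?V i)"
  let ?Z = "{z \<in> tups (l * m). \<exists>x\<in>tups k. z @ x \<in> ?W}"
  have "dfn (l * m + k) B ?W"
    using definable_reindex[OF assms(1) _ assms(2)] g assms(2)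
    by (intro definable_INT) auto
  then show "dfn (l * m) B ?Z" using definable_project assms(2) by blast
  fix ys assume ys: "length ys = l" "set ys \<subseteq> tups m"
  have len: "\<forall>y\<in>set ys. length y = m" using ys by (auto simp: tuples_def)
  have c: "concat ys \<in> tups (l * m)"
    using concat_map_in_tuples[of ys id m] ys by auto
  have "concat ys @ x \<in> ?W \<longleftrightarrow> (\<forall>y\<in>set ys. x @ y \<in> Y)" if x: "x \<in> tups k" for x
  proof -
    have "map (\<lambda>j. (concat ys @ x) ! g i j) [0..<k + m] = x @ ys ! i" if i: "i < l" for i
    proof (rule nth_equalityI)
      have leni: "length (ys ! i) = m" using len i ys(1) by auto
      then show "length (map (\<lambda>j. (concat ys @ x) ! g i j) [0..<k + m]) = length (x @ ys ! i)"
        using x by (simp add: tuples_def)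
      fix j assume "j < length (map (\<lambda>j. (concat ys @ x) ! g i j) [0..<k + m])"
      then have j: "j < k + m" by simp
      have "(concat ys @ x) ! g i j = (x @ ys ! i) ! j"
      proof (cases "j < k")
        case True
        then show ?thesis using c x by (simp add: g_def nth_append tuples_def)
      next
        case False
        then have jm: "j - k < m" using j by auto
        have "i * m + (j - k) < l * m" using g[OF i j] False jm mult_le_mono1[of "Suc i" l m] i by simp
        then have "(concat ys @ x) ! g i j = concat ys ! (i * m + (j - k))"
          using c False by (simp add: g_def nth_append tuples_def)
        also have "\<dots> = ys ! i ! (j - k)" using nth_concat_blocks[OF len _ jm] i ys(1) by simp
        finally show ?thesis using False x by (simp add: nth_append tuples_def)
      qed
      then show "map (\<lambda>j. (concat ys @ x) ! g i j) [0..<k + m] ! j = (x @ ys ! i) ! j"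
        using j by simp
    qed
    moreover have "concat ys @ x \<in> tups (l * m + k)" using c x by (auto simp: tuples_def)
    ultimately have "concat ys @ x \<in> ?W \<longleftrightarrow> (\<forall>i<l. x @ ys ! i \<in> Y)" by auto
    then show ?thesis using ys(1) by (auto simp: all_set_conv_all_nth)
  qed
  then show "concat ys \<in> ?Z \<longleftrightarrow> (\<exists>x\<in>tups k. \<forall>y\<in>set ys. x @ y \<in> Y)" using c by blast
qed

section \<open>Dividing\<close>

text \<open>Dividing as a property of definable sets: by homogeneity, replacing the parameters by conjugates
  over \<open>A\<close> amounts to moving the set by automorphisms over \<open>A\<close>.\<close>

definition sdiv :: "'a set \<Rightarrow> nat \<Rightarrow> 'a list set \<Rightarrow> bool" where
  "sdiv A r X \<longleftrightarrow> (\<exists>\<sigma> :: nat \<Rightarrow> 'a \<Rightarrow> 'a. (\<forall>i. \<sigma> i \<in> Aut A) \<and>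
    (\<forall>I. finite I \<and> card I = r \<longrightarrow> (\<Inter>i\<in>I. map (\<sigma> i) ` X) = {}))"

text \<open>Dependence is dividing, not forking; \<open>fork_imp_dep\<close> later shows that in a
  simple theory nothing is lost.\<close>

definition dep :: "'a set \<Rightarrow> 'a list \<Rightarrow> 'a set \<Rightarrow> bool" where
  "dep A a B \<longleftrightarrow> (\<exists>X r. dfn (length a) (A \<union> B) X \<and> a \<in> X \<and> sdiv A r X)"

lemma sdivE:
  assumes "sdiv A r X"
  obtains \<sigma> :: "nat \<Rightarrow> 'a \<Rightarrow> 'a" where "\<And>i. \<sigma> i \<in> Aut A"
    "\<And>I. finite I \<Longrightarrow> card I = r \<Longrightarrow> (\<Inter>i\<in>I. map (\<sigma> i) ` X) = {}"
proof -
  from assms obtain \<sigma> :: "nat \<Rightarrow> 'a \<Rightarrow> 'a" where \<sigma>: "\<forall>i. \<sigma> i \<in> Aut A"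
    "\<forall>I. finite I \<and> card I = r \<longrightarrow> (\<Inter>i\<in>I. map (\<sigma> i) ` X) = {}"
    unfolding sdiv_def by (elim exE conjE)
  show thesis by (rule that[of \<sigma>]) (use \<sigma> in simp_all)
qed

lemma sdivI:
  fixes \<sigma> :: "nat \<Rightarrow> 'a \<Rightarrow> 'a"
  assumes "\<And>i. \<sigma> i \<in> Aut A"
    "\<And>I. finite I \<Longrightarrow> card I = r \<Longrightarrow> (\<Inter>i\<in>I. map (\<sigma> i) ` X) = {}"
  shows "sdiv A r X"
  unfolding sdiv_def using assms by (intro exI[of _ \<sigma>]) simp

lemma sdiv_antimono: "sdiv A' r X \<Longrightarrow> A \<subseteq> A' \<Longrightarrow> sdiv A r X"
  unfolding sdiv_def using Aut_antimono by (meson subsetD)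

text \<open>An empty index set has intersection \<open>UNIV\<close>, which rules out
  \<open>r = 0\<close>.\<close>

lemma sdiv_pos: "sdiv A r X \<Longrightarrow> 0 < r"
  by (rule ccontr) (auto elim!: sdivE)

lemma sdiv_image:
  assumes "sdiv A r X" "\<sigma> \<in> Aut A" "A \<subseteq> U" "X \<subseteq> tups k"
  shows "sdiv A r (map \<sigma> ` X)"
proof -
  obtain \<rho> :: "nat \<Rightarrow> 'a \<Rightarrow> 'a" where \<rho>: "\<And>i. \<rho> i \<in> Aut A"
    "\<And>I. finite I \<Longrightarrow> card I = r \<Longrightarrow> (\<Inter>i\<in>I. map (\<rho> i) ` X) = {}"
    using assms(1) by (rule sdivE) blast
  obtain \<tau> where \<tau>: "\<tau> \<in> Aut A" "\<And>x k. x \<in> tups k \<Longrightarrow> map \<tau> (map \<sigma> x) = x"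
    using Aut_inverse[OF assms(2,3)] by metis
  have "map (\<rho> i \<circ> \<tau>) ` map \<sigma> ` X = map (\<rho> i) ` X" for i
  proof -
    have "map (\<rho> i \<circ> \<tau>) (map \<sigma> x) = map (\<rho> i) x" if "x \<in> X" for x
      using \<tau>(2)[of x k] that assms(4) by (metis map_map subsetD)
    then show ?thesis unfolding image_image by (rule image_cong[OF refl])
  qed
  then show ?thesis
    using \<rho>(2) Aut_comp[OF \<rho>(1) \<tau>(1)] by (intro sdivI[of "\<lambda>i. \<rho> i \<circ> \<tau>"]) simp_all
qed

lemma definable_image:
  assumes "dfn k (A \<union> set b) X" "\<sigma> \<in> Aut A" "A \<subseteq> U" "set b \<subseteq> U"
  shows "dfn k (A \<union> \<sigma> ` set b) (map \<sigma> ` X)"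
proof -
  obtain Y where Y: "dfn (k + length b) A Y" "X = {x \<in> tups k. x @ b \<in> Y}"
    using definable_as_fibre[OF assms(1,3,4)] by blast
  have b: "b \<in> tups (length b)" using assms(4) by (simp add: tuples_def)
  have "map \<sigma> ` X = {x \<in> tups k. x @ map \<sigma> b \<in> Y}"
    unfolding Y(2) by (rule image_fibre[OF Y(1) assms(3,2) b])
  then show ?thesis
    using definable_fibre[OF Y(1) Aut_tuples[OF assms(2) b] assms(3)] by simp
qed

text \<open>A set dividing over a larger base divides over a smaller one, so the base may shrink
  while the total set of parameters grows.\<close>

lemma dep_mono:
  assumes "dep A' a B'" "A \<subseteq> A'" "A' \<union> B' \<subseteq> A \<union> B"
  shows "dep A a B"
  using assms sdiv_antimono definable_mono unfolding dep_def by meson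

lemma dep_subset: "dep A a B' \<Longrightarrow> B' \<subseteq> B \<Longrightarrow> dep A a B"
  by (erule dep_mono) auto

lemma dep_finite:
  assumes "dep A a B"
  obtains b where "set b \<subseteq> B" "dep A a (set b)"
  using assms definable_finite_support unfolding dep_def by metis

text \<open>Automorphisms over \<open>A\<close> preserve every \<open>A\<close>-definable set, so a
  nonempty one never has conjugates with empty intersection.\<close>

lemma not_dep_base:
  assumes "A \<subseteq> U" "B \<subseteq> A"
  shows "\<not> dep A a B"
proof
  assume "dep A a B"
  then obtain X r where X: "dfn (length a) A X" "a \<in> X" "sdiv A r X"
    using assms(2) by (auto simp: dep_def Un_absorb2)
  obtain \<sigma> :: "nat \<Rightarrow> 'a \<Rightarrow> 'a" where \<sigma>: "\<And>i. \<sigma> i \<in> Aut A"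
    "\<And>I. finite I \<Longrightarrow> card I = r \<Longrightarrow> (\<Inter>i\<in>I. map (\<sigma> i) ` X) = {}"
    using X(3) by (rule sdivE) blast
  have "a \<in> (\<Inter>i\<in>{..<r}. map (\<sigma> i) ` X)"
    using image_definable_fixed[OF X(1) assms(1) \<sigma>(1)] X(2) by simp
  then show False using \<sigma>(2)[of "{..<r}"] by simp
qed

lemma dep_Aut:
  assumes "dep A a B" "\<sigma> \<in> Aut A" "A \<subseteq> U" "B \<subseteq> U"
  shows "dep A (map \<sigma> a) (\<sigma> ` B)"
proof -
  obtain b where b: "set b \<subseteq> B" "dep A a (set b)" using dep_finite[OF assms(1)] .
  then obtain X r where X: "dfn (length a) (A \<union> set b) X" "a \<in> X" "sdiv A r X"
    by (auto simp: dep_def)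
  have "dfn (length (map \<sigma> a)) (A \<union> \<sigma> ` set b) (map \<sigma> ` X)"
    using definable_image[OF X(1) assms(2,3)] b(1) assms(4) by simp
  moreover have "sdiv A r (map \<sigma> ` X)"
    by (rule sdiv_image[OF X(3) assms(2,3) definable_subset_tuples[OF X(1)]])
  ultimately have "dep A (map \<sigma> a) (\<sigma> ` set b)" unfolding dep_def using X(2) by blast
  then show ?thesis by (rule dep_subset) (use b(1) in blast)
qed

text \<open>A witness of dividing may be taken indiscernible over \<open>A\<close>; the non-dividing type of \<open>c\<close> over
  \<open>A \<union> set b\<close> is then realized by one tuple simultaneously along the whole witness.\<close>

lemma sdiv_extend_base:
  assumes A: "sm A" and b: "b \<in> tups m" and c: "c \<in> tups l"
    and X: "dfn k (A \<union> set b) X" "sdiv A r X" and nd: "\<not> dep A c (set b)"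
  shows "sdiv (A \<union> set c) r X"
proof -
  have AU: "A \<subseteq> U" using A by (rule small_subset_U)
  have lenb: "length b = m" and bU: "set b \<subseteq> U" using b by (auto simp: tuples_def)
  obtain Y where Y: "dfn (k + m) A Y" "X = {x \<in> tups k. x @ b \<in> Y}"
    using definable_as_fibre[OF X(1) AU bU] lenb by blast
  obtain \<sigma> :: "nat \<Rightarrow> 'a \<Rightarrow> 'a" where \<sigma>: "\<And>i. \<sigma> i \<in> Aut A"
    "\<And>I. finite I \<Longrightarrow> card I = r \<Longrightarrow> (\<Inter>i\<in>I. map (\<sigma> i) ` X) = {}"
    using X(2) by (rule sdivE) blast
  have img: "map \<rho> ` X = {x \<in> tups k. x @ map \<rho> b \<in> Y}" if "\<rho> \<in> Aut A" for \<rho>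
    unfolding Y(2) by (rule image_fibre[OF Y(1) AU that b])
  define b' where "b' i = map (\<sigma> i) b" for i
  have b': "b' i \<in> tups m" for i using Aut_tuples[OF \<sigma>(1) b] by (simp add: b'_def)
  obtain a' :: "nat \<Rightarrow> 'a list" where a': "\<And>i. a' i \<in> tups m"
    and indisc: "\<And>is js X. \<lbrakk>sorted_wrt (<) is; sorted_wrt (<) js; length js = length is;
        dfn (length is * m) A X; concat (map a' is) \<in> X\<rbrakk> \<Longrightarrow> concat (map a' js) \<in> X"
    and EM: "\<And>is X. \<lbrakk>sorted_wrt (<) is; dfn (length is * m) A X; concat (map a' is) \<in> X\<rbrakk>
      \<Longrightarrow> \<exists>js. sorted_wrt (<) js \<and> length js = length is \<and> concat (map b' js) \<in> X"
    using indiscernible_extraction[of b' m A, OF b' A] by blast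
  have "\<exists>\<tau>\<in>Aut A. map \<tau> b = a' i" for i
  proof -
    have "\<exists>j. b' j \<in> Z" if "dfn m A Z" "a' i \<in> Z" for Z
    proof -
      have "\<exists>js. sorted_wrt (<) js \<and> length js = length [i] \<and> concat (map b' js) \<in> Z"
        by (intro EM) (use that in simp_all)
      then show ?thesis by (auto simp: length_Suc_conv)
    qed
    moreover have "\<exists>\<sigma>\<in>Aut A. map \<sigma> b = b' j" for j using \<sigma>(1) by (auto simp: b'_def)
    ultimately show ?thesis using extraction_conjugate[of A b m "a' i" b', OF A b a'] by blast
  qed
  then obtain \<tau> where \<tau>: "\<And>i. \<tau> i \<in> Aut A" "\<And>i. map (\<tau> i) b = a' i" by metis
  have sorted_list: "sorted_wrt (<) (sorted_list_of_set I)" "length (sorted_list_of_set I) = card I"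
    "finite I \<Longrightarrow> set (sorted_list_of_set I) = I" for I :: "nat set"
    by (auto simp: strict_sorted_list_of_set)
  \<comment> \<open>The extracted sequence still witnesses dividing with the same \<open>r\<close>:
    a point common to \<open>r\<close> of its instances would give one for \<open>r\<close>
    instances of the \<open>b' j\<close>.\<close>
  have incons: False if I: "finite I" "card I = r" and x: "x \<in> tups k" "\<And>i. i \<in> I \<Longrightarrow> x @ a' i \<in> Y" for I x
  proof -
    obtain Z where Z: "dfn (r * m) A Z" "\<And>ys. \<lbrakk>length ys = r; set ys \<subseteq> tups m\<rbrakk> \<Longrightarrow>
      concat ys \<in> Z \<longleftrightarrow> (\<exists>x\<in>tups k. \<forall>y\<in>set ys. x @ y \<in> Y)"
      using definable_common_point[OF Y(1) AU, of r] by blast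
    let ?is = "sorted_list_of_set I"
    have "concat (map a' ?is) \<in> Z"
      using Z(2)[of "map a' ?is"] x a' I sorted_list[of I] by auto
    then obtain js where js: "sorted_wrt (<) js" "length js = r" "concat (map b' js) \<in> Z"
      using EM[of ?is Z] Z(1) sorted_list[of I] I by auto
    then obtain y where y: "y \<in> tups k" "\<And>j. j \<in> set js \<Longrightarrow> y @ b' j \<in> Y"
      using Z(2)[of "map b' js"] b' by auto
    have "y \<in> (\<Inter>j\<in>set js. map (\<sigma> j) ` X)" using y img[OF \<sigma>(1)] by (auto simp: b'_def)
    moreover have "card (set js) = r" using js strict_sorted_iff distinct_card by metis
    ultimately show False using \<sigma>(2)[of "set js"] by auto
  qed
  define g where "g iW = {z \<in> tups l. z @ a' (fst iW) \<in> snd iW}" for iW :: "nat \<times> 'a list set"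
  define \<X> where "\<X> = g ` {iW. dfn (l + m) A (snd iW) \<and> c @ b \<in> snd iW}"
  let ?D = "A \<union> (\<Union>i. set (a' i))"
  have "sm (\<Union>i. set (a' i))"
    using a' by (intro small_countable_set) (auto simp: tuples_def countable_finite)
  then have D: "sm ?D" using A small_Un by blast
  obtain z where z: "z \<in> tups l" "\<And>X. X \<in> \<X> \<Longrightarrow> z \<in> X"
  proof (rule realize_definable_sets[OF D, of \<X> l])
    fix X assume "X \<in> \<X>"
    then obtain i W where W: "dfn (l + m) A W" "X = {z \<in> tups l. z @ a' i \<in> W}" by (auto simp: \<X>_def g_def)
    show "dfn l ?D X" unfolding W(2)
      by (rule definable_mono[OF definable_fibre[OF W(1) a' AU]]) blast
  next
    fix T assume T: "finite T" "T \<subseteq> \<X>"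
    then obtain P where P: "finite P" "P \<subseteq> {iW. dfn (l + m) A (snd iW) \<and> c @ b \<in> snd iW}" "T = g ` P"
      unfolding \<X>_def by (meson finite_subset_image)
    define W where "W = tups (l + m) \<inter> (\<Inter>iW\<in>P. snd iW)"
    have W: "dfn (l + m) A W" unfolding W_def by (rule definable_INT[OF P(1) _ AU]) (use P(2) in blast)
    have cbW: "c @ b \<in> W" using P(2) b c by (auto simp: W_def tuples_def)
    obtain N' where N': "\<And>iW. iW \<in> P \<Longrightarrow> fst iW < N'"
      using finite_nat_bounded[of "fst ` P"] P(1) by auto
    \<comment> \<open>The successor keeps \<open>N\<close> positive, so that the index sets
      \<open>I\<close> below are nonempty.\<close>
    define N where "N = Suc N'"
    obtain Z where Z: "dfn (N * m) A Z" "\<And>ys. \<lbrakk>length ys = N; set ys \<subseteq> tups m\<rbrakk> \<Longrightarrow>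
      concat ys \<in> Z \<longleftrightarrow> (\<exists>x\<in>tups l. \<forall>y\<in>set ys. x @ y \<in> W)"
      using definable_common_point[OF W AU, of N] by blast
    have "concat (map a' [0..<N]) \<in> Z"
    proof (rule ccontr)
      \<comment> \<open>By indiscernibility any \<open>N\<close> instances are then inconsistent, so
        the fibre of \<open>W\<close> over \<open>b\<close>, which contains \<open>c\<close>,
        divides over \<open>A\<close>.\<close>
      assume not: "concat (map a' [0..<N]) \<notin> Z"
      let ?X = "{z \<in> tups l. z @ b \<in> W}"
      have imgW: "map \<rho> ` ?X = {x \<in> tups l. x @ map \<rho> b \<in> W}" if "\<rho> \<in> Aut A" for \<rho>
        by (rule image_fibre[OF W AU that b])
      have "(\<Inter>i\<in>I. map (\<tau> i) ` ?X) = {}" if I: "finite I" "card I = N" for I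
      proof (rule ccontr)
        assume "\<not> ?thesis"
        then obtain z where z: "\<And>i. i \<in> I \<Longrightarrow> z \<in> map (\<tau> i) ` ?X" by auto
        have "I \<noteq> {}" using I by (auto simp: N_def)
        then have "z \<in> tups l" using z imgW[OF \<tau>(1)] by blast
        moreover have "z @ a' i \<in> W" if "i \<in> I" for i using z[OF that] imgW[OF \<tau>(1)] \<tau>(2) by auto
        ultimately have "concat (map a' (sorted_list_of_set I)) \<in> Z"
          using Z(2)[of "map a' (sorted_list_of_set I)"] a' I sorted_list[of I] by auto
        then show False
          using indisc[of "sorted_list_of_set I" "[0..<N]" Z] Z(1) not sorted_list[of I] I by simp
      qed
      with \<tau>(1) have "sdiv A N ?X" by (rule sdivI)
      moreover have "dfn (length c) (A \<union> set b) ?X"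
        using definable_fibre[OF W b AU] c by (simp add: tuples_def)
      ultimately show False using nd cbW c unfolding dep_def by blast
    qed
    then have "\<exists>x\<in>tups l. \<forall>y\<in>set (map a' [0..<N]). x @ y \<in> W"
      using Z(2)[of "map a' [0..<N]"] a' by (simp add: image_subset_iff)
    then obtain z where z: "z \<in> tups l" "\<And>i. i < N \<Longrightarrow> z @ a' i \<in> W" by auto
    have "z \<in> g iW" if "iW \<in> P" for iW
      using z(1) z(2)[of "fst iW"] N'[OF that] that by (auto simp: W_def N_def g_def)
    then show "tups l \<inter> \<Inter>T \<noteq> {}" using z(1) P(3) by blast
  qed blast
  have "\<exists>\<rho>\<in>Aut A. map \<rho> (c @ b) = z @ a' i" for i
  proof -
    have "z @ a' i \<in> W" if "dfn (l + m) A W" "c @ b \<in> W" for W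
    proof -
      have "g (i, W) \<in> \<X>" using that by (simp add: \<X>_def)
      then have "z \<in> g (i, W)" by (rule z(2))
      then show ?thesis by (simp add: g_def)
    qed
    moreover have "c @ b \<in> tups (l + m)" "z @ a' i \<in> tups (l + m)"
      using b c z(1) a'[of i] by (auto simp: tuples_def)
    ultimately show ?thesis using Aut_exists[OF _ _ A] by metis
  qed
  then obtain \<rho> :: "nat \<Rightarrow> 'a \<Rightarrow> 'a" where \<rho>: "\<And>i. \<rho> i \<in> Aut A" "\<And>i. map (\<rho> i) (c @ b) = z @ a' i" by metis
  have \<rho>': "map (\<rho> i) c = z" "map (\<rho> i) b = a' i" for i
    using \<rho>(2)[of i] z(1) c by (auto simp: tuples_def append_eq_append_conv)
  \<comment> \<open>All \<open>\<rho> i\<close> send \<open>c\<close> to \<open>z\<close>, and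
    \<open>\<theta>\<close> undoes \<open>\<rho> 0\<close>; hence
    \<open>\<theta> \<circ> \<rho> i\<close> fixes \<open>c\<close> while the moved sets stay
    \<open>r\<close>-inconsistent.\<close>
  obtain \<theta> where \<theta>: "\<theta> \<in> Aut A" "\<And>x k. x \<in> tups k \<Longrightarrow> map \<theta> (map (\<rho> 0) x) = x"
    "\<And>x k. x \<in> tups k \<Longrightarrow> map (\<rho> 0) (map \<theta> x) = x"
    using Aut_inverse[OF \<rho>(1) AU] by metis
  have "\<theta> \<circ> \<rho> i \<in> Aut (A \<union> set c)" for i
  proof -
    have "map (\<theta> \<circ> \<rho> i) c = map (\<theta> \<circ> \<rho> 0) c" using \<rho>'(1) by (metis map_map)
    also have "\<dots> = c" using \<theta>(2)[OF c] by simp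
    finally have "\<forall>x\<in>set c. (\<theta> \<circ> \<rho> i) x = x" by (metis map_eq_conv map_ident)
    then show ?thesis using Aut_comp[OF \<theta>(1) \<rho>(1)] unfolding Aut_def by blast
  qed
  moreover have "(\<Inter>i\<in>I. map (\<theta> \<circ> \<rho> i) ` X) = {}" if I: "finite I" "card I = r" for I
  proof (rule ccontr)
    assume "\<not> ?thesis"
    then obtain y where y: "\<And>i. i \<in> I \<Longrightarrow> y \<in> map (\<theta> \<circ> \<rho> i) ` X" by auto
    have *: "map (\<rho> 0) y \<in> tups k \<and> map (\<rho> 0) y @ a' i \<in> Y" if "i \<in> I" for i
    proof -
      obtain x where x: "x \<in> X" "y = map \<theta> (map (\<rho> i) x)" using y[OF \<open>i \<in> I\<close>] by auto
      have "map (\<rho> i) x \<in> {x \<in> tups k. x @ a' i \<in> Y}" using img[OF \<rho>(1), of i] x(1) \<rho>'(2)[of i] by force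
      then show ?thesis using x(2) \<theta>(3)[of "map (\<rho> i) x" k] by (simp del: map_map)
    qed
    have "I \<noteq> {}" using I sdiv_pos[OF X(2)] by auto
    then show False using incons[OF I, of "map (\<rho> 0) y"] * by blast
  qed
  ultimately show ?thesis by (rule sdivI)
qed

text \<open>Left transitivity. As \<open>b\<close> does not depend on \<open>d\<close>, a set over
  \<open>d\<close> that divides over \<open>A\<close> still divides over
  \<open>A \<union> set b\<close>; there its fibre above \<open>b\<close> divides and contains
  \<open>c\<close>.\<close>

lemma not_dep_append:
  assumes A: "sm A" and b: "b \<in> tups m" and c: "c \<in> tups l" and d: "d \<in> tups h"
    and nb: "\<not> dep A b (set d)" and nc: "\<not> dep (A \<union> set b) c (set d)"
  shows "\<not> dep A (b @ c) (set d)"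
proof
  assume "dep A (b @ c) (set d)"
  then obtain X r where X: "dfn (m + l) (A \<union> set d) X" "b @ c \<in> X" "sdiv A r X"
    using b c by (auto simp: dep_def tuples_def)
  have U: "A \<union> set d \<subseteq> U" using small_subset_U[OF A] d by (auto simp: tuples_def)
  obtain \<sigma> :: "nat \<Rightarrow> 'a \<Rightarrow> 'a" where \<sigma>: "\<And>i. \<sigma> i \<in> Aut (A \<union> set b)"
    "\<And>I. finite I \<Longrightarrow> card I = r \<Longrightarrow> (\<Inter>i\<in>I. map (\<sigma> i) ` X) = {}"
    using sdiv_extend_base[OF A d b X(1,3) nb] by (rule sdivE) blast
  let ?X = "{z \<in> tups l. b @ z \<in> X}"
  have "(\<Inter>i\<in>I. map (\<sigma> i) ` ?X) = {}" if I: "finite I" "card I = r" for I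
  proof (rule ccontr)
    assume "\<not> ?thesis"
    then obtain z where z: "\<And>i. i \<in> I \<Longrightarrow> z \<in> map (\<sigma> i) ` ?X" by auto
    have "b @ z \<in> map (\<sigma> i) ` X" if "i \<in> I" for i
    proof -
      obtain y where y: "b @ y \<in> X" "z = map (\<sigma> i) y" using z[OF \<open>i \<in> I\<close>] by auto
      have "map (\<sigma> i) b = b" using Aut_fix[OF \<sigma>(1)] by simp
      then have "b @ z = map (\<sigma> i) (b @ y)" using y(2) by simp
      then show ?thesis using y(1) by blast
    qed
    then show False using \<sigma>(2)[OF I] by blast
  qed
  with \<sigma>(1) have "sdiv (A \<union> set b) r ?X" by (rule sdivI)
  moreover have "dfn (length c) (A \<union> set b \<union> set d) ?X"
    using definable_front_fibre[OF X(1) b U] c by (simp add: tuples_def ac_simps)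
  ultimately show False using nc X(2) c unfolding dep_def by blast
qed

section \<open>The rank of a definable set\<close>

text \<open>A local rank in the style of Shelah, with sets and inconsistency numbers drawn from
  \<open>T\<close>. Conjugates under \<open>Aut {}\<close> stand for instances of a formula at
  parameters of the same type over the empty set.\<close>

primrec rank_ge :: "('a list set \<times> nat) set \<Rightarrow> nat \<Rightarrow> 'a list set \<Rightarrow> bool" where
  "rank_ge T 0 X \<longleftrightarrow> X \<noteq> {}"
| "rank_ge T (Suc n) X \<longleftrightarrow> (\<exists>X\<^sub>0 r. \<exists>\<sigma> :: nat \<Rightarrow> 'a \<Rightarrow> 'a. (X\<^sub>0, r) \<in> T \<and> (\<forall>j. \<sigma> j \<in> Aut {}) \<and>
    (\<forall>I. finite I \<and> card I = r \<longrightarrow> (\<Inter>j\<in>I. map (\<sigma> j) ` X\<^sub>0) = {}) \<and>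
    (\<forall>j. rank_ge T n (X \<inter> map (\<sigma> j) ` X\<^sub>0)))"

lemma rank_ge_SucE:
  assumes "rank_ge T (Suc n) X"
  obtains X\<^sub>0 r and \<sigma> :: "nat \<Rightarrow> 'a \<Rightarrow> 'a" where "(X\<^sub>0, r) \<in> T" "\<And>j. \<sigma> j \<in> Aut {}"
    "\<And>I. finite I \<Longrightarrow> card I = r \<Longrightarrow> (\<Inter>j\<in>I. map (\<sigma> j) ` X\<^sub>0) = {}"
    "\<And>j. rank_ge T n (X \<inter> map (\<sigma> j) ` X\<^sub>0)"
proof -
  from assms obtain X\<^sub>0 r and \<sigma> :: "nat \<Rightarrow> 'a \<Rightarrow> 'a" where *: "(X\<^sub>0, r) \<in> T" "\<forall>j. \<sigma> j \<in> Aut {}"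
    "\<forall>I. finite I \<and> card I = r \<longrightarrow> (\<Inter>j\<in>I. map (\<sigma> j) ` X\<^sub>0) = {}"
    "\<forall>j. rank_ge T n (X \<inter> map (\<sigma> j) ` X\<^sub>0)"
    unfolding rank_ge.simps by (elim exE conjE)
  show thesis by (rule that[of X\<^sub>0 r \<sigma>]) (use * in simp_all)
qed

text \<open>\<open>r\<close>-inconsistency survives restriction to an infinite index set, which is
  then reindexed by its enumeration.\<close>

lemma rank_ge_SucI:
  fixes \<sigma> :: "nat \<Rightarrow> 'a \<Rightarrow> 'a"
  assumes "(X\<^sub>0, r) \<in> T" "\<And>j. \<sigma> j \<in> Aut {}"
    "\<And>I. finite I \<Longrightarrow> card I = r \<Longrightarrow> (\<Inter>j\<in>I. map (\<sigma> j) ` X\<^sub>0) = {}"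
    and J: "infinite J" "\<And>j. j \<in> J \<Longrightarrow> rank_ge T n (X \<inter> map (\<sigma> j) ` X\<^sub>0)"
  shows "rank_ge T (Suc n) X"
proof -
  let ?h = "enumerate J"
  have "(\<Inter>j\<in>I. map (\<sigma> (?h j)) ` X\<^sub>0) = {}" if I: "finite I" "card I = r" for I
  proof -
    have "card (?h ` I) = r" using I(2) card_image[OF inj_on_subset[OF inj_enumerate[OF J(1)]], of I] by simp
    then have "(\<Inter>j\<in>?h ` I. map (\<sigma> j) ` X\<^sub>0) = {}" using assms(3) I(1) by blast
    then show ?thesis by simp
  qed
  moreover have "rank_ge T n (X \<inter> map (\<sigma> (?h j)) ` X\<^sub>0)" for j
    using J(2) enumerate_in_set[OF J(1)] by blast
  ultimately have "(X\<^sub>0, r) \<in> T \<and> (\<forall>j. (\<sigma> \<circ> ?h) j \<in> Aut {}) \<and>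
    (\<forall>I. finite I \<and> card I = r \<longrightarrow> (\<Inter>j\<in>I. map ((\<sigma> \<circ> ?h) j) ` X\<^sub>0) = {}) \<and>
    (\<forall>j. rank_ge T n (X \<inter> map ((\<sigma> \<circ> ?h) j) ` X\<^sub>0))"
    using assms(1,2) by simp
  then show ?thesis unfolding rank_ge.simps by (intro exI)
qed

lemma rank_ge_mono: "rank_ge T n X \<Longrightarrow> X \<subseteq> X' \<Longrightarrow> rank_ge T n X'"
proof (induction n arbitrary: X X')
  case (Suc n)
  obtain X\<^sub>0 r and \<sigma> :: "nat \<Rightarrow> 'a \<Rightarrow> 'a" where \<sigma>: "(X\<^sub>0, r) \<in> T" "\<And>j. \<sigma> j \<in> Aut {}"
    "\<And>I. finite I \<Longrightarrow> card I = r \<Longrightarrow> (\<Inter>j\<in>I. map (\<sigma> j) ` X\<^sub>0) = {}"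
    "\<And>j. rank_ge T n (X \<inter> map (\<sigma> j) ` X\<^sub>0)"
    using rank_ge_SucE[OF Suc.prems(1)] by blast
  show ?case
  proof (rule rank_ge_SucI[of X\<^sub>0 r T \<sigma> UNIV])
    show "rank_ge T n (X' \<inter> map (\<sigma> j) ` X\<^sub>0)" for j
      using \<sigma>(4)[of j] by (rule Suc.IH) (use Suc.prems(2) in blast)
  qed (use \<sigma> in auto)
qed auto

lemma rank_ge_nonempty: "rank_ge T n X \<Longrightarrow> X \<noteq> {}"
proof (induction n arbitrary: X)
  case (Suc n)
  obtain X\<^sub>0 r and \<sigma> :: "nat \<Rightarrow> 'a \<Rightarrow> 'a" where "(X\<^sub>0, r) \<in> T" "\<And>j. \<sigma> j \<in> Aut {}"
    "\<And>I. finite I \<Longrightarrow> card I = r \<Longrightarrow> (\<Inter>j\<in>I. map (\<sigma> j) ` X\<^sub>0) = {}"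
    and *: "\<And>j. rank_ge T n (X \<inter> map (\<sigma> j) ` X\<^sub>0)"
    using rank_ge_SucE[OF Suc.prems(1)] by blast
  show ?case using Suc.IH[OF *] by blast
qed simp

text \<open>One of the two parts inherits the rank from infinitely many of the conjugates.\<close>

lemma rank_ge_Un: "rank_ge T n (X \<union> X') \<Longrightarrow> rank_ge T n X \<or> rank_ge T n X'"
proof (induction n arbitrary: X X')
  case (Suc n)
  obtain X\<^sub>0 r and \<sigma> :: "nat \<Rightarrow> 'a \<Rightarrow> 'a" where \<sigma>: "(X\<^sub>0, r) \<in> T" "\<And>j. \<sigma> j \<in> Aut {}"
    "\<And>I. finite I \<Longrightarrow> card I = r \<Longrightarrow> (\<Inter>j\<in>I. map (\<sigma> j) ` X\<^sub>0) = {}"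
    "\<And>j. rank_ge T n ((X \<union> X') \<inter> map (\<sigma> j) ` X\<^sub>0)"
    using rank_ge_SucE[OF Suc.prems] by blast
  let ?J = "\<lambda>X. {j. rank_ge T n (X \<inter> map (\<sigma> j) ` X\<^sub>0)}"
  have "?J X \<union> ?J X' = UNIV" using \<sigma>(4) Suc.IH by (force simp: Int_Un_distrib2)
  then have "infinite (?J X) \<or> infinite (?J X')"
    by (metis finite_Un infinite_UNIV_nat)
  then show ?case
    using rank_ge_SucI[OF \<sigma>(1-3), of "?J X" n X] rank_ge_SucI[OF \<sigma>(1-3), of "?J X'" n X'] by blast
qed auto

lemma rank_ge_UN:
  assumes "finite I" "rank_ge T n (\<Union>i\<in>I. X i)"
  shows "\<exists>i\<in>I. rank_ge T n (X i)"
  using assms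
proof (induction I rule: finite_induct)
  case empty
  then show ?case using rank_ge_nonempty[of T n "{}"] by simp
next
  case (insert i I)
  then show ?case using rank_ge_Un[of T n "X i" "\<Union>i\<in>I. X i"] by auto
qed

text \<open>Reduces finitely many pairs to one by the pigeonhole principle: in a splitting of depth
  \<open>\<Sum>t\<in>T. f t\<close> some pair \<open>t\<close> must be usable \<open>f t\<close>
  times.\<close>

lemma rank_ge_single:
  assumes "finite T" "T \<noteq> {}" "rank_ge T (\<Sum>t\<in>T. f t) X"
  shows "\<exists>t\<in>T. rank_ge {t} (f t) X"
  using assms(3)
proof (induction "\<Sum>t\<in>T. f t" arbitrary: f X)
  case 0
  then obtain t where "t \<in> T" "f t = 0" using assms(1,2) by auto
  moreover have "X \<noteq> {}" using 0(2) rank_ge_nonempty by blast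
  ultimately show ?case by force
next
  case (Suc N)
  have "rank_ge T (Suc N) X" using Suc(2,3) by simp
  then obtain X\<^sub>0 r and \<sigma> :: "nat \<Rightarrow> 'a \<Rightarrow> 'a" where \<sigma>: "(X\<^sub>0, r) \<in> T" "\<And>j. \<sigma> j \<in> Aut {}"
    "\<And>I. finite I \<Longrightarrow> card I = r \<Longrightarrow> (\<Inter>j\<in>I. map (\<sigma> j) ` X\<^sub>0) = {}"
    "\<And>j. rank_ge T N (X \<inter> map (\<sigma> j) ` X\<^sub>0)"
    using rank_ge_SucE by blast
  let ?t = "(X\<^sub>0, r)"
  show ?case
  proof (cases "f ?t")
    case 0
    then have "rank_ge {?t} (f ?t) X" using Suc(3) rank_ge_nonempty[OF Suc(3)] by simp
    then show ?thesis using \<sigma>(1) by blast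
  next
    case (Suc l)
    \<comment> \<open>The first splitting uses the pair \<open>?t\<close>, so one unit of the depth
      demanded of it is spent.\<close>
    define f' where "f' = f(?t := l)"
    have "(\<Sum>t\<in>T. f t) = f ?t + (\<Sum>t\<in>T - {?t}. f t)" "(\<Sum>t\<in>T. f' t) = l + (\<Sum>t\<in>T - {?t}. f' t)"
      using assms(1) \<sigma>(1) by (simp_all add: sum.remove f'_def)
    moreover have "(\<Sum>t\<in>T - {?t}. f t) = (\<Sum>t\<in>T - {?t}. f' t)"
      by (rule sum.cong) (auto simp: f'_def)
    ultimately have N: "N = (\<Sum>t\<in>T. f' t)" using Suc \<open>Suc N = sum f T\<close> by simp
    have "\<exists>t\<in>T. rank_ge {t} (f' t) (X \<inter> map (\<sigma> j) ` X\<^sub>0)" for j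
      using Suc.hyps(1)[OF N] \<sigma>(4)[of j] N by simp
    then obtain g where g: "\<And>j. g j \<in> T" "\<And>j. rank_ge {g j} (f' (g j)) (X \<inter> map (\<sigma> j) ` X\<^sub>0)" by metis
    \<comment> \<open>The pair may vary with the conjugate, but infinitely many conjugates agree on
      it.\<close>
    have "finite (range g)" using g(1) assms(1) by (meson finite_subset image_subsetI)
    then obtain j\<^sub>0 where "infinite {j \<in> UNIV. g j = g j\<^sub>0}"
      using pigeonhole_infinite[of UNIV g] infinite_UNIV_nat by blast
    then obtain t where t: "infinite {j. g j = t}" by simp
    have r: "rank_ge {t} (f' t) (X \<inter> map (\<sigma> j) ` X\<^sub>0)" if "j \<in> {j. g j = t}" for j using g(2)[of j] that by simp
    show ?thesis
    proof (cases "t = ?t")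
      case True
      then have "rank_ge {?t} l (X \<inter> map (\<sigma> j) ` X\<^sub>0)" if "j \<in> {j. g j = t}" for j
        using r[OF that] by (simp add: f'_def)
      then have "rank_ge {?t} (Suc l) X" using rank_ge_SucI[of X\<^sub>0 r "{?t}" \<sigma>, OF _ \<sigma>(2,3) t] by blast
      then show ?thesis using \<sigma>(1) Suc by (metis)
    next
      case False
      obtain j where j: "g j = t" using t not_finite_existsD by blast
      then have "rank_ge {t} (f t) (X \<inter> map (\<sigma> j) ` X\<^sub>0)" using r[of j] False by (simp add: f'_def)
      then have "rank_ge {t} (f t) X" by (rule rank_ge_mono) blast
      then show ?thesis using g(1)[of j] j by blast
    qed
  qed
qed

lemma rank_ge_image:
  assumes "\<tau> \<in> Aut {}" "\<And>X\<^sub>0 r. (X\<^sub>0, r) \<in> T \<Longrightarrow> X\<^sub>0 \<subseteq> tups k"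
  shows "rank_ge T n X \<Longrightarrow> X \<subseteq> tups k \<Longrightarrow> rank_ge T n (map \<tau> ` X)"
proof (induction n arbitrary: X)
  case (Suc n)
  obtain X\<^sub>0 r and \<sigma> :: "nat \<Rightarrow> 'a \<Rightarrow> 'a" where \<sigma>: "(X\<^sub>0, r) \<in> T" "\<And>j. \<sigma> j \<in> Aut {}"
    "\<And>I. finite I \<Longrightarrow> card I = r \<Longrightarrow> (\<Inter>j\<in>I. map (\<sigma> j) ` X\<^sub>0) = {}"
    "\<And>j. rank_ge T n (X \<inter> map (\<sigma> j) ` X\<^sub>0)"
    using rank_ge_SucE[OF Suc.prems(1)] by blast
  obtain \<theta> where \<theta>: "\<And>x k. x \<in> tups k \<Longrightarrow> map \<theta> (map \<tau> x) = x"
    using Aut_inverse[OF assms(1)] by (metis empty_subsetI)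
  have X0: "map (\<sigma> j) ` X\<^sub>0 \<subseteq> tups k" for j using assms(2)[OF \<sigma>(1)] Aut_tuples[OF \<sigma>(2)] by blast
  have eq: "map (\<tau> \<circ> \<sigma> j) ` X\<^sub>0 = map \<tau> ` map (\<sigma> j) ` X\<^sub>0" for j by (simp add: image_image)
  show ?case
  proof (rule rank_ge_SucI[of X\<^sub>0 r T "\<lambda>j. \<tau> \<circ> \<sigma> j" UNIV])
    show "\<tau> \<circ> \<sigma> j \<in> Aut {}" for j using Aut_comp[OF assms(1) \<sigma>(2)] .
    show "(\<Inter>j\<in>I. map (\<tau> \<circ> \<sigma> j) ` X\<^sub>0) = {}" if I: "finite I" "card I = r" for I
    proof (rule ccontr)
      assume "\<not> ?thesis"
      then obtain y where y: "\<And>j. j \<in> I \<Longrightarrow> y \<in> map \<tau> ` map (\<sigma> j) ` X\<^sub>0" unfolding eq by auto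
      have "map \<theta> y \<in> map (\<sigma> j) ` X\<^sub>0" if j: "j \<in> I" for j
      proof -
        obtain x where x: "x \<in> map (\<sigma> j) ` X\<^sub>0" "y = map \<tau> x" using y[OF j] by blast
        then have "map \<theta> y = x" using \<theta> X0 by blast
        then show ?thesis using x(1) by simp
      qed
      then show False using \<sigma>(3)[OF I] by blast
    qed
    show "rank_ge T n (map \<tau> ` X \<inter> map (\<tau> \<circ> \<sigma> j) ` X\<^sub>0)" for j
      using Suc.IH[OF \<sigma>(4)[of j]] Suc.prems(2) image_Int_tuples[OF assms(1) Suc.prems(2) X0[of j]]
      unfolding eq by auto
  qed (use \<sigma>(1) in auto)
qed simp

text \<open>Unfolding the rank gives the tree property up to height \<open>n\<close>: the children
  of a node carry the parameters of the conjugates used at that level.\<close>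

lemma rank_ge_tree:
  assumes "dfn (k + m) {} Y" "b \<in> tups m"
  shows "rank_ge {({x \<in> tups k. x @ b \<in> Y}, r)} n X \<Longrightarrow>
    \<exists>t :: nat list \<Rightarrow> 'a list. (\<forall>s. t s \<in> tups m) \<and>
      (\<forall>s. length s < n \<longrightarrow> (\<forall>I. finite I \<longrightarrow> card I = r \<longrightarrow> \<not> (\<exists>x\<in>tups k. \<forall>i\<in>I. x @ t (s @ [i]) \<in> Y))) \<and>
      (\<forall>s. length s = n \<longrightarrow> (\<exists>x\<in>X. \<forall>j\<in>{1..n}. x @ t (take j s) \<in> Y))"
proof (induction n arbitrary: X)
  case 0
  then show ?case using assms(2) by (intro exI[of _ "\<lambda>_. b"]) auto
next
  case (Suc n)
  let ?X = "{x \<in> tups k. x @ b \<in> Y}"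
  obtain \<sigma> :: "nat \<Rightarrow> 'a \<Rightarrow> 'a" where \<sigma>: "\<And>j. \<sigma> j \<in> Aut {}"
    "\<And>I. finite I \<Longrightarrow> card I = r \<Longrightarrow> (\<Inter>j\<in>I. map (\<sigma> j) ` ?X) = {}"
    "\<And>j. rank_ge {(?X, r)} n (X \<inter> map (\<sigma> j) ` ?X)"
    by (rule rank_ge_SucE[OF Suc.prems]) blast
  have img: "map (\<sigma> j) ` ?X = {x \<in> tups k. x @ map (\<sigma> j) b \<in> Y}" for j
    by (rule image_fibre[OF assms(1) _ \<sigma>(1) assms(2)]) simp
  let ?good = "\<lambda>j t. (\<forall>s. t s \<in> tups m) \<and>
      (\<forall>s. length s < n \<longrightarrow> (\<forall>I. finite I \<longrightarrow> card I = r \<longrightarrow> \<not> (\<exists>x\<in>tups k. \<forall>i\<in>I. x @ t (s @ [i]) \<in> Y))) \<and>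
      (\<forall>s. length s = n \<longrightarrow> (\<exists>x\<in>X \<inter> map (\<sigma> j) ` ?X. \<forall>j\<in>{1..n}. x @ t (take j s) \<in> Y))"
  have "\<forall>j. \<exists>t :: nat list \<Rightarrow> 'a list. ?good j t" using Suc.IH[OF \<sigma>(3)] by blast
  then have "\<exists>t :: nat \<Rightarrow> nat list \<Rightarrow> 'a list. \<forall>j. ?good j (t j)" by (rule choice)
  then obtain t :: "nat \<Rightarrow> nat list \<Rightarrow> 'a list" where "\<forall>j. ?good j (t j)" by (rule exE)
  then have t: "?good j (t j)" for j by (rule spec)
  \<comment> \<open>The root carries the filler \<open>b\<close>, the node \<open>[i]\<close> the
    \<open>i\<close>-th conjugate of \<open>b\<close>, and the nodes below it the tree obtained
    inside that conjugate.\<close>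
  define t' where "t' s = (case s of [] \<Rightarrow> b | i # s' \<Rightarrow> if s' = [] then map (\<sigma> i) b else t i s')" for s
  show ?case
  proof (intro exI[of _ t'] conjI allI impI)
    show "t' s \<in> tups m" for s
      using t assms(2) Aut_tuples[OF \<sigma>(1) assms(2)] by (auto simp: t'_def split: list.split)
  next
    fix s :: "nat list" and I :: "nat set" assume s: "length s < Suc n" and I: "finite I" "card I = r"
    show "\<not> (\<exists>x\<in>tups k. \<forall>i\<in>I. x @ t' (s @ [i]) \<in> Y)"
    proof (cases s)
      case Nil
      show ?thesis
      proof
        assume "\<exists>x\<in>tups k. \<forall>i\<in>I. x @ t' (s @ [i]) \<in> Y"
        then obtain x where "x \<in> tups k" "\<And>i. i \<in> I \<Longrightarrow> x @ t' (s @ [i]) \<in> Y" by blast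
        then have "x \<in> (\<Inter>j\<in>I. map (\<sigma> j) ` ?X)" unfolding img by (simp add: Nil t'_def)
        then show False unfolding \<sigma>(2)[OF I] by simp
      qed
    next
      case (Cons i s')
      then have "t' (s @ [j]) = t i (s' @ [j])" for j by (simp add: t'_def)
      then show ?thesis using t[of i] s I Cons by auto
    qed
  next
    fix s :: "nat list" assume s: "length s = Suc n"
    then obtain i s' where s': "s = i # s'" "length s' = n" by (auto simp: length_Suc_conv)
    have "\<exists>x\<in>X \<inter> map (\<sigma> i) ` ?X. \<forall>j\<in>{1..n}. x @ t i (take j s') \<in> Y"
      using t[of i, THEN conjunct2, THEN conjunct2, rule_format, OF s'(2)] .
    then obtain x where x: "x \<in> X \<inter> map (\<sigma> i) ` ?X" "\<And>j. j \<in> {1..n} \<Longrightarrow> x @ t i (take j s') \<in> Y"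
      by (elim bexE) simp
    have "x @ t' (take j s) \<in> Y" if j: "j \<in> {1..Suc n}" for j
    proof (cases "j = 1")
      case True
      then show ?thesis using x(1) unfolding img by (simp add: s' t'_def)
    next
      case False
      then obtain j' where j': "j = Suc j'" "j' \<in> {1..n}" using j by (cases j) auto
      then have "take j' s' \<noteq> []" using s'(2) by auto
      then show ?thesis using x(2)[OF j'(2)] by (simp add: s' t'_def j')
    qed
    then show "\<exists>x\<in>X. \<forall>j\<in>{1..Suc n}. x @ t' (take j s) \<in> Y" using x(1) by blast
  qed
qed

lemma realizations_fibre:
  assumes "(\<phi>, b) \<in> pformulas M k U"
  obtains Y where "dfn (k + length b) {} Y"
    "\<And>b'. b' \<in> tups (length b) \<Longrightarrow> realizations M k {(\<phi>, b')} = {x \<in> tups k. x @ b' \<in> Y}"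
    "\<And>x b'. \<lbrakk>x \<in> tups k; b' \<in> tups (length b)\<rbrakk> \<Longrightarrow> holds M x (\<phi>, b') \<longleftrightarrow> x @ b' \<in> Y"
proof
  let ?Y = "realizations M (k + length b) {(\<phi>, [])}"
  have "(\<phi>, []) \<in> pformulas M (k + length b) {}" using assms by (auto simp: pformulas_def)
  then show "dfn (k + length b) {} ?Y" unfolding definable_def by blast
  show *: "holds M x (\<phi>, b') \<longleftrightarrow> x @ b' \<in> ?Y" if "x \<in> tups k" "b' \<in> tups (length b)" for x b'
    using that by (auto simp: realizations_def holds_def tuples_def)
  show "realizations M k {(\<phi>, b')} = {x \<in> tups k. x @ b' \<in> ?Y}" if "b' \<in> tups (length b)" for b'
    using *[OF _ that] by (auto simp: realizations_def)
qed

end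

section \<open>Finiteness of the rank in simple theories\<close>

locale simple_monster = monster_model +
  assumes simple: "simple_theory M"
begin

text \<open>Trees of all finite heights are joined to one of infinite height by a limit along an
  ultrafilter containing all tails.\<close>

lemma rank_finite:
  assumes "dfn k U X"
  shows "\<exists>n. \<not> rank_ge {(X, r)} n (tups k)"
proof (rule ccontr)
  assume "\<not> ?thesis"
  then have R: "\<And>n. rank_ge {(X, r)} n (tups k)" by blast
  obtain \<phi> b where \<delta>: "(\<phi>, b) \<in> pformulas M k U" "X = realizations M k {(\<phi>, b)}"
    using assms by (auto simp: definable_def)
  define m where "m = length b"
  obtain Y where Y: "dfn (k + m) {} Y"
    "\<And>b'. b' \<in> tups m \<Longrightarrow> realizations M k {(\<phi>, b')} = {x \<in> tups k. x @ b' \<in> Y}"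
    and holds: "\<And>x b'. \<lbrakk>x \<in> tups k; b' \<in> tups m\<rbrakk> \<Longrightarrow> holds M x (\<phi>, b') \<longleftrightarrow> x @ b' \<in> Y"
    using realizations_fibre[OF \<delta>(1)] unfolding m_def by blast
  have b: "b \<in> tups m" using \<delta>(1) by (auto simp: pformulas_def tuples_def m_def)
  let ?good = "\<lambda>n t. (\<forall>s. t s \<in> tups m) \<and>
      (\<forall>s. length s < n \<longrightarrow> (\<forall>I. finite I \<longrightarrow> card I = r \<longrightarrow> \<not> (\<exists>x\<in>tups k. \<forall>i\<in>I. x @ t (s @ [i]) \<in> Y))) \<and>
      (\<forall>s. length s = n \<longrightarrow> (\<exists>x\<in>tups k. \<forall>j\<in>{1..n}. x @ t (take j s) \<in> Y))"
  have "\<forall>n. \<exists>t :: nat list \<Rightarrow> 'a list. ?good n t"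
    using rank_ge_tree[OF Y(1) b R[unfolded \<delta>(2) Y(2)[OF b]]] by (rule allI)
  then have "\<exists>t :: nat \<Rightarrow> nat list \<Rightarrow> 'a list. \<forall>n. ?good n (t n)" by (rule choice)
  then obtain t :: "nat \<Rightarrow> nat list \<Rightarrow> 'a list" where "\<forall>n. ?good n (t n)" by (rule exE)
  then have good: "?good n (t n)" for n by (rule spec)
  have t: "t n s \<in> tups m" for n s using good[of n] by blast
  obtain F where F: "ultrafilter F" "\<And>X. X \<in> range (\<lambda>n::nat. {n..}) \<Longrightarrow> eventually (\<lambda>n. n \<in> X) F"
  proof (rule ultrafilter_extension[of "range (\<lambda>n::nat. {n..})"])
    fix T assume T: "finite T" "T \<subseteq> range (\<lambda>n::nat. {n..})"
    then obtain P where "finite P" "T = (\<lambda>n. {n..}) ` P" by (meson finite_subset_image)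
    moreover then obtain N where "\<And>n. n \<in> P \<Longrightarrow> n < N" using finite_nat_bounded[of P] by auto
    ultimately have "N \<in> \<Inter>T" by (auto simp: less_imp_le)
    then show "\<Inter>T \<noteq> {}" by blast
  qed blast
  have ev: "eventually (\<lambda>n. N \<le> n) F" for N using F(2)[of "{N..}"] by simp
  obtain u where u: "u \<in> U" using is_struct by (auto simp: is_structure_def)
  define f where "f n = (\<lambda>(s, j). if j < m then t n s ! j else u)" for n
  have "f n sj \<in> U" for n sj
    using t[of n "fst sj"] u by (auto simp: f_def tuples_def split: prod.split)
  then obtain v where v: "\<And>i. v i \<in> U"
    "\<And>is X. dfn (length is) {} X \<Longrightarrow> map v is \<in> X \<longleftrightarrow> eventually (\<lambda>n. map (f n) is \<in> X) F"
    using realize_limit_type[OF F(1) _ small_finite[of "{}"], of f] by blast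
  define b' where "b' s = map (\<lambda>j. v (s, j)) [0..<m]" for s
  have b': "b' s \<in> tups m" for s using v(1) by (auto simp: b'_def tuples_def)
  define ix where "ix ss = concat (map (\<lambda>s. map (Pair s) [0..<m]) ss)" for ss :: "nat list list"
  have ix: "length (ix ss) = length ss * m" "map v (ix ss) = concat (map b' ss)"
    "map (f n) (ix ss) = concat (map (t n) ss)" for ss n
  proof -
    show "length (ix ss) = length ss * m" by (induction ss) (auto simp: ix_def)
    show "map v (ix ss) = concat (map b' ss)" by (induction ss) (auto simp: ix_def b'_def)
    have "map (\<lambda>j. f n (s, j)) [0..<m] = t n s" for s
      by (rule nth_equalityI) (use t[of n s] in \<open>auto simp: f_def tuples_def\<close>)
    then show "map (f n) (ix ss) = concat (map (t n) ss)"
      by (induction ss) (auto simp: ix_def comp_def)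
  qed
  \<comment> \<open>Used in both directions: from left to right it keeps siblings inconsistent, from
    right to left it keeps branches consistent.\<close>
  have lim: "(\<exists>x\<in>tups k. \<forall>s\<in>set ss. x @ b' s \<in> Y) \<longleftrightarrow>
    eventually (\<lambda>n. \<exists>x\<in>tups k. \<forall>s\<in>set ss. x @ t n s \<in> Y) F" for ss
  proof -
    obtain Z where Z: "dfn (length ss * m) {} Z" "\<And>ys. \<lbrakk>length ys = length ss; set ys \<subseteq> tups m\<rbrakk> \<Longrightarrow>
      concat ys \<in> Z \<longleftrightarrow> (\<exists>x\<in>tups k. \<forall>y\<in>set ys. x @ y \<in> Y)"
      using definable_common_point[OF Y(1), of "length ss"] by blast
    have "concat (map b' ss) \<in> Z \<longleftrightarrow> eventually (\<lambda>n. concat (map (t n) ss) \<in> Z) F"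
      using v(2)[of "ix ss" Z] Z(1) by (simp add: ix)
    moreover have "concat (map w ss) \<in> Z \<longleftrightarrow> (\<exists>x\<in>tups k. \<forall>s\<in>set ss. x @ w s \<in> Y)"
      if "\<And>s. w s \<in> tups m" for w
      using Z(2)[of "map w ss"] that by (simp add: image_subset_iff)
    ultimately show ?thesis using b' t by simp
  qed
  have "inconsistent_family M k r \<phi> (\<lambda>i. b' (s @ [i]))" for s
    unfolding inconsistent_family_def
  proof (intro allI impI, rule ccontr)
    fix I :: "nat set" assume I: "finite I \<and> card I = r"
      and "realizations M k ((\<lambda>i. (\<phi>, b' (s @ [i]))) ` I) \<noteq> {}"
    then obtain x where "x \<in> tups k" "\<And>i. i \<in> I \<Longrightarrow> x @ b' (s @ [i]) \<in> Y"
      using holds b' by (auto simp: realizations_def)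
    then have "\<exists>x\<in>tups k. \<forall>s\<in>set (map (\<lambda>i. s @ [i]) (sorted_list_of_set I)). x @ b' s \<in> Y"
      using I by auto
    then have "eventually (\<lambda>n. \<exists>x\<in>tups k. \<forall>s\<in>set (map (\<lambda>i. s @ [i]) (sorted_list_of_set I)). x @ t n s \<in> Y) F"
      unfolding lim .
    then have "eventually (\<lambda>n. (\<exists>x\<in>tups k. \<forall>i\<in>I. x @ t n (s @ [i]) \<in> Y) \<and> Suc (length s) \<le> n) F"
      using ev[of "Suc (length s)"] I by (auto intro: eventually_conj)
    then have "\<exists>n. (\<exists>x\<in>tups k. \<forall>i\<in>I. x @ t n (s @ [i]) \<in> Y) \<and> Suc (length s) \<le> n"
      using F(1) eventually_happens' unfolding ultrafilter_def by blast
    then obtain n where "\<exists>x\<in>tups k. \<forall>i\<in>I. x @ t n (s @ [i]) \<in> Y" "length s < n"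
      by (metis Suc_le_lessD)
    then show False using good[of n] I by blast
  qed
  moreover have "realizations M k ((\<lambda>n. (\<phi>, b' (map \<sigma> [0..<Suc n]))) ` {..<N}) \<noteq> {}" for \<sigma> N
  proof -
    let ?ss = "map (\<lambda>n. map \<sigma> [0..<Suc n]) [0..<N]"
    have "eventually (\<lambda>n. \<exists>x\<in>tups k. \<forall>s\<in>set ?ss. x @ t n s \<in> Y) F"
      using ev[of N]
    proof (rule eventually_mono)
      fix n assume n: "N \<le> n"
      obtain x where x: "x \<in> tups k" "\<And>j. j \<in> {1..n} \<Longrightarrow> x @ t n (take j (map \<sigma> [0..<n])) \<in> Y"
      proof -
        have "length (map \<sigma> [0..<n]) = n" by simp
        then have "\<exists>x\<in>tups k. \<forall>j\<in>{1..n}. x @ t n (take j (map \<sigma> [0..<n])) \<in> Y"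
          using good[of n] by blast
        then show thesis using that by blast
      qed
      have "x @ t n (map \<sigma> [0..<Suc i]) \<in> Y" if "i < N" for i
        using x(2)[of "Suc i"] that n by (simp add: take_map del: upt_Suc)
      then show "\<exists>x\<in>tups k. \<forall>s\<in>set ?ss. x @ t n s \<in> Y" by (intro bexI[OF _ x(1)]) auto
    qed
    then have "\<exists>x\<in>tups k. \<forall>s\<in>set ?ss. x @ b' s \<in> Y" unfolding lim .
    then obtain x where x: "x \<in> tups k" "\<And>n. n < N \<Longrightarrow> x @ b' (map \<sigma> [0..<Suc n]) \<in> Y"
      by (auto simp del: upt_Suc)
    then have "x \<in> realizations M k ((\<lambda>n. (\<phi>, b' (map \<sigma> [0..<Suc n]))) ` {..<N})"
      using holds b' by (auto simp: realizations_def simp del: upt_Suc)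
    then show ?thesis by blast
  qed
  ultimately have "tree_property M k m \<phi>"
    unfolding tree_property_def using b' by blast
  moreover have "\<phi> \<in> formulas M" "fv \<phi> \<subseteq> {..<k + m}" using \<delta>(1) by (auto simp: pformulas_def m_def)
  ultimately show False using simple unfolding simple_theory_def by blast
qed

lemma rank_finite_family:
  assumes "finite T" "\<And>X r. (X, r) \<in> T \<Longrightarrow> dfn k U X"
  shows "\<exists>n. \<not> rank_ge T n (tups k)"
proof (cases "T = {}")
  case True
  then have "\<not> rank_ge T (Suc 0) (tups k)" by simp
  then show ?thesis by blast
next
  case False
  have "\<forall>t\<in>T. \<exists>n. \<not> rank_ge {t} n (tups k)" using rank_finite assms(2) by force
  then obtain f where "\<And>t. t \<in> T \<Longrightarrow> \<not> rank_ge {t} (f t) (tups k)" by metis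
  then show ?thesis using rank_ge_single[OF assms(1) False, of f] by blast
qed

end

context monster_model
begin

section \<open>Forking\<close>

definition fork :: "'a set \<Rightarrow> 'a list \<Rightarrow> 'a set \<Rightarrow> bool" where
  "fork A a B \<longleftrightarrow> (\<exists>X \<X>. dfn (length a) (A \<union> B) X \<and> a \<in> X \<and> finite \<X> \<and>
    (\<forall>Z\<in>\<X>. dfn (length a) U Z \<and> (\<exists>r. sdiv A r Z)) \<and> X \<subseteq> \<Union>\<X>)"

text \<open>The extension property, the reason for passing from dividing to forking: compactness
  could fail only if finitely many dividing sets covered a set of the type.\<close>

lemma extend_not_fork:
  assumes A: "sm (A \<union> B)" and E: "sm E" and a: "a \<in> tups k" and nf: "\<not> fork A a B"
  obtains \<sigma> where "\<sigma> \<in> Aut (A \<union> B)" "\<not> dep A (map \<sigma> a) E"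
proof -
  have AU: "A \<union> B \<subseteq> U" and EU: "E \<subseteq> U" using small_subset_U A E by auto
  have lena: "length a = k" using a by (simp add: tuples_def)
  define \<X>1 where "\<X>1 = {X. dfn k (A \<union> B) X \<and> a \<in> X}"
  define \<D> where "\<D> = {Z. dfn k (A \<union> E) Z \<and> (\<exists>r. sdiv A r Z)}"
  let ?D = "A \<union> B \<union> E"
  have D: "sm ?D" "?D \<subseteq> U" using small_Un[OF A E] AU EU by auto
  obtain a' where a': "a' \<in> tups k" "\<And>X. X \<in> \<X>1 \<union> (\<lambda>Z. tups k - Z) ` \<D> \<Longrightarrow> a' \<in> X"
  proof (rule realize_definable_sets[OF D(1), of "\<X>1 \<union> (\<lambda>Z. tups k - Z) ` \<D>" k])
    fix X assume "X \<in> \<X>1 \<union> (\<lambda>Z. tups k - Z) ` \<D>"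
    then show "dfn k ?D X"
    proof
      assume "X \<in> \<X>1"
      then show ?thesis unfolding \<X>1_def using definable_mono[of M k "A \<union> B" X ?D] by blast
    next
      assume "X \<in> (\<lambda>Z. tups k - Z) ` \<D>"
      then obtain Z where "dfn k (A \<union> E) Z" "X = tups k - Z" by (auto simp: \<D>_def)
      then show ?thesis using definable_mono[of M k "A \<union> E" Z ?D] definable_complement D(2) by blast
    qed
  next
    fix T assume T: "finite T" "T \<subseteq> \<X>1 \<union> (\<lambda>Z. tups k - Z) ` \<D>"
    have "finite (T - \<X>1)" "T - \<X>1 \<subseteq> (\<lambda>Z. tups k - Z) ` \<D>" using T by auto
    then obtain \<Z> where \<Z>: "\<Z> \<subseteq> \<D>" "finite \<Z>" "T - \<X>1 = (\<lambda>Z. tups k - Z) ` \<Z>"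
      using finite_subset_image[of "T - \<X>1" "\<lambda>Z. tups k - Z" \<D>] by metis
    let ?X = "tups k \<inter> (\<Inter>X\<in>T \<inter> \<X>1. X)"
    have "dfn k (A \<union> B) ?X"
      using T(1) AU by (intro definable_INT) (auto simp: \<X>1_def)
    moreover have "a \<in> ?X" using a by (auto simp: \<X>1_def)
    moreover have "dfn k U Z \<and> (\<exists>r. sdiv A r Z)" if "Z \<in> \<Z>" for Z
      using \<Z>(1) that definable_mono[of M k "A \<union> E" Z U] AU EU by (auto simp: \<D>_def)
    ultimately have "\<not> ?X \<subseteq> \<Union>\<Z>" using nf \<Z>(2) unfolding fork_def lena by metis
    then obtain x where x: "x \<in> ?X" "x \<notin> \<Union>\<Z>" by blast
    have "x \<in> X" if "X \<in> T" for X
    proof (cases "X \<in> \<X>1")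
      case False
      then have "X \<in> (\<lambda>Z. tups k - Z) ` \<Z>" using that \<Z>(3) by blast
      then show ?thesis using x by blast
    qed (use x(1) that in blast)
    then show "tups k \<inter> \<Inter>T \<noteq> {}" using x(1) by blast
  qed blast
  have "a' \<in> X" if "dfn k (A \<union> B) X" "a \<in> X" for X using a'(2)[of X] that by (simp add: \<X>1_def)
  then obtain \<sigma> where \<sigma>: "\<sigma> \<in> Aut (A \<union> B)" "map \<sigma> a = a'" using Aut_exists[OF a a'(1) A] by blast
  have "\<not> dep A a' E"
  proof
    assume "dep A a' E"
    then obtain X where "a' \<in> X" "X \<in> \<D>" using a'(1) by (auto simp: dep_def \<D>_def tuples_def)
    then show False using a'(2)[of "tups k - X"] by blast
  qed
  then show thesis using that \<sigma> by blast
qed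

text \<open>Iterated extension yields an independent sequence of conjugates, the kind of sequence to
  which \<open>Kim\<close> applies.\<close>

lemma not_fork_sequence:
  assumes A: "sm (A \<union> B)" and a: "a \<in> tups k" and nf: "\<not> fork A a B"
  obtains \<sigma> :: "nat \<Rightarrow> 'a \<Rightarrow> 'a" where "\<And>i. \<sigma> i \<in> Aut (A \<union> B)"
    "\<And>i. \<not> dep A (map (\<sigma> i) a) (\<Union>j<i. set (map (\<sigma> j) a))"
proof -
  define P where "P w \<longleftrightarrow> (\<forall>i<length w. w ! i \<in> Aut (A \<union> B) \<and>
    \<not> dep A (map (w ! i) a) (\<Union>j<i. set (map (w ! j) a)))" for w
  have "\<exists>\<tau>. P (w @ [\<tau>])" if P: "P w" for w
  proof -
    have "sm (\<Union>j<length w. set (map (w ! j) a))"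
    proof (rule small_finite)
      show "(\<Union>j<length w. set (map (w ! j) a)) \<subseteq> U"
        using P Aut_tuples[OF _ a] unfolding P_def in_tuples by blast
    qed simp
    then obtain \<tau> where "\<tau> \<in> Aut (A \<union> B)" "\<not> dep A (map \<tau> a) (\<Union>j<length w. set (map (w ! j) a))"
      using extend_not_fork[OF A _ a nf] by blast
    then have "P (w @ [\<tau>])" using P unfolding P_def by (auto simp: nth_append less_Suc_eq)
    then show ?thesis by blast
  qed
  moreover have "P []" by (simp add: P_def)
  ultimately obtain \<sigma> where \<sigma>: "\<And>n. P (map \<sigma> [0..<n])" using sequence_of_prefixes[of P] by blast
  have "\<sigma> i \<in> Aut (A \<union> B)" "\<not> dep A (map (\<sigma> i) a) (\<Union>j<i. set (map (\<sigma> j) a))" for i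
    using \<sigma>[of "Suc i"] by (auto simp: P_def nth_append simp flip: upt_Suc_append simp del: upt_Suc)
  then show thesis using that by blast
qed

lemma not_dep_Nil: "\<not> dep A [] B"
proof
  assume "dep A [] B"
  then obtain X r where X: "[] \<in> X" "sdiv A r X" by (auto simp: dep_def)
  obtain \<sigma> :: "nat \<Rightarrow> 'a \<Rightarrow> 'a" where "\<And>i. \<sigma> i \<in> Aut A"
    "\<And>I. finite I \<Longrightarrow> card I = r \<Longrightarrow> (\<Inter>i\<in>I. map (\<sigma> i) ` X) = {}"
    using X(2) by (rule sdivE) blast
  then have "(\<Inter>i\<in>{..<r}. map (\<sigma> i) ` X) = {}" by simp
  moreover have "[] \<in> map (\<sigma> i) ` X" for i using X(1) by force
  ultimately show False by blast
qed

text \<open>Left transitivity adjoins the later tuples one at a time. This reversal of order is a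
  substitute for symmetry, which is derived from it by way of \<open>Kim\<close>.\<close>

lemma not_dep_tail:
  assumes A: "sm A" and e: "\<And>j. j < n \<Longrightarrow> e j \<in> tups m"
    and nd: "\<And>j. j < n \<Longrightarrow> \<not> dep A (e j) (\<Union>l<j. set (e l))" and "i < n"
  shows "\<not> dep A (concat (map e [Suc i..<n])) (set (e i))"
proof -
  have "\<not> dep A (concat (map e [Suc i..<Suc i + l])) (set (e i))" if "Suc i + l \<le> n" for l
    using that
  proof (induction l)
    case 0
    then show ?case using not_dep_Nil by simp
  next
    case (Suc l)
    let ?b = "concat (map e [Suc i..<Suc i + l])" and ?j = "Suc i + l"
    have j: "?j < n" using Suc.prems by simp
    have b: "?b \<in> tups (length [Suc i..<Suc i + l] * m)"
      by (rule concat_map_in_tuples) (use e j in force)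
    have "\<not> dep (A \<union> set ?b) (e ?j) (set (e i))"
    proof
      assume "dep (A \<union> set ?b) (e ?j) (set (e i))"
      then have "dep A (e ?j) (\<Union>l<?j. set (e l))" by (rule dep_mono) auto
      then show False using nd[OF j] by blast
    qed
    then have "\<not> dep A (?b @ e ?j) (set (e i))"
      using not_dep_append[OF A b e[OF j] e[OF \<open>i < n\<close>]] Suc.IH Suc.prems by simp
    then show ?case by simp
  qed
  from this[of "n - Suc i"] show ?thesis using \<open>i < n\<close> by simp
qed

lemma realizations_image:
  assumes "(\<phi>, b) \<in> pformulas M k U" "\<sigma> \<in> Aut A"
  shows "map \<sigma> ` realizations M k {(\<phi>, b)} = realizations M k {(\<phi>, map \<sigma> b)}"
proof -
  obtain Y where Y: "dfn (k + length b) {} Y"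
    "\<And>b'. b' \<in> tups (length b) \<Longrightarrow> realizations M k {(\<phi>, b')} = {x \<in> tups k. x @ b' \<in> Y}"
    by (rule realizations_fibre[OF assms(1)]) blast
  have b: "b \<in> tups (length b)" using assms(1) by (auto simp: pformulas_def tuples_def)
  have "\<sigma> \<in> Aut {}" using assms(2) by (simp add: Aut_def)
  then show ?thesis
    using image_fibre[OF Y(1) _ _ b] Y(2)[OF b] Y(2)[OF Aut_tuples[OF assms(2) b]] by simp
qed

lemma inconsistent_family_image:
  fixes \<sigma> :: "nat \<Rightarrow> 'a \<Rightarrow> 'a"
  assumes "(\<phi>, b) \<in> pformulas M k U" "\<And>i. \<sigma> i \<in> Aut A"
  shows "inconsistent_family M k r \<phi> (\<lambda>i. map (\<sigma> i) b) \<longleftrightarrow>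
    (\<forall>I. finite I \<and> card I = r \<longrightarrow> (\<Inter>i\<in>I. map (\<sigma> i) ` realizations M k {(\<phi>, b)}) = {})"
\<comment> \<open>For \<open>r = 0\<close> the empty intersections are all tuples on one side and
  \<open>UNIV\<close> on the other; neither is empty, so both sides fail.\<close>
proof (cases "r = 0")
  case True
  obtain u where "u \<in> U" using is_struct by (auto simp: is_structure_def)
  then have "replicate k u \<in> tups k" by (simp add: tuples_def set_replicate_conv_if)
  then have "\<exists>x. x \<in> tups k" by blast
  then show ?thesis
    using True by (auto simp: inconsistent_family_def realizations_def)
next
  case False
  have "realizations M k ((\<lambda>i. (\<phi>, map (\<sigma> i) b)) ` I) = (\<Inter>i\<in>I. map (\<sigma> i) ` realizations M k {(\<phi>, b)})"
    if "card I = r" for I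
  proof -
    have "I \<noteq> {}" using that False by auto
    then show ?thesis unfolding realizations_image[OF assms] by (auto simp: realizations_def)
  qed
  then show ?thesis by (auto simp: inconsistent_family_def)
qed

lemma divides_iff_sdiv:
  assumes "(\<phi>, b) \<in> pformulas M k U" "sm A"
  shows "divides M k A (\<phi>, b) \<longleftrightarrow> (\<exists>r. sdiv A r (realizations M k {(\<phi>, b)}))"
proof
  have b: "b \<in> tups (length b)" using assms(1) by (auto simp: pformulas_def tuples_def)
  {
    assume "divides M k A (\<phi>, b)"
    then obtain r and c :: "nat \<Rightarrow> 'a list" where c: "\<And>i. c i \<in> tups (length b)" "\<And>i. tp M (c i) A = tp M b A"
      "inconsistent_family M k r \<phi> c" by (auto simp: divides_def)
    have "\<exists>\<sigma>\<in>Aut A. map \<sigma> b = c i" for i using c(2)[of i] tp_eq_Aut[OF b c(1) assms(2)] by metis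
    then obtain \<sigma> where \<sigma>: "\<And>i. \<sigma> i \<in> Aut A" "\<And>i. map (\<sigma> i) b = c i" by metis
    have "inconsistent_family M k r \<phi> (\<lambda>i. map (\<sigma> i) b)" using c(3) \<sigma>(2) by simp
    then have "sdiv A r (realizations M k {(\<phi>, b)})"
      unfolding inconsistent_family_image[of \<phi> b k \<sigma> A, OF assms(1) \<sigma>(1)]
      by (intro sdivI[of \<sigma>] \<sigma>(1)) simp
    then show "\<exists>r. sdiv A r (realizations M k {(\<phi>, b)})" by blast
  next
    assume "\<exists>r. sdiv A r (realizations M k {(\<phi>, b)})"
    then obtain r where r: "sdiv A r (realizations M k {(\<phi>, b)})" by blast
    obtain \<sigma> :: "nat \<Rightarrow> 'a \<Rightarrow> 'a" where \<sigma>: "\<And>i. \<sigma> i \<in> Aut A"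
      "\<And>I. finite I \<Longrightarrow> card I = r \<Longrightarrow> (\<Inter>i\<in>I. map (\<sigma> i) ` realizations M k {(\<phi>, b)}) = {}"
      using r by (rule sdivE) blast
    have "inconsistent_family M k r \<phi> (\<lambda>i. map (\<sigma> i) b)"
      unfolding inconsistent_family_image[of \<phi> b k \<sigma> A, OF assms(1) \<sigma>(1)] using \<sigma>(2) by blast
    moreover have "map (\<sigma> i) b \<in> tups (length b)" "tp M (map (\<sigma> i) b) A = tp M b A" for i
      using Aut_tuples[OF \<sigma>(1) b] tp_eq_Aut[OF b _ assms(2)] \<sigma>(1) by metis+
    ultimately show "divides M k A (\<phi>, b)"
      unfolding divides_def by (intro exI[of _ r] exI[of _ "\<lambda>i. map (\<sigma> i) b"]) simp
  }
qed

lemma forks_imp_fork: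
  assumes "forks M (length a) A (tp M a (A \<union> B))" "sm A" "B \<subseteq> U" "set a \<subseteq> U"
  shows "fork A a B"
proof -
  let ?k = "length a"
  obtain q\<^sub>0 \<Delta> where q0: "finite q\<^sub>0" "q\<^sub>0 \<subseteq> tp M a (A \<union> B)" and \<Delta>: "finite \<Delta>" "\<Delta> \<subseteq> pformulas M ?k U"
    "\<And>\<delta>. \<delta> \<in> \<Delta> \<Longrightarrow> divides M ?k A \<delta>"
    and cover: "realizations M ?k q\<^sub>0 \<subseteq> (\<Union>\<delta>\<in>\<Delta>. realizations M ?k {\<delta>})"
    using assms(1) unfolding forks_def by metis
  let ?X = "tups ?k \<inter> (\<Inter>\<delta>\<in>q\<^sub>0. realizations M ?k {\<delta>})"
  have "A \<union> B \<subseteq> U" using assms(3) small_subset_U[OF assms(2)] by blast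
  then have "dfn ?k (A \<union> B) ?X"
    using q0 by (intro definable_INT) (auto simp: definable_def tp_def)
  moreover have "a \<in> ?X" using q0(2) assms(4) by (auto simp: tp_def realizations_def tuples_def)
  moreover have "?X \<subseteq> \<Union>((\<lambda>\<delta>. realizations M ?k {\<delta>}) ` \<Delta>)"
    using cover by (auto simp: realizations_def)
  moreover have "dfn ?k U Z \<and> (\<exists>r. sdiv A r Z)" if Z: "Z \<in> (\<lambda>\<delta>. realizations M ?k {\<delta>}) ` \<Delta>" for Z
  proof -
    obtain \<phi> b where \<delta>: "(\<phi>, b) \<in> \<Delta>" "Z = realizations M ?k {(\<phi>, b)}" using Z by auto
    then have "(\<phi>, b) \<in> pformulas M ?k U" using \<Delta>(2) by blast
    then show ?thesis using \<Delta>(3)[OF \<delta>(1)] divides_iff_sdiv[of \<phi> b ?k A, OF _ assms(2)]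
      unfolding definable_def \<delta>(2) by metis
  qed
  ultimately show ?thesis
    unfolding fork_def using \<Delta>(1)
    by (intro exI[of _ ?X] exI[of _ "(\<lambda>\<delta>. realizations M ?k {\<delta>}) ` \<Delta>"]) simp
qed

lemma dep_imp_forks:
  assumes "dep A a B" "sm A" "B \<subseteq> U"
  shows "forks M (length a) A (tp M a (A \<union> B))"
proof -
  let ?k = "length a"
  obtain X r where X: "dfn ?k (A \<union> B) X" "a \<in> X" "sdiv A r X" using assms(1) by (auto simp: dep_def)
  then obtain \<phi> b where \<delta>: "(\<phi>, b) \<in> pformulas M ?k (A \<union> B)" "X = realizations M ?k {(\<phi>, b)}"
    by (auto simp: definable_def)
  have U: "(\<phi>, b) \<in> pformulas M ?k U"
    using \<delta>(1) assms(3) small_subset_U[OF assms(2)] by (auto simp: pformulas_def)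
  have "divides M ?k A (\<phi>, b)" using divides_iff_sdiv[OF U assms(2)] X(3) \<delta>(2) by blast
  moreover have "(\<phi>, b) \<in> tp M a (A \<union> B)" using X(2) \<delta> by (auto simp: tp_def realizations_def)
  ultimately show ?thesis
    unfolding forks_def using U by (intro exI[of _ "{(\<phi>, b)}"]) auto
qed

end

section \<open>Forking, dividing and symmetry in simple theories\<close>

context simple_monster
begin

lemma not_fork_base:
  assumes A: "sm A" and a: "a \<in> tups k"
  shows "\<not> fork A a {}"
proof
  assume "fork A a {}"
  then obtain X \<X> where X: "dfn k A X" "a \<in> X" and \<X>: "finite \<X>" "\<And>Z. Z \<in> \<X> \<Longrightarrow> dfn k U Z"
    "\<And>Z. Z \<in> \<X> \<Longrightarrow> \<exists>r. sdiv A r Z" "X \<subseteq> \<Union>\<X>"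
    using a by (auto simp: fork_def tuples_def)
  have AU: "A \<subseteq> U" using small_subset_U[OF A] .
  obtain r where r: "\<And>Z. Z \<in> \<X> \<Longrightarrow> sdiv A (r Z) Z" using \<X>(3) by metis
  define T where "T = (\<lambda>Z. (Z, r Z)) ` \<X>"
  have XT: "X \<subseteq> tups k" using definable_subset_tuples[OF X(1)] .
  have Tt: "X\<^sub>0 \<subseteq> tups k" if "(X\<^sub>0, s) \<in> T" for X\<^sub>0 s
    using that definable_subset_tuples[OF \<X>(2)] by (auto simp: T_def)
  have "rank_ge T n X" for n
  proof (induction n)
    case 0
    then show ?case using X(2) by auto
  next
    case (Suc n)
    have "X = (\<Union>Z\<in>\<X>. X \<inter> Z)" using \<X>(4) by blast
    then obtain Z where Z: "Z \<in> \<X>" "rank_ge T n (X \<inter> Z)"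
      using rank_ge_UN[OF \<X>(1), of T n "\<lambda>Z. X \<inter> Z"] Suc.IH by auto
    obtain \<sigma> :: "nat \<Rightarrow> 'a \<Rightarrow> 'a" where \<sigma>: "\<And>i. \<sigma> i \<in> Aut A"
      "\<And>I. finite I \<Longrightarrow> card I = r Z \<Longrightarrow> (\<Inter>i\<in>I. map (\<sigma> i) ` Z) = {}"
      using r[OF Z(1)] by (rule sdivE) blast
    have \<sigma>0: "\<sigma> i \<in> Aut {}" for i using \<sigma>(1)[of i] by (simp add: Aut_def)
    show ?case
    proof (rule rank_ge_SucI[of Z "r Z" T \<sigma> UNIV])
      fix j
      have "rank_ge T n (map (\<sigma> j) ` (X \<inter> Z))"
        using rank_ge_image[OF \<sigma>0, of T k n "X \<inter> Z"] Tt Z(2) XT by blast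
      moreover have "map (\<sigma> j) ` (X \<inter> Z) = X \<inter> map (\<sigma> j) ` Z"
        using image_Int_tuples[OF \<sigma>0 XT definable_subset_tuples[OF \<X>(2)[OF Z(1)]]]
          image_definable_fixed[OF X(1) AU \<sigma>(1)] by simp
      ultimately show "rank_ge T n (X \<inter> map (\<sigma> j) ` Z)" by simp
    qed (use \<sigma>0 \<sigma>(2) Z(1) in \<open>auto simp: T_def\<close>)
  qed
  then have "rank_ge T n (tups k)" for n using rank_ge_mono XT by blast
  moreover have "\<exists>n. \<not> rank_ge T n (tups k)"
    by (rule rank_finite_family) (use \<X>(1,2) in \<open>auto simp: T_def\<close>)
  ultimately show False by blast
qed

text \<open>Read from the end, a non-dividing sequence turns each conjugate of \<open>X\<close> into a set
  that still divides over the later tuples, so a common point would give large rank.\<close>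

lemma Kim:
  assumes A: "sm A" and b: "b \<in> tups m" and X: "dfn k (A \<union> set b) X" "sdiv A r X"
  obtains n where "\<And>\<sigma> :: nat \<Rightarrow> 'a \<Rightarrow> 'a. \<lbrakk>\<And>i. i < n \<Longrightarrow> \<sigma> i \<in> Aut A;
      \<And>i. i < n \<Longrightarrow> \<not> dep A (map (\<sigma> i) b) (\<Union>j<i. set (map (\<sigma> j) b))\<rbrakk>
    \<Longrightarrow> tups k \<inter> (\<Inter>i<n. map (\<sigma> i) ` X) = {}"
proof -
  have AU: "A \<subseteq> U" using small_subset_U[OF A] .
  have bU: "set b \<subseteq> U" using b by (simp add: tuples_def)
  have XU: "dfn k U X" by (rule definable_mono[OF X(1)]) (use AU bU in blast)
  have Xt: "X \<subseteq> tups k" using definable_subset_tuples[OF X(1)] .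
  \<comment> \<open>A bound for the one pair \<open>(X, r)\<close> suffices, because every level
    below splits with conjugates of \<open>X\<close> and the same \<open>r\<close>.\<close>
  obtain n where n: "\<not> rank_ge {(X, r)} n (tups k)" using rank_finite[OF XU] by blast
  have "tups k \<inter> (\<Inter>i<n. map (\<sigma> i) ` X) = {}"
    if \<sigma>: "\<And>i. i < n \<Longrightarrow> \<sigma> i \<in> Aut A"
      "\<And>i. i < n \<Longrightarrow> \<not> dep A (map (\<sigma> i) b) (\<Union>j<i. set (map (\<sigma> j) b))" for \<sigma> :: "nat \<Rightarrow> 'a \<Rightarrow> 'a"
  proof (rule ccontr)
    assume ne: "\<not> ?thesis"
    define e where "e i = map (\<sigma> i) b" for i
    have e: "e i \<in> tups m" if "i < n" for i using Aut_tuples[OF \<sigma>(1)[OF that] b] by (simp add: e_def)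
    \<comment> \<open>The common part of the conjugates from \<open>i\<close> on: passing from
      \<open>S i\<close> to \<open>S (Suc i)\<close> drops one conjugate and gains one unit of
      rank.\<close>
    define S where "S i = tups k \<inter> (\<Inter>j\<in>{i..<n}. map (\<sigma> j) ` X)" for i
    have "rank_ge {(X, r)} i (S i)" if "i \<le> n" for i
      using that
    proof (induction i)
      case 0
      then show ?case using ne by (simp add: S_def lessThan_atLeast0)
    next
      case (Suc i)
      then have i: "i < n" by simp
      \<comment> \<open>\<open>S (Suc i)\<close> is definable over \<open>A\<close> and
        \<open>?c\<close>, so the automorphisms over them that spread out \<open>?Z\<close> leave it
        in place.\<close>
      let ?c = "concat (map e [Suc i..<n])" and ?Z = "map (\<sigma> i) ` X"
      have c: "?c \<in> tups (length [Suc i..<n] * m)" by (rule concat_map_in_tuples) (use e in simp)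
      then have cU: "A \<union> set ?c \<subseteq> U" using AU by (simp add: tuples_def)
      have img: "dfn k (A \<union> set (e j)) (map (\<sigma> j) ` X)" if "j < n" for j
        using definable_image[OF X(1) \<sigma>(1)[OF that] AU bU] by (simp add: e_def)
      have "\<not> dep A ?c (set (e i))"
        by (rule not_dep_tail[OF A e _ i]) (use \<sigma>(2) in \<open>auto simp: e_def\<close>)
      then have "sdiv (A \<union> set ?c) r ?Z"
        using sdiv_extend_base[OF A e[OF i] c img[OF i] sdiv_image[OF X(2) \<sigma>(1)[OF i] AU Xt]] by blast
      then obtain \<rho> :: "nat \<Rightarrow> 'a \<Rightarrow> 'a" where \<rho>: "\<And>j. \<rho> j \<in> Aut (A \<union> set ?c)"
        "\<And>I. finite I \<Longrightarrow> card I = r \<Longrightarrow> (\<Inter>j\<in>I. map (\<rho> j) ` ?Z) = {}"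
        by (rule sdivE) blast
      have \<rho>0: "\<rho> j \<in> Aut {}" for j using \<rho>(1)[of j] by (simp add: Aut_def)
      have \<sigma>0: "\<sigma> i \<in> Aut {}" using \<sigma>(1)[OF i] by (simp add: Aut_def)
      have SS: "S i = S (Suc i) \<inter> ?Z"
      proof -
        have "{i..<n} = insert i {Suc i..<n}" using i by auto
        then show ?thesis by (auto simp: S_def)
      qed
      have St: "S (Suc i) \<subseteq> tups k" by (simp add: S_def)
      have Zt: "?Z \<subseteq> tups k" using Xt Aut_tuples[OF \<sigma>0] by blast
      have Sdfn: "dfn k (A \<union> set ?c) (S (Suc i))"
        unfolding S_def
      proof (rule definable_INT[OF _ _ cU])
        fix j assume j: "j \<in> {Suc i..<n}"
        then have "j < n" by simp
        from img[OF this] show "dfn k (A \<union> set ?c) (map (\<sigma> j) ` X)"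
          by (rule definable_mono) (use j in auto)
      qed simp
      have eq: "map (\<rho> j \<circ> \<sigma> i) ` X = map (\<rho> j) ` ?Z" for j by (simp add: image_image)
      show ?case
      proof (rule rank_ge_SucI[of X r _ "\<lambda>j. \<rho> j \<circ> \<sigma> i" UNIV])
        fix j
        have "rank_ge {(X, r)} i (map (\<rho> j) ` S i)"
          using rank_ge_image[OF \<rho>0, of "{(X, r)}" k i "S i"] Suc Xt by (simp add: S_def)
        moreover have "map (\<rho> j) ` S i = S (Suc i) \<inter> map (\<rho> j) ` ?Z"
          unfolding SS image_Int_tuples[OF \<rho>0 St Zt] image_definable_fixed[OF Sdfn cU \<rho>(1)] ..
        ultimately show "rank_ge {(X, r)} i (S (Suc i) \<inter> map (\<rho> j \<circ> \<sigma> i) ` X)" unfolding eq by simp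
      qed (use \<rho>(2) Aut_comp[OF \<rho>0 \<sigma>0] in \<open>auto simp del: map_map simp: eq\<close>)
    qed
    from this[of n] have "rank_ge {(X, r)} n (tups k)" by (simp add: S_def)
    then show False using n by blast
  qed
  then show thesis using that by blast
qed

text \<open>Along a non-dividing sequence of conjugates, a point common to many
  conjugates of \<open>X\<close> lies in many conjugates of one of the dividing sets covering \<open>X\<close>.\<close>

lemma fork_imp_dep:
  assumes A: "sm A" and B: "B \<subseteq> U" and a: "a \<in> tups k" and f: "fork A a B"
  shows "dep A a B"
proof -
  have AU: "A \<subseteq> U" using small_subset_U[OF A] .
  have lena: "length a = k" using a by (simp add: tuples_def)
  obtain X \<X> where X: "dfn k (A \<union> B) X" "a \<in> X" and \<X>: "finite \<X>" "\<And>Z. Z \<in> \<X> \<Longrightarrow> dfn k U Z"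
    "\<And>Z. Z \<in> \<X> \<Longrightarrow> \<exists>r. sdiv A r Z" "X \<subseteq> \<Union>\<X>"
    using f unfolding fork_def lena by blast
  obtain r where r: "\<And>Z. Z \<in> \<X> \<Longrightarrow> sdiv A (r Z) Z" using \<X>(3) by metis
  have Xt: "X \<subseteq> tups k" using definable_subset_tuples[OF X(1)] .
  have "\<exists>c. set c \<subseteq> U \<and> dfn k (A \<union> set c) Z" if "Z \<in> \<X>" for Z
  proof -
    have "dfn k (A \<union> U) Z" using \<X>(2)[OF that] AU by (simp add: Un_absorb1)
    then show ?thesis using definable_finite_support by metis
  qed
  then obtain c where c: "\<And>Z. Z \<in> \<X> \<Longrightarrow> set (c Z) \<subseteq> U" "\<And>Z. Z \<in> \<X> \<Longrightarrow> dfn k (A \<union> set (c Z)) Z"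
    by metis
  have "finite (\<Union>Z\<in>\<X>. set (c Z))" using \<X>(1) by simp
  \<comment> \<open>\<open>e\<close> collects the parameters of all covering sets, so that one
    sequence of conjugates of \<open>e\<close> moves all of them at once.\<close>
  then obtain e where e: "set e = (\<Union>Z\<in>\<X>. set (c Z))" by (meson finite_list)
  have et: "e \<in> tups (length e)" using c(1) by (auto simp: tuples_def e)
  have Ze: "dfn k (A \<union> set e) Z" if "Z \<in> \<X>" for Z
    by (rule definable_mono[OF c(2)[OF that]]) (use that in \<open>auto simp: e\<close>)
  have "sm (A \<union> {})" using A by simp
  then obtain \<sigma> :: "nat \<Rightarrow> 'a \<Rightarrow> 'a" where \<sigma>: "\<And>i. \<sigma> i \<in> Aut (A \<union> {})"
    "\<And>i. \<not> dep A (map (\<sigma> i) e) (\<Union>j<i. set (map (\<sigma> j) e))"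
    using not_fork_sequence[OF _ et not_fork_base[OF A et]] by blast
  have \<sigma>A: "\<sigma> i \<in> Aut A" for i using \<sigma>(1)[of i] by simp
  have "\<exists>n. \<forall>\<sigma> :: nat \<Rightarrow> 'a \<Rightarrow> 'a. (\<forall>i<n. \<sigma> i \<in> Aut A) \<longrightarrow>
      (\<forall>i<n. \<not> dep A (map (\<sigma> i) e) (\<Union>j<i. set (map (\<sigma> j) e))) \<longrightarrow>
      tups k \<inter> (\<Inter>i<n. map (\<sigma> i) ` Z) = {}" if "Z \<in> \<X>" for Z
  proof (rule Kim[OF A et Ze[OF that] r[OF that]])
  qed metis
  then obtain n where n: "\<And>Z \<sigma>. \<lbrakk>Z \<in> \<X>; \<And>i. i < n Z \<Longrightarrow> (\<sigma> :: nat \<Rightarrow> 'a \<Rightarrow> 'a) i \<in> Aut A;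
      \<And>i. i < n Z \<Longrightarrow> \<not> dep A (map (\<sigma> i) e) (\<Union>j<i. set (map (\<sigma> j) e))\<rbrakk>
      \<Longrightarrow> tups k \<inter> (\<Inter>i<n Z. map (\<sigma> i) ` Z) = {}"
    by metis
  \<comment> \<open>One more than the sum of the bounds from Kim's lemma: among \<open>N\<close>
    conjugates, some covering set \<open>Z\<close> occurs more than \<open>n Z\<close>
    times.\<close>
  define N where "N = Suc (\<Sum>Z\<in>\<X>. n Z)"
  have "(\<Inter>i\<in>I. map (\<sigma> i) ` X) = {}" if I: "finite I" "card I = N" for I
  proof (rule ccontr)
    assume "\<not> ?thesis"
    then obtain x where x: "\<And>i. i \<in> I \<Longrightarrow> x \<in> map (\<sigma> i) ` X" by auto
    have "I \<noteq> {}" using I by (auto simp: N_def)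
    then have xt: "x \<in> tups k" using x Xt Aut_tuples[OF \<sigma>A] by blast
    define I' where "I' Z = {i \<in> I. x \<in> map (\<sigma> i) ` Z}" for Z
    have "I \<subseteq> (\<Union>Z\<in>\<X>. I' Z)"
    proof
      fix i assume i: "i \<in> I"
      then obtain y where "y \<in> X" "x = map (\<sigma> i) y" using x by blast
      then show "i \<in> (\<Union>Z\<in>\<X>. I' Z)" using \<X>(4) i by (auto simp: I'_def)
    qed
    then have "card I \<le> card (\<Union>Z\<in>\<X>. I' Z)"
      using I(1) \<X>(1) by (intro card_mono) (auto simp: I'_def)
    also have "\<dots> \<le> (\<Sum>Z\<in>\<X>. card (I' Z))" by (rule card_UN_le[OF \<X>(1)])
    finally have "(\<Sum>Z\<in>\<X>. n Z) < (\<Sum>Z\<in>\<X>. card (I' Z))" using I(2) by (simp add: N_def)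
    then obtain Z where Z: "Z \<in> \<X>" "n Z < card (I' Z)" by (meson leD leI sum_mono)
    have fin: "finite (I' Z)" using I(1) by (simp add: I'_def)
    let ?is = "sorted_list_of_set (I' Z)"
    have len: "n Z < length ?is" using Z(2) by simp
    have sorted: "sorted_wrt (<) ?is" by (simp add: strict_sorted_list_of_set)
    \<comment> \<open>A subsequence of an independent sequence is independent, since each term now
      has fewer predecessors.\<close>
    let ?\<sigma> = "\<lambda>i. \<sigma> (?is ! i)"
    have "tups k \<inter> (\<Inter>i<n Z. map (?\<sigma> i) ` Z) = {}"
    proof (rule n[OF Z(1)])
      fix i assume i: "i < n Z"
      show "?\<sigma> i \<in> Aut A" by (rule \<sigma>A)
      show "\<not> dep A (map (?\<sigma> i) e) (\<Union>j<i. set (map (?\<sigma> j) e))"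
      proof
        assume "dep A (map (?\<sigma> i) e) (\<Union>j<i. set (map (?\<sigma> j) e))"
        moreover have "?is ! j < ?is ! i" if "j < i" for j
          using sorted that i len by (simp add: sorted_wrt_iff_nth_less)
        ultimately have "dep A (map (?\<sigma> i) e) (\<Union>j<?is ! i. set (map (\<sigma> j) e))"
          by (elim dep_subset) blast
        then show False using \<sigma>(2) by blast
      qed
    qed
    moreover have "x \<in> map (?\<sigma> i) ` Z" if "i < n Z" for i
    proof -
      have "?is ! i \<in> set ?is" using that len by simp
      then have "?is ! i \<in> I' Z" using fin by simp
      then show ?thesis by (simp add: I'_def)
    qed
    ultimately show False using xt by blast
  qed
  with \<sigma>A have "sdiv A N X" by (rule sdivI)
  then show ?thesis unfolding dep_def lena using X by blast
qed

text \<open>Closes the circle from \<open>dep\<close> to \<open>forks\<close> to \<open>fork\<close>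
  and back to \<open>dep\<close>.\<close>

lemma indep_iff:
  assumes "sm A" "B \<subseteq> U" "a \<in> tups k"
  shows "Defs.indep M a A B \<longleftrightarrow> \<not> dep A a B"
  unfolding Defs.indep_def
  using assms forks_imp_fork fork_imp_dep[OF assms] dep_imp_forks in_tuples by blast

text \<open>The \<open>\<sigma> i\<close> fix \<open>b\<close>, so \<open>b\<close> is common to all
  conjugates of the set over \<open>a\<close> that witnesses its dependence; \<open>Kim\<close>
  forbids this along an independent sequence.\<close>

lemma not_dep_sequence_not_common:
  assumes A: "sm A" and a: "a \<in> tups k" and b: "b \<in> tups m" and d: "dep A b (set a)"
    and \<sigma>: "\<And>i. \<sigma> i \<in> Aut (A \<union> set b)"
    "\<And>i :: nat. \<not> dep A (map (\<sigma> i) a) (\<Union>j<i. set (map (\<sigma> j) a))"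
  shows False
proof -
  obtain X r where X: "dfn m (A \<union> set a) X" "b \<in> X" "sdiv A r X"
    using d b by (auto simp: dep_def tuples_def)
  obtain n where n: "\<And>\<sigma> :: nat \<Rightarrow> 'a \<Rightarrow> 'a. \<lbrakk>\<And>i. i < n \<Longrightarrow> \<sigma> i \<in> Aut A;
      \<And>i. i < n \<Longrightarrow> \<not> dep A (map (\<sigma> i) a) (\<Union>j<i. set (map (\<sigma> j) a))\<rbrakk>
    \<Longrightarrow> tups m \<inter> (\<Inter>i<n. map (\<sigma> i) ` X) = {}"
    using Kim[OF A a X(1,3)] by blast
  have "tups m \<inter> (\<Inter>i<n. map (\<sigma> i) ` X) = {}"
    using \<sigma> Aut_antimono[of A "A \<union> set b"] by (intro n) auto
  moreover have "b \<in> map (\<sigma> i) ` X" for i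
    using Aut_fix[OF \<sigma>(1), of b i] X(2) by (metis image_eqI sup_ge2)
  ultimately show False using b by blast
qed

text \<open>If \<open>a\<close> did not depend on \<open>b\<close>, its type over \<open>A\<close>
  and \<open>b\<close> would not fork over \<open>A\<close> and would be realized by a sequence
  independent over \<open>A\<close>, which the preceding lemma excludes.\<close>

lemma dep_sym:
  assumes A: "sm A" and a: "a \<in> tups k" and b: "b \<in> tups m" and d: "dep A b (set a)"
  shows "dep A a (set b)"
proof (rule ccontr)
  assume nd: "\<not> dep A a (set b)"
  have bU: "set b \<subseteq> U" using b by (simp add: tuples_def)
  have nf: "\<not> fork A a (set b)" using fork_imp_dep[OF A bU a] nd by blast
  obtain \<sigma> :: "nat \<Rightarrow> 'a \<Rightarrow> 'a" where "\<And>i. \<sigma> i \<in> Aut (A \<union> set b)"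
    "\<And>i. \<not> dep A (map (\<sigma> i) a) (\<Union>j<i. set (map (\<sigma> j) a))"
    using not_fork_sequence[OF small_Un_set[OF A bU] a nf] by blast
  then show False using not_dep_sequence_not_common[OF A a b d] by blast
qed

text \<open>Transitivity on the right, obtained by symmetry from transitivity on the left.\<close>

lemma not_dep_trans:
  assumes A: "sm A" and a: "a \<in> tups k" and B: "finite B" "B \<subseteq> U" and d: "d \<in> tups l"
    and nd: "\<not> dep A a B" "\<not> dep (A \<union> B) a (set d)"
  shows "\<not> dep A a (B \<union> set d)"
proof -
  obtain b where b: "set b = B" using B(1) by (meson finite_list)
  have bt: "b \<in> tups (length b)" using B(2) b by (simp add: tuples_def)
  have Ab: "sm (A \<union> set b)" using small_Un_set[OF A, of b] B(2) b by simp
  have "\<not> dep A b (set a)" using dep_sym[OF A a bt] nd(1) b by blast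
  moreover have "\<not> dep (A \<union> set b) d (set a)" using dep_sym[OF Ab a d] nd(2) b by blast
  ultimately have "\<not> dep A (b @ d) (set a)" by (rule not_dep_append[OF A bt d a])
  moreover have "b @ d \<in> tups (length b + l)" using bt d by (simp add: tuples_def)
  ultimately have "\<not> dep A a (set (b @ d))" using dep_sym[OF A _ a] by blast
  then show ?thesis using b by simp
qed

text \<open>A set over \<open>e\<close> that divides need not divide when \<open>e\<close> is
  replaced by a tuple of another type. Symmetry puts the dividing set over \<open>a\<close> instead,
  with \<open>e\<close> as a member: then \<open>a\<close> may move by automorphisms, and any
  \<open>e'\<close> in the moved set will do.\<close>

lemma dep_open:
  assumes A: "sm A" and a: "a \<in> tups k" and e: "e \<in> tups m" and d: "dep A a (set e)"
  obtains Y where "dfn (m + k) A Y" "e @ a \<in> Y"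
    "\<And>\<sigma> e'. \<lbrakk>\<sigma> \<in> Aut A; e' \<in> tups m; e' @ map \<sigma> a \<in> Y\<rbrakk> \<Longrightarrow> dep A (map \<sigma> a) (set e')"
proof -
  have AU: "A \<subseteq> U" using small_subset_U[OF A] .
  have aU: "set a \<subseteq> U" "length a = k" using a by (auto simp: tuples_def)
  obtain X r where X: "dfn m (A \<union> set a) X" "e \<in> X" "sdiv A r X"
    using dep_sym[OF A e a d] e by (auto simp: dep_def tuples_def)
  obtain Y where Y: "dfn (m + k) A Y" "X = {x \<in> tups m. x @ a \<in> Y}"
    using definable_as_fibre[OF X(1) AU aU(1)] aU(2) by blast
  have "dep A (map \<sigma> a) (set e')" if \<sigma>: "\<sigma> \<in> Aut A" and e': "e' \<in> tups m" "e' @ map \<sigma> a \<in> Y" for \<sigma> e'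
  proof -
    have "e' \<in> map \<sigma> ` X" unfolding Y(2) image_fibre[OF Y(1) AU \<sigma> a] using e' by blast
    moreover have "dfn m (A \<union> set (map \<sigma> a)) (map \<sigma> ` X)"
      using definable_image[OF X(1) \<sigma> AU aU(1)] by simp
    moreover have "sdiv A r (map \<sigma> ` X)"
      by (rule sdiv_image[OF X(3) \<sigma> AU definable_subset_tuples[OF X(1)]])
    ultimately have "dep A e' (set (map \<sigma> a))" using e'(1) by (auto simp: dep_def tuples_def)
    then show ?thesis using dep_sym[OF A Aut_tuples[OF \<sigma> a] e'(1)] by blast
  qed
  then show thesis using that Y X(2) by blast
qed

end

section \<open>Elementary submodels\<close>

lemma wf_trm_univ_update: "wf_trm (M\<lparr>univ := V\<rparr>) t = wf_trm M t"
  by (induction t) auto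

lemma wf_fm_univ_update: "wf_fm (M\<lparr>univ := V\<rparr>) \<phi> = wf_fm M \<phi>"
  by (induction \<phi>) (auto simp: wf_trm_univ_update)

lemma pformulas_submodel:
  assumes "elementary_submodel N M"
  shows "pformulas N k B = pformulas M k B"
proof -
  obtain V where "N = M\<lparr>univ := V\<rparr>" using assms by (auto simp: elementary_submodel_def)
  then show ?thesis by (simp add: pformulas_def formulas_def wf_fm_univ_update)
qed

lemma univ_submodel: "elementary_submodel N M \<Longrightarrow> univ N \<subseteq> univ M"
  by (auto simp: elementary_submodel_def)

lemma tuples_submodel: "elementary_submodel N M \<Longrightarrow> tuples N k \<subseteq> tuples M k"
  using univ_submodel by (auto simp: tuples_def)

lemma sat_submodel:
  assumes "elementary_submodel N M" "wf_fm M \<phi>" "v ` fv \<phi> \<subseteq> univ N"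
  shows "sat N v \<phi> = sat M v \<phi>"
proof -
  have "is_structure N" using assms(1) by (simp add: elementary_submodel_def)
  then obtain w where w: "range w \<subseteq> univ N" "\<And>i. i \<in> fv \<phi> \<Longrightarrow> w i = v i"
    using total_assignment[OF _ assms(3)] by blast
  have "sat N v \<phi> = sat N w \<phi>" by (rule sat_cong) (simp add: w)
  also have "\<dots> = sat M w \<phi>" using assms(1,2) w(1) by (auto simp: elementary_submodel_def formulas_def)
  also have "\<dots> = sat M v \<phi>" by (rule sat_cong) (simp add: w)
  finally show ?thesis .
qed

lemma holds_submodel:
  assumes "elementary_submodel N M" "\<delta> \<in> pformulas M k (univ N)" "x \<in> tuples N k"
  shows "holds N x \<delta> = holds M x \<delta>"
proof -
  have "fv (fst \<delta>) \<subseteq> {..<length (x @ snd \<delta>)}" using assms(2,3) by (auto simp: pformulas_def tuples_def)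
  then have "(!) (x @ snd \<delta>) ` fv (fst \<delta>) \<subseteq> set (x @ snd \<delta>)" using nth_mem by blast
  also have "\<dots> \<subseteq> univ N" using assms(2,3) by (auto simp: pformulas_def tuples_def)
  finally show ?thesis
    unfolding holds_def using assms(1,2) by (intro sat_submodel) (auto simp: pformulas_def formulas_def)
qed

lemma realizations_submodel:
  assumes "elementary_submodel N M" "q \<subseteq> pformulas M k (univ N)"
  shows "realizations N k q = realizations M k q \<inter> tuples N k"
  using holds_submodel[OF assms(1)] assms(2) tuples_submodel[OF assms(1)]
  unfolding realizations_def by blast

lemma wf_fm_Exs: "wf_fm M (foldr Ex is \<phi>) = wf_fm M \<phi>"
  by (induction "is") auto

lemma fv_Exs: "fv (foldr Ex is \<phi>) = fv \<phi> - set is"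
  by (induction "is") auto

lemma sat_Exs:
  "sat M v (foldr Ex is \<phi>) \<longleftrightarrow>
    (\<exists>w. (\<forall>i\<in>set is. w i \<in> univ M) \<and> (\<forall>i. i \<notin> set is \<longrightarrow> w i = v i) \<and> sat M w \<phi>)"
proof (induction "is" arbitrary: v)
  case Nil
  have "(\<forall>i. w i = v i) \<longleftrightarrow> w = v" for w by auto
  then show ?case by simp
next
  case (Cons i "is")
  have "sat M v (foldr Ex (i # is) \<phi>) \<longleftrightarrow> (\<exists>a\<in>univ M. \<exists>w. (\<forall>j\<in>set is. w j \<in> univ M) \<and>
    (\<forall>j. j \<notin> set is \<longrightarrow> w j = (v(i := a)) j) \<and> sat M w \<phi>)"
    using Cons.IH by simp
  also have "\<dots> \<longleftrightarrow> (\<exists>w. (\<forall>j\<in>set (i # is). w j \<in> univ M) \<and> (\<forall>j. j \<notin> set (i # is) \<longrightarrow> w j = v j) \<and> sat M w \<phi>)"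
    (is "?l \<longleftrightarrow> ?r")
  proof
    assume ?l
    then obtain a w where w: "a \<in> univ M" "\<forall>j\<in>set is. w j \<in> univ M"
      "\<forall>j. j \<notin> set is \<longrightarrow> w j = (v(i := a)) j" "sat M w \<phi>" by blast
    then have "w i \<in> univ M" by (cases "i \<in> set is") auto
    then show ?r using w by (intro exI[of _ w]) auto
  next
    assume ?r
    then obtain w where "\<forall>j\<in>set (i # is). w j \<in> univ M" "\<forall>j. j \<notin> set (i # is) \<longrightarrow> w j = v j" "sat M w \<phi>"
      by blast
    then show ?l by (intro bexI[of _ "w i"] exI[of _ w]) auto
  qed
  finally show ?case .
qed

lemma elementary_submodel_realizations:
  assumes "elementary_submodel N M" "\<delta> \<in> pformulas M k (univ N)" "realizations M k {\<delta>} \<noteq> {}"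
  shows "realizations N k {\<delta>} \<noteq> {}"
proof -
  obtain \<phi> b where \<delta>: "\<delta> = (\<phi>, b)" by force
  have wf: "wf_fm M \<phi>" and fv: "fv \<phi> \<subseteq> {..<k + length b}" and bN: "set b \<subseteq> univ N"
    using assms(2) by (auto simp: \<delta> pformulas_def formulas_def)
  obtain x where x: "x \<in> tuples M k" "sat M ((!) (x @ b)) \<phi>"
    using assms(3) by (auto simp: \<delta> realizations_def holds_def)
  let ?\<psi> = "foldr Ex [0..<k] \<phi>"
  \<comment> \<open>Only positions from \<open>k\<close> on matter, the variables below
    \<open>k\<close> being quantified.\<close>
  define v where "v i = b ! (i - k)" for i
  have "\<exists>w. (\<forall>i\<in>set [0..<k]. w i \<in> univ M) \<and> (\<forall>i. i \<notin> set [0..<k] \<longrightarrow> w i = v i) \<and> sat M w \<phi>"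
  proof (intro exI[of _ "\<lambda>i. if i < k then x ! i else v i"] conjI)
    have "sat M (\<lambda>i. if i < k then x ! i else v i) \<phi> = sat M ((!) (x @ b)) \<phi>"
      by (rule sat_cong) (use x(1) in \<open>auto simp: nth_append tuples_def v_def\<close>)
    then show "sat M (\<lambda>i. if i < k then x ! i else v i) \<phi>" using x(2) by simp
  qed (use x(1) in \<open>auto simp: tuples_def\<close>)
  then have "sat M v ?\<psi>" unfolding sat_Exs .
  moreover have "v ` fv ?\<psi> \<subseteq> univ N"
  proof
    fix y assume "y \<in> v ` fv ?\<psi>"
    then obtain i where "i < k + length b" "\<not> i < k" "y = b ! (i - k)" using fv by (auto simp: fv_Exs v_def)
    then show "y \<in> univ N" using bN by auto
  qed
  ultimately have "sat N v ?\<psi>" using sat_submodel[OF assms(1)] wf by (simp add: wf_fm_Exs)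
  then obtain w where w: "\<forall>i\<in>set [0..<k]. w i \<in> univ N" "\<forall>i. i \<notin> set [0..<k] \<longrightarrow> w i = v i" "sat N w \<phi>"
    unfolding sat_Exs by blast
  have "sat N ((!) (map w [0..<k] @ b)) \<phi> = sat N w \<phi>"
    by (rule sat_cong) (use w(2) fv in \<open>auto simp: nth_append v_def\<close>)
  then have "map w [0..<k] \<in> realizations N k {\<delta>}"
    using w(1,3) by (auto simp: realizations_def \<delta> holds_def tuples_def)
  then show ?thesis by blast
qed

context monster_model
begin

section \<open>Complete types\<close>

lemma tp_in_types:
  assumes "a \<in> tups k"
  shows "tp M a D \<in> types M k D"
proof -
  have "a \<in> realizations M k p\<^sub>0" if "p\<^sub>0 \<subseteq> tp M a D" for p\<^sub>0
    using that assms by (auto simp: realizations_def tp_def)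
  moreover have "(\<phi>, b) \<in> tp M a D \<or> (Neg \<phi>, b) \<in> tp M a D" if "(\<phi>, b) \<in> pformulas M k D" for \<phi> b
    using that assms by (auto simp: tp_def holds_def pformulas_def formulas_def tuples_def)
  moreover have "tp M a D \<subseteq> pformulas M k D" using assms by (auto simp: tp_def tuples_def)
  ultimately show ?thesis unfolding types_def by blast
qed

lemma type_eq_tp:
  assumes "q \<in> types M k D" "a \<in> realizations M k q"
  shows "q = tp M a D"
proof
  have len: "length a = k" using assms(2) by (simp add: realizations_def tuples_def)
  show "q \<subseteq> tp M a D" using assms len by (auto simp: types_def tp_def realizations_def)
  show "tp M a D \<subseteq> q"
  proof
    fix \<delta> assume \<delta>: "\<delta> \<in> tp M a D"
    obtain \<phi> b where [simp]: "\<delta> = (\<phi>, b)" by force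
    have "\<delta> \<in> q \<or> (Neg \<phi>, b) \<in> q" using \<delta> assms(1) len by (auto simp: types_def tp_def)
    moreover have "(Neg \<phi>, b) \<notin> q" using \<delta> assms(2) by (auto simp: tp_def realizations_def holds_def)
    ultimately show "\<delta> \<in> q" by blast
  qed
qed

lemma realizations_orbit:
  assumes "q \<in> types M k D" "a \<in> realizations M k q" "sm D" "a' \<in> tups k"
  shows "a' \<in> realizations M k q \<longleftrightarrow> (\<exists>\<sigma>\<in>Aut D. map \<sigma> a = a')"
proof -
  have a: "a \<in> tups k" using assms(2) by (simp add: realizations_def)
  have q: "q = tp M a D" by (rule type_eq_tp[OF assms(1,2)])
  have "a' \<in> realizations M k q \<longleftrightarrow> tp M a D = tp M a' D"
  proof
    assume "a' \<in> realizations M k q"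
    then show "tp M a D = tp M a' D" using type_eq_tp[OF assms(1)] q by metis
  next
    assume "tp M a D = tp M a' D"
    then show "a' \<in> realizations M k q" using q assms(4) by (auto simp: realizations_def tp_def)
  qed
  then show ?thesis using tp_eq_Aut[OF a assms(4,3)] by simp
qed

lemma submodel_type_realized:
  assumes N: "elementary_submodel N M" "C \<subseteq> univ N" "saturated N (cardSuc |C| +c natLeq)"
    and C: "sm C" and a: "a \<in> tups k" and d: "set d \<subseteq> univ N"
  obtains \<sigma> where "\<sigma> \<in> Aut (C \<union> set d)" "map \<sigma> a \<in> tuples N k"
proof -
  let ?D = "C \<union> set d"
  have DN: "?D \<subseteq> univ N" using N(2) d by blast
  have DU: "?D \<subseteq> U" using DN univ_submodel[OF N(1)] by blast
  \<comment> \<open>The summand \<open>natLeq\<close> serves finite \<open>C\<close> and the summand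
    \<open>cardSuc |C|\<close> infinite \<open>C\<close>; a finite tuple \<open>d\<close> is
    absorbed in both cases.\<close>
  have card: "|?D| <o cardSuc |C| +c natLeq"
  proof (cases "finite C")
    case True
    then have "|?D| <o natLeq" using finite_iff_ordLess_natLeq[of ?D] by simp
    then show ?thesis using ordLess_ordLeq_trans ordLeq_csum2[OF natLeq_Card_order] by blast
  next
    case False
    have "|set d| <o natLeq" "natLeq \<le>o |C|"
      using finite_iff_ordLess_natLeq[of "set d"] infinite_iff_natLeq_ordLeq[of C] False by auto
    then have "|set d| \<le>o |C|" using ordLess_ordLeq_trans ordLess_imp_ordLeq by blast
    then have "|?D| \<le>o |C|"
      using card_of_Un_Plus_ordLeq card_of_Plus_infinite1[OF False] ordLeq_ordIso_trans by blast
    then have "|?D| <o cardSuc |C|"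
      using cardSuc_greater[OF card_of_Card_order] ordLeq_ordLess_trans by blast
    then show ?thesis
      using ordLess_ordLeq_trans ordLeq_csum1[OF cardSuc_Card_order[OF card_of_Card_order]] by blast
  qed
  let ?q = "tp M a ?D"
  have q: "?q \<in> types M k ?D" by (rule tp_in_types[OF a])
  have qN: "?q \<subseteq> pformulas M k (univ N)"
    using a DN by (auto simp: tp_def tuples_def pformulas_def)
  have "realizations N k p\<^sub>0 \<noteq> {}" if p0: "p\<^sub>0 \<subseteq> ?q" "finite p\<^sub>0" for p\<^sub>0
  proof -
    \<comment> \<open>A finite part of the type amounts to one formula, whose satisfiability passes
      to \<open>N\<close> by elementarity.\<close>
    let ?X = "tups k \<inter> (\<Inter>\<delta>\<in>p\<^sub>0. realizations M k {\<delta>})"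
    have "dfn k ?D ?X"
      using p0 a by (intro definable_INT[OF _ _ DU]) (auto simp: definable_def tp_def tuples_def)
    then obtain \<delta> where \<delta>: "\<delta> \<in> pformulas M k ?D" "?X = realizations M k {\<delta>}"
      unfolding definable_def by blast
    have \<delta>N: "\<delta> \<in> pformulas M k (univ N)" using \<delta>(1) DN by (auto simp: pformulas_def)
    have "a \<in> ?X" using p0(1) a by (auto simp: tp_def realizations_def)
    then have "realizations N k {\<delta>} \<noteq> {}"
      using elementary_submodel_realizations[OF N(1) \<delta>N] \<delta>(2) by blast
    then obtain x where x: "x \<in> ?X" "x \<in> tuples N k"
      using realizations_submodel[OF N(1), of "{\<delta>}" k] \<delta>N \<delta>(2) by blast
    then have "x \<in> realizations M k p\<^sub>0 \<inter> tuples N k" by (auto simp: realizations_def)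
    then show ?thesis using realizations_submodel[OF N(1), of p\<^sub>0 k] p0(1) qN by blast
  qed
  then have "?q \<in> types N k ?D"
    using q unfolding types_def pformulas_submodel[OF N(1)] by blast
  then have "realizations N k ?q \<noteq> {}" using N(3) DN card unfolding saturated_def by blast
  then obtain a' where a': "a' \<in> realizations M k ?q" "a' \<in> tuples N k"
    using realizations_submodel[OF N(1) qN] by blast
  have "a \<in> realizations M k ?q" using a by (auto simp: realizations_def tp_def)
  moreover have "sm ?D" using small_Un_set[OF C] DU by blast
  ultimately obtain \<sigma> where "\<sigma> \<in> Aut ?D" "map \<sigma> a = a'"
    using realizations_orbit[OF q] a' tuples_submodel[OF N(1)] by blast
  then show thesis using that a'(2) by blast
qed

text \<open>Each term has the same type as \<open>a\<close> over \<open>C\<close>, \<open>d\<close>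
  and the earlier terms, so it depends on earlier terms exactly when \<open>a\<close> does.\<close>

lemma submodel_sequence:
  assumes N: "elementary_submodel N M" "C \<subseteq> univ N" "saturated N (cardSuc |C| +c natLeq)"
    and C: "sm C" and a: "a \<in> tups k" and d: "set d \<subseteq> univ N"
  obtains \<sigma> :: "nat \<Rightarrow> 'a \<Rightarrow> 'a" where "\<And>i. \<sigma> i \<in> Aut (C \<union> set d \<union> (\<Union>j<i. set (map (\<sigma> j) a)))"
    "\<And>i. map (\<sigma> i) a \<in> tuples N k"
proof -
  define P where "P w \<longleftrightarrow> (\<forall>i<length w. w ! i \<in> Aut (C \<union> set d \<union> (\<Union>j<i. set (map (w ! j) a))) \<and>
    map (w ! i) a \<in> tuples N k)" for w
  have "\<exists>\<tau>. P (w @ [\<tau>])" if P: "P w" for w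
  proof -
    let ?d = "d @ concat (map (\<lambda>j. map (w ! j) a) [0..<length w])"
    have d': "set ?d = set d \<union> (\<Union>j<length w. set (map (w ! j) a))" by auto
    have "set ?d \<subseteq> univ N" using P d unfolding d' P_def in_tuples by blast
    then obtain \<tau> where "\<tau> \<in> Aut (C \<union> set ?d)" "map \<tau> a \<in> tuples N k"
      using submodel_type_realized[OF N C a] by blast
    then have "P (w @ [\<tau>])" using P unfolding d' P_def by (auto simp: nth_append less_Suc_eq Un_assoc)
    then show ?thesis by blast
  qed
  moreover have "P []" by (simp add: P_def)
  ultimately obtain \<sigma> where \<sigma>: "\<And>n. P (map \<sigma> [0..<n])" using sequence_of_prefixes[of P] by blast
  have "\<sigma> i \<in> Aut (C \<union> set d \<union> (\<Union>j<i. set (map (\<sigma> j) a)))" "map (\<sigma> i) a \<in> tuples N k" for i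
    using \<sigma>[of "Suc i"] by (auto simp: P_def nth_append simp flip: upt_Suc_append simp del: upt_Suc)
  then show thesis using that by blast
qed

section \<open>Indiscernible sequences and their dependence\<close>

lemma indiscernible_Aut:
  assumes "indiscernible M C a" "\<And>i. a i \<in> tups k" "sm C"
    and "sorted_wrt (<) is" "sorted_wrt (<) js" "length is = length js"
  obtains \<sigma> where "\<sigma> \<in> Aut C" "\<And>l. l < length is \<Longrightarrow> map \<sigma> (a (is ! l)) = a (js ! l)"
proof -
  have "tp M (concat (map a is)) C = tp M (concat (map a js)) C"
    using assms unfolding indiscernible_def by blast
  moreover have "concat (map a is) \<in> tups (length is * k)" "concat (map a js) \<in> tups (length is * k)"
    using concat_map_in_tuples[of "is" a k] concat_map_in_tuples[of js a k] assms(2,6) by auto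
  ultimately obtain \<sigma> where \<sigma>: "\<sigma> \<in> Aut C" "map \<sigma> (concat (map a is)) = concat (map a js)"
    using tp_eq_Aut[OF _ _ assms(3)] by blast
  have len: "length (a i) = k" for i using assms(2)[of i] by (simp add: tuples_def)
  have "concat (map (\<lambda>i. map \<sigma> (a i)) is) = concat (map a js)"
    using \<sigma>(2) by (simp add: map_concat comp_def)
  then have "map (\<lambda>i. map \<sigma> (a i)) is = map a js"
    by (rule concat_injective) (use assms(6) len in \<open>auto simp: set_zip\<close>)
  then have "map \<sigma> (a (is ! l)) = a (js ! l)" if "l < length is" for l
    using that assms(6) by (metis nth_map)
  then show thesis using that \<sigma>(1) by blast
qed

text \<open>Indiscernibility is applied to the index lists \<open>0, ..., m - 1, m\<close> and
  \<open>0, ..., m - 1, n\<close>.\<close>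

lemma indiscernible_Aut_last:
  assumes ind: "indiscernible M C a" and a: "\<And>i. a i \<in> tups k" and C: "sm C" and "m \<le> n"
  obtains \<sigma> where "\<sigma> \<in> Aut (C \<union> (\<Union>j<m. set (a j)))" "map \<sigma> (a m) = a n"
proof -
  have s: "sorted_wrt (<) ([0..<m] @ [l])" if "m \<le> l" for l :: nat
    using that by (auto simp: sorted_wrt_append)
  obtain \<sigma> where \<sigma>: "\<sigma> \<in> Aut C" and eq: "\<And>l. l < length ([0..<m] @ [m]) \<Longrightarrow>
      map \<sigma> (a (([0..<m] @ [m]) ! l)) = a (([0..<m] @ [n]) ! l)"
    using indiscernible_Aut[OF ind a C s[OF order_refl] s[OF \<open>m \<le> n\<close>]] by auto
  have "map \<sigma> (a j) = a j" if "j < m" for j using eq[of j] that by (simp add: nth_append)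
  then have "\<sigma> x = x" if "x \<in> set (a j)" "j < m" for x j using that by (metis map_eq_conv map_ident)
  then have "\<sigma> \<in> Aut (C \<union> (\<Union>j<m. set (a j)))" using \<sigma> by (auto simp: Aut_def)
  moreover have "map \<sigma> (a m) = a n" using eq[of m] by (simp add: nth_append)
  ultimately show thesis using that by blast
qed

lemma dep_Aut_fixed:
  assumes "dep C a B" "\<sigma> \<in> Aut (C \<union> B)" "C \<subseteq> U" "B \<subseteq> U"
  shows "dep C (map \<sigma> a) B"
proof -
  have "\<sigma> ` B = B" using assms(2) by (force simp: Aut_def)
  moreover have "\<sigma> \<in> Aut C" using assms(2) by (simp add: Aut_def)
  ultimately show ?thesis using dep_Aut[OF assms(1) _ assms(3,4)] by metis
qed

lemma dep_Aut_fixedD: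
  assumes "dep C (map \<sigma> a) B" "\<sigma> \<in> Aut (C \<union> B)" "C \<subseteq> U" "B \<subseteq> U" "a \<in> tups k"
  shows "dep C a B"
proof -
  obtain \<tau> where \<tau>: "\<tau> \<in> Aut (C \<union> B)" "\<And>x k. x \<in> tups k \<Longrightarrow> map \<tau> (map \<sigma> x) = x"
    using Aut_inverse[OF assms(2)] assms(3,4) by (metis Un_least)
  show ?thesis using dep_Aut_fixed[OF assms(1) \<tau>(1) assms(3,4)] \<tau>(2)[OF assms(5)] by simp
qed

text \<open>Makes the condition in \<open>F_Mb\<close> upward closed, so that comparing the infimum
  with \<open>n\<close> is testing the condition at \<open>n\<close>.\<close>

lemma indiscernible_dep_mono:
  assumes ind: "indiscernible M C a" and a: "\<And>i. a i \<in> tups k" and C: "sm C"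
    and d: "dep C (a m) (\<Union>j<m. set (a j))" and "m \<le> n"
  shows "dep C (a n) (\<Union>j<n. set (a j))"
proof -
  obtain \<sigma> where "\<sigma> \<in> Aut (C \<union> (\<Union>j<m. set (a j)))" "map \<sigma> (a m) = a n"
    using indiscernible_Aut_last[OF ind a C \<open>m \<le> n\<close>] by blast
  moreover have "(\<Union>j<m. set (a j)) \<subseteq> U" using a by (auto simp: tuples_def)
  ultimately have "dep C (a n) (\<Union>j<m. set (a j))"
    using dep_Aut_fixed[OF d _ small_subset_U[OF C]] by metis
  then show ?thesis by (rule dep_subset) (use \<open>m \<le> n\<close> in force)
qed

end

section \<open>The three conditions in terms of \<open>dep\<close>, and weak degeneracy from
  \<open>F_Mb\<close>\<close>

context simple_monster
begin

lemma forking_extension_tp: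
  assumes p: "p \<in> types M k C" and C: "sm C" and D: "C \<subseteq> D" "D \<subseteq> U" and a: "a \<in> realizations M k p"
  shows "forking_extension M k C p D (tp M a D) \<longleftrightarrow> dep C a D"
proof -
  have at: "a \<in> tups k" using a by (simp add: realizations_def)
  have "p = tp M a C" by (rule type_eq_tp[OF p a])
  then have "p \<subseteq> tp M a D" using D(1) by (auto simp: tp_def pformulas_def)
  then have "forking_extension M k C p D (tp M a D) \<longleftrightarrow> forks M k C (tp M a D)"
    using D(1) tp_in_types[OF at] by (simp add: forking_extension_def)
  moreover have "C \<union> D = D" using D(1) by blast
  ultimately show ?thesis
    using indep_iff[OF C D(2) at] at by (simp add: Defs.indep_def tuples_def)
qed

lemma morley_sequence_iff:
  assumes "sm C" "\<And>i. a i \<in> tups k"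
  shows "morley_sequence M C a \<longleftrightarrow> indiscernible M C a \<and> (\<forall>i. \<not> dep C (a i) (\<Union>j<i. set (a j)))"
proof -
  have "(\<Union>j<i. set (a j)) \<subseteq> U" for i using assms(2) by (auto simp: tuples_def)
  then show ?thesis using indep_iff[OF assms(1) _ assms(2)] by (simp add: morley_sequence_def)
qed

lemma F_Mb_le_iff:
  assumes p: "p \<in> types M k C" and C: "sm C"
  shows "F_Mb M k C p \<le> enat n \<longleftrightarrow> (\<forall>a. (\<forall>i. a i \<in> realizations M k p) \<and> indiscernible M C a \<and>
    \<not> morley_sequence M C a \<longrightarrow> dep C (a n) (\<Union>j<n. set (a j)))"
proof -
  have CU: "C \<subseteq> U" using small_subset_U[OF C] .
  define Q where "Q n \<longleftrightarrow> (\<forall>a. (\<forall>i. a i \<in> realizations M k p) \<and> indiscernible M C a \<and>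
    \<not> morley_sequence M C a \<longrightarrow> dep C (a n) (\<Union>j<n. set (a j)))" for n
  have dep_Un: "dep C b (C \<union> B) \<longleftrightarrow> dep C b B" for b B by (simp add: dep_def Un_assoc[symmetric])
  have "forking_extension M k C p (C \<union> (\<Union>j<n. set (a j))) (tp M (a n) (C \<union> (\<Union>j<n. set (a j))))
    \<longleftrightarrow> dep C (a n) (\<Union>j<n. set (a j))" if "\<forall>i. a i \<in> realizations M k p" for a n
  proof -
    have "(\<Union>j<n. set (a j)) \<subseteq> U" using that by (auto simp: realizations_def tuples_def)
    then show ?thesis
      using forking_extension_tp[OF p C, of "C \<union> (\<Union>j<n. set (a j))" "a n"] that CU
      by (simp add: dep_Un)
  qed
  then have F: "F_Mb M k C p = Inf {enat n | n. Q n}"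
    unfolding F_Mb_def Q_def by (intro arg_cong[of _ _ Inf] Collect_cong ex_cong1) blast
  have mono: "Q n" if "Q m" "m \<le> n" for m n
    using that(1) indiscernible_dep_mono[OF _ _ C _ that(2)] unfolding Q_def realizations_def by blast
  have "F_Mb M k C p \<le> enat n \<longleftrightarrow> Q n"
  proof
    assume "F_Mb M k C p \<le> enat n"
    then have "Inf {enat n | n. Q n} < enat (Suc n)" unfolding F using le_less_trans by force
    then obtain m where "Q m" "m < Suc n" unfolding Inf_less_iff by auto
    then show "Q n" using mono by simp
  next
    assume "Q n"
    then show "F_Mb M k C p \<le> enat n" unfolding F by (intro Inf_lower) blast
  qed
  then show ?thesis unfolding Q_def .
qed

lemma weakly_degenerate_iff:
  assumes C: "sm C"
  shows "weakly_degenerate M \<kappa> n k C p \<longleftrightarrow> (\<forall>a\<in>realizations M k p. \<forall>N.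
    elementary_submodel N M \<and> sm (univ N) \<and> C \<subseteq> univ N \<and>
    saturated N (cardSuc |C| +c natLeq) \<and> dep C a (\<Union>b\<in>realizations N k p. set b) \<longrightarrow>
    (\<exists>B\<^sub>0 \<subseteq> realizations N k p. finite B\<^sub>0 \<and> card B\<^sub>0 \<le> n \<and> dep C a (\<Union>b\<in>B\<^sub>0. set b)))"
proof -
  have *: "\<not> Defs.indep M a C (\<Union>b\<in>B. set b) \<longleftrightarrow> dep C a (\<Union>b\<in>B. set b)"
    if "elementary_submodel N M" "B \<subseteq> realizations N k p" "a \<in> realizations M k p" for N B a
  proof -
    have "(\<Union>b\<in>B. set b) \<subseteq> U"
      using that(2) univ_submodel[OF that(1)] by (auto simp: realizations_def tuples_def)
    moreover have "a \<in> tups k" using that(3) by (simp add: realizations_def)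
    ultimately show ?thesis using indep_iff[OF C] by blast
  qed
  show ?thesis
    unfolding weakly_degenerate_def
    by (intro ball_cong refl all_cong1 imp_cong conj_cong ex_cong1 *) auto
qed

theorem F_Mb_imp_weakly_degenerate:
  assumes p: "p \<in> types M k C" and C: "sm C" and F: "F_Mb M k C p \<le> enat n"
  shows "weakly_degenerate M \<kappa> n k C p"
  unfolding weakly_degenerate_iff[OF C]
proof (intro ballI allI impI, elim conjE, rule ccontr)
  fix a N assume a: "a \<in> realizations M k p" and N: "elementary_submodel N M" "C \<subseteq> univ N"
      "saturated N (cardSuc |C| +c natLeq)"
    and dp: "dep C a (\<Union>b\<in>realizations N k p. set b)"
    and no: "\<not> (\<exists>B\<^sub>0\<subseteq>realizations N k p. finite B\<^sub>0 \<and> card B\<^sub>0 \<le> n \<and> dep C a (\<Union>b\<in>B\<^sub>0. set b))"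
  have CU: "C \<subseteq> U" using small_subset_U[OF C] .
  have at: "a \<in> tups k" using a by (simp add: realizations_def)
  have pN: "p \<subseteq> pformulas M k (univ N)"
    using p N(2) by (auto simp: types_def pformulas_def)
  obtain d where d: "set d \<subseteq> (\<Union>b\<in>realizations N k p. set b)" "dep C a (set d)" using dep_finite[OF dp] .
  have dN: "set d \<subseteq> univ N" using d(1) by (auto simp: realizations_def tuples_def)
  have dU: "set d \<subseteq> U" using dN univ_submodel[OF N(1)] by blast
  have dt: "d \<in> tups (length d)" using dU by (simp add: tuples_def)
  let ?D = "C \<union> set d"
  have D: "sm ?D" using small_Un_set[OF C dU] .
  obtain \<sigma> :: "nat \<Rightarrow> 'a \<Rightarrow> 'a" where \<sigma>: "\<And>i. \<sigma> i \<in> Aut (?D \<union> (\<Union>j<i. set (map (\<sigma> j) a)))"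
    "\<And>i. map (\<sigma> i) a \<in> tuples N k"
    using submodel_sequence[OF N C at dN] by blast
  define b where "b i = map (\<sigma> i) a" for i
  have bt: "b i \<in> tups k" for i using \<sigma>(2) tuples_submodel[OF N(1)] by (auto simp: b_def)
  have \<sigma>C: "\<sigma> i \<in> Aut C" and \<sigma>D: "\<sigma> i \<in> Aut ?D" for i using \<sigma>(1)[of i] by (auto simp: Aut_def)
  have bp: "b i \<in> realizations N k p" for i
    unfolding realizations_submodel[OF N(1) pN]
    using realizations_orbit[OF p a C bt] \<sigma>(2) \<sigma>C by (auto simp: b_def)
  \<comment> \<open>\<open>b i\<close> and \<open>a\<close> have the same type over the earlier
    terms, and by \<open>no\<close> the tuple \<open>a\<close> depends on no \<open>n\<close>
    realizations of \<open>p\<close> in \<open>N\<close>.\<close>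
  have indep: "\<not> dep C (b i) (\<Union>j\<in>J. set (b j))" if J: "J \<subseteq> {..<i}" "card J \<le> n" for i J
  proof
    let ?B = "\<Union>j\<in>J. set (b j)"
    assume dB: "dep C (b i) ?B"
    have BU: "?B \<subseteq> U" using bt by (auto simp: tuples_def)
    have "\<sigma> i \<in> Aut (C \<union> ?B)" using \<sigma>(1)[of i] J(1) by (fastforce simp: Aut_def b_def)
    then have "dep C a (\<Union>c\<in>b ` J. set c)"
      using dep_Aut_fixedD[OF dB[unfolded b_def] _ CU _ at] BU by (simp add: b_def)
    moreover have "finite J" using J(1) finite_subset by blast
    ultimately show False
      using no bp J(2) card_image_le[of J b] by (metis finite_imageI image_subsetI le_trans)
  qed
  \<comment> \<open>Extraction is over \<open>?D\<close>, so that every term stays conjugate to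
    \<open>a\<close> over \<open>C\<close> and \<open>d\<close>; this is what prevents a Morley
    sequence.\<close>
  obtain a' :: "nat \<Rightarrow> 'a list" where a': "\<And>i. a' i \<in> tups k"
    and indisc: "\<And>is js X. \<lbrakk>sorted_wrt (<) is; sorted_wrt (<) js; length js = length is;
        dfn (length is * k) ?D X; concat (map a' is) \<in> X\<rbrakk> \<Longrightarrow> concat (map a' js) \<in> X"
    and EM: "\<And>is X. \<lbrakk>sorted_wrt (<) is; dfn (length is * k) ?D X; concat (map a' is) \<in> X\<rbrakk>
      \<Longrightarrow> \<exists>js. sorted_wrt (<) js \<and> length js = length is \<and> concat (map b js) \<in> X"
    using indiscernible_extraction[of b k ?D, OF bt D] by blast
  have "\<exists>\<tau>\<in>Aut ?D. map \<tau> a = a' i" for i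
  proof -
    have "\<exists>j. b j \<in> X" if "dfn k ?D X" "a' i \<in> X" for X
    proof -
      have "\<exists>js. sorted_wrt (<) js \<and> length js = length [i] \<and> concat (map b js) \<in> X"
        by (intro EM) (use that in simp_all)
      then show ?thesis by (auto simp: length_Suc_conv)
    qed
    moreover have "\<exists>\<sigma>\<in>Aut ?D. map \<sigma> a = b j" for j using \<sigma>D by (auto simp: b_def)
    ultimately show ?thesis using extraction_conjugate[of ?D a k "a' i" b, OF D at a'] by blast
  qed
  then obtain \<tau> where \<tau>: "\<And>i. \<tau> i \<in> Aut ?D" "\<And>i. map (\<tau> i) a = a' i" by metis
  have \<tau>C: "\<tau> i \<in> Aut C" for i using \<tau>(1)[of i] by (auto simp: Aut_def)
  have ind: "indiscernible M C a'"
    unfolding indiscernible_def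
  proof (intro allI impI, elim conjE)
    fix "is" js :: "nat list"
    assume s: "sorted_wrt (<) is" "sorted_wrt (<) js" "length is = length js"
    have t: "concat (map a' is) \<in> tups (length is * k)" "concat (map a' js) \<in> tups (length is * k)"
      using concat_map_in_tuples[of "is" a' k] concat_map_in_tuples[of js a' k] a' s(3) by auto
    have "concat (map a' is) \<in> X \<longleftrightarrow> concat (map a' js) \<in> X" if "dfn (length is * k) C X" for X
    proof -
      have "dfn (length is * k) ?D X" using definable_mono[OF that] by blast
      then show ?thesis using indisc[of "is" js X] indisc[of js "is" X] s by metis
    qed
    then show "tp M (concat (map a' is)) C = tp M (concat (map a' js)) C" using tp_eq_iff[OF t] by blast
  qed
  have "\<not> morley_sequence M C a'"
  proof
    assume "morley_sequence M C a'"
    then have nd: "\<not> dep C (map (\<tau> i) a) (\<Union>j<i. set (map (\<tau> j) a))" for i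
      using morley_sequence_iff[of C a' k, OF C a'] unfolding \<tau>(2) by blast
    have "dep C d (set a)" using dep_sym[OF C dt at d(2)] .
    then show False using not_dep_sequence_not_common[of C a k d _ \<tau>, OF C at dt _ \<tau>(1) nd] by blast
  qed
  moreover have "a' i \<in> realizations M k p" for i
    using realizations_orbit[OF p a C a'] \<tau>C \<tau>(2) by blast
  ultimately have "dep C (a' n) (\<Union>j<n. set (a' j))"
    using F[unfolded F_Mb_le_iff[OF p C]] ind by blast
  then have "dep C (a' n) (set (concat (map a' [0..<n])))" by (simp add: lessThan_atLeast0)
  moreover have et: "concat (map a' [0..<n]) \<in> tups (n * k)"
    using concat_map_in_tuples[of "[0..<n]" a' k] a' by simp
  \<comment> \<open>Openness expresses the dependence among the extracted terms by a definable set,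
    which the Ehrenfeucht-Mostowski property returns to \<open>n + 1\<close> terms of the sequence
    \<open>b\<close>.\<close>
  ultimately obtain Y where Y: "dfn (n * k + k) C Y" "concat (map a' [0..<n]) @ a' n \<in> Y"
    "\<And>\<sigma> e'. \<lbrakk>\<sigma> \<in> Aut C; e' \<in> tups (n * k); e' @ map \<sigma> (a' n) \<in> Y\<rbrakk> \<Longrightarrow> dep C (map \<sigma> (a' n)) (set e')"
    using dep_open[OF C a' et] by blast
  let ?is = "[0..<n] @ [n]"
  have "\<exists>js. sorted_wrt (<) js \<and> length js = length ?is \<and> concat (map b js) \<in> Y"
  proof (rule EM)
    show "sorted_wrt (<) ?is" by (auto simp: sorted_wrt_append)
    show "dfn (length ?is * k) ?D Y" using definable_mono[OF Y(1)] by (simp add: add.commute)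
    show "concat (map a' ?is) \<in> Y" using Y(2) by simp
  qed
  then obtain js where js: "sorted_wrt (<) js" "length js = Suc n" "concat (map b js) \<in> Y" by auto
  then obtain "is" i where "is": "js = is @ [i]" "length is = n"
    by (metis append_butlast_last_id length_append_singleton list.size(3) nat.distinct(1) nat.inject)
  have bi: "map (\<sigma> i) a = b i" by (simp add: b_def)
  \<comment> \<open>The last entry must be a conjugate of \<open>a' n\<close> over \<open>C\<close>;
    \<open>\<sigma> i \<circ> \<theta>\<close> carries \<open>a' n\<close> through \<open>a\<close>
    to \<open>b i\<close>.\<close>
  obtain \<theta> where \<theta>: "\<theta> \<in> Aut C" "\<And>x k. x \<in> tups k \<Longrightarrow> map \<theta> (map (\<tau> n) x) = x"
    using Aut_inverse[OF \<tau>C CU] by metis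
  have "map (\<sigma> i \<circ> \<theta>) (a' n) = b i" using \<theta>(2)[OF at] unfolding bi[symmetric] \<tau>(2)[of n, symmetric] by (metis map_map)
  moreover have "\<sigma> i \<circ> \<theta> \<in> Aut C" using Aut_comp[OF \<sigma>C \<theta>(1)] .
  moreover have "concat (map b is) \<in> tups (n * k)" using concat_map_in_tuples[of "is" b k] bt "is"(2) by simp
  ultimately have "dep C (b i) (set (concat (map b is)))"
    using Y(3)[of "\<sigma> i \<circ> \<theta>" "concat (map b is)"] js(3) "is"(1) by simp
  moreover have "set is \<subseteq> {..<i}" using js(1) "is"(1) by (auto simp: sorted_wrt_append)
  moreover have "card (set is) \<le> n" using card_length "is"(2) by metis
  ultimately show False using indep[of "set is" i] by simp
qed

section \<open>Regular types\<close>

text \<open>The type of \<open>b\<close> over \<open>C \<union> E\<close> is a forking extension of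
  \<open>p\<close>, hence orthogonal to \<open>p\<close>; so \<open>a\<close> is independent of
  \<open>b\<close> over \<open>C \<union> E\<close>, and transitivity finishes.\<close>

lemma regular_not_dep_Un:
  assumes p: "p \<in> types M k C" and C: "sm C" and reg: "regular_type M \<kappa> k C p"
    and a: "a \<in> realizations M k p" and b: "b \<in> realizations M k p" and E: "finite E" "E \<subseteq> U"
    and db: "dep C b E" and na: "\<not> dep C a E"
  shows "\<not> dep C a (E \<union> set b)"
proof -
  let ?D = "C \<union> E"
  have at: "a \<in> tups k" and bt: "b \<in> tups k" using a b by (auto simp: realizations_def)
  have D: "sm ?D" using small_Un[OF C small_finite[OF E]] .
  have DU: "?D \<subseteq> U" using small_subset_U[OF D] .
  have dep_Un: "dep C c ?D \<longleftrightarrow> dep C c E" for c by (simp add: dep_def Un_assoc[symmetric])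
  have "forking_extension M k C p ?D (tp M b ?D)"
    using forking_extension_tp[OF p C _ DU b] db dep_Un by simp
  then have "orthogonal M \<kappa> k C p k ?D (tp M b ?D)" using reg D unfolding regular_type_def by blast
  moreover have "b \<in> realizations M k (tp M b ?D)" using bt by (auto simp: realizations_def tp_def)
  moreover have "Defs.indep M a C ?D" using indep_iff[OF C DU at] na dep_Un by blast
  moreover have "Defs.indep M b ?D ?D" using indep_iff[OF D DU bt] not_dep_base[OF DU order_refl] by blast
  ultimately have "Defs.indep M a ?D (set b)" using a D unfolding orthogonal_def by blast
  then have "\<not> dep ?D a (set b)" using indep_iff[OF D _ at] bt by (simp add: tuples_def)
  then show ?thesis using not_dep_trans[OF C at E bt na] by blast
qed

text \<open>Elements dependent on \<open>E\<close> are adjoined one at a time without making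
  \<open>a\<close> dependent. The alternative \<open>b \<in> E\<close> handles members of
  \<open>E\<close> without appeal to their depending on themselves.\<close>

lemma regular_closure_trans:
  assumes p: "p \<in> types M k C" and C: "sm C" and reg: "regular_type M \<kappa> k C p"
    and a: "a \<in> realizations M k p" and B: "finite B" "B \<subseteq> realizations M k p"
    and E: "finite E" "E \<subseteq> realizations M k p"
    and BE: "\<And>b. b \<in> B \<Longrightarrow> b \<in> E \<or> dep C b (\<Union>e\<in>E. set e)"
    and d: "dep C a (\<Union>e\<in>E \<union> B. set e)"
  shows "dep C a (\<Union>e\<in>E. set e)"
proof (rule ccontr)
  assume na: "\<not> ?thesis"
  have "\<not> dep C a (\<Union>e\<in>E \<union> B. set e)"
    using B BE
  proof (induction B rule: finite_induct)
    case empty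
    then show ?case using na by simp
  next
    case (insert b B)
    then have IH: "\<not> dep C a (\<Union>e\<in>E \<union> B. set e)" by simp
    show ?case
    proof (cases "b \<in> E")
      case True
      then show ?thesis using IH by (simp add: insert_absorb)
    next
      case False
      have "finite (\<Union>e\<in>E \<union> B. set e)" using insert.hyps(1) E(1) by simp
      moreover have "(\<Union>e\<in>E \<union> B. set e) \<subseteq> U"
        using insert.prems(1) E(2) by (auto simp: realizations_def tuples_def)
      moreover have "dep C b (\<Union>e\<in>E \<union> B. set e)"
        using insert.prems(2)[of b] False by (blast intro: dep_subset)
      ultimately have "\<not> dep C a ((\<Union>e\<in>E \<union> B. set e) \<union> set b)"
        using regular_not_dep_Un[OF p C reg a] insert.prems(1) IH by blast
      then show ?thesis by (simp add: ac_simps)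
    qed
  qed
  then show False using d by blast
qed

text \<open>Symmetry over \<open>C \<union> E\<close>, followed by transitivity.\<close>

lemma dep_exchange:
  assumes C: "sm C" and a: "a \<in> tups k" and b: "b \<in> tups k" and E: "finite E" "E \<subseteq> U"
    and na: "\<not> dep C a E" and d: "dep C a (E \<union> set b)"
  shows "dep C b (E \<union> set a)"
proof (rule ccontr)
  assume "\<not> ?thesis"
  then have "\<not> dep (C \<union> E) b (set a)" using dep_mono[of "C \<union> E" b "set a" C "E \<union> set a"] by blast
  then have "\<not> dep (C \<union> E) a (set b)"
    using dep_sym[OF small_Un[OF C small_finite[OF E]] b a] by blast
  then show False using not_dep_trans[OF C a E b na] d by blast
qed

text \<open>Steinitz exchange: after \<open>i\<close> steps \<open>i\<close> members of
  \<open>E\<close> have been replaced by \<open>a 0, ..., a (i - 1)\<close>, and the rest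
  \<open>E'\<close> together with these still spans \<open>E\<close>.\<close>

lemma regular_dimension_le:
  assumes p: "p \<in> types M k C" and C: "sm C" and reg: "regular_type M \<kappa> k C p"
    and a: "\<And>i. i < m \<Longrightarrow> a i \<in> realizations M k p"
    and na: "\<And>i. i < m \<Longrightarrow> \<not> dep C (a i) (\<Union>j<i. set (a j))"
    and E: "finite E" "E \<subseteq> realizations M k p"
    and da: "\<And>i. i < m \<Longrightarrow> dep C (a i) (\<Union>e\<in>E. set e)"
  shows "m \<le> card E"
proof -
  let ?S = "\<lambda>X :: 'a list set. \<Union>x\<in>X. set x"
  have SU: "finite (?S X) \<and> ?S X \<subseteq> U" if "finite X" "X \<subseteq> realizations M k p" for X
    using that by (auto simp: realizations_def tuples_def)
  have "\<exists>E'\<subseteq>E. card E' + i = card E \<and>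
    (\<forall>e\<in>E. e \<in> a ` {..<i} \<union> E' \<or> dep C e (?S (a ` {..<i} \<union> E')))" if "i \<le> m" for i
    using that
  proof (induction i)
    case 0
    then show ?case by (intro exI[of _ E]) auto
  next
    case (Suc i)
    let ?F = "a ` {..<i}" and ?F' = "a ` {..<Suc i}"
    obtain E' where E': "E' \<subseteq> E" "card E' + i = card E"
      "\<And>e. e \<in> E \<Longrightarrow> e \<in> ?F \<union> E' \<or> dep C e (?S (?F \<union> E'))" using Suc by auto
    have i: "i < m" using Suc.prems by simp
    have Fp: "?F \<subseteq> realizations M k p" "?F' \<subseteq> realizations M k p" using a Suc.prems by auto
    have finE': "finite E'" and E'p: "E' \<subseteq> realizations M k p" using E'(1) E finite_subset by auto
    have "dep C (a i) (?S (?F \<union> E'))"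
    proof (rule regular_closure_trans[OF p C reg a[OF i] E])
      show "dep C (a i) (?S (?F \<union> E' \<union> E))" using da[OF i] by (rule dep_subset) blast
    qed (use finE' Fp E'p E'(3) in auto)
    \<comment> \<open>With \<open>E''\<close> of least size, removing a member \<open>e\<close>
      destroys the dependence, as exchange requires. It is nonempty because \<open>a i\<close> is
      independent of its predecessors.\<close>
    then have "\<exists>E''. (E'' \<subseteq> E' \<and> dep C (a i) (?S (?F \<union> E''))) \<and>
      (\<forall>G. G \<subseteq> E' \<and> dep C (a i) (?S (?F \<union> G)) \<longrightarrow> card E'' \<le> card G)"
      by (intro ex_has_least_nat[where k = E']) simp
    then obtain E'' where E'': "E'' \<subseteq> E'" "dep C (a i) (?S (?F \<union> E''))"
      and min: "\<And>G. G \<subseteq> E' \<Longrightarrow> dep C (a i) (?S (?F \<union> G)) \<Longrightarrow> card E'' \<le> card G"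
      by (elim exE conjE) simp
    have "E'' \<noteq> {}" using E''(2) na[OF i] by auto
    then obtain e where e: "e \<in> E''" by blast
    let ?G = "E'' - {e}"
    have finE'': "finite E''" using E''(1) finE' finite_subset by blast
    have nG: "\<not> dep C (a i) (?S (?F \<union> ?G))"
      using min[of ?G] E''(1) e finE'' by (metis Diff_subset card_Diff1_less leD subset_trans)
    have "dep C (a i) (?S (?F \<union> ?G) \<union> set e)" using E''(2) by (rule dep_subset) blast
    then have "dep C e (?S (?F \<union> ?G) \<union> set (a i))"
      using dep_exchange[OF C _ _ _ _ nG] a[OF i] e E''(1) E'p SU[of "?F \<union> ?G"] finE'' Fp(1)
      by (auto simp: realizations_def subset_iff)
    then have de: "dep C e (?S (?F' \<union> (E' - {e})))"
      by (rule dep_subset) (use E''(1) in \<open>auto simp: less_Suc_eq\<close>)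
    have eE': "e \<in> E'" using e E''(1) by blast
    show ?case
    proof (intro exI[of _ "E' - {e}"] conjI ballI)
      show "E' - {e} \<subseteq> E" using E'(1) by blast
      show "card (E' - {e}) + Suc i = card E"
        using E'(2) eE' finE' by (metis add_Suc_right add_Suc card_Suc_Diff1)
      fix x assume x: "x \<in> E"
      show "x \<in> ?F' \<union> (E' - {e}) \<or> dep C x (?S (?F' \<union> (E' - {e})))"
      proof (cases "x \<in> ?F \<union> E'")
        case True
        then show ?thesis using de by (auto simp: less_Suc_eq)
      next
        case False
        then have "dep C x (?S (?F \<union> E'))" using E'(3)[OF x] by blast
        then have "dep C x (?S (?F' \<union> (E' - {e}) \<union> (?F \<union> E')))" by (rule dep_subset) blast
        then have "dep C x (?S (?F' \<union> (E' - {e})))"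
        proof (rule regular_closure_trans[OF p C reg, rotated -1])
          show "b \<in> ?F' \<union> (E' - {e}) \<or> dep C b (?S (?F' \<union> (E' - {e})))" if "b \<in> ?F \<union> E'" for b
            using that de by (auto simp: less_Suc_eq)
        qed (use x E finE' Fp E'p in auto)
        then show ?thesis by blast
      qed
    qed
  qed
  from this[of m] show ?thesis by auto
qed

theorem covering_imp_F_Mb:
  assumes p: "p \<in> types M k C" and C: "sm C" and reg: "regular_type M \<kappa> k C p"
    and cover: "\<And>D q. sm D \<Longrightarrow> forking_extension M k C p D q \<Longrightarrow>
      \<exists>F. finite F \<and> (\<forall>as\<in>F. length as = n \<and> set as \<subseteq> realizations M k p) \<and>
        realizations M k q \<subseteq> (\<Union>as\<in>F. p_closure M k C p (\<Union>a\<in>set as. set a))"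
  shows "F_Mb M k C p \<le> enat n"
  unfolding F_Mb_le_iff[OF p C]
proof (intro allI impI, elim conjE)
  fix a assume a: "\<forall>i. a i \<in> realizations M k p" and ind: "indiscernible M C a"
    and nm: "\<not> morley_sequence M C a"
  have CU: "C \<subseteq> U" using small_subset_U[OF C] .
  have at: "a i \<in> tups k" for i using a by (simp add: realizations_def)
  obtain m where m: "dep C (a m) (\<Union>j<m. set (a j))"
    using nm ind morley_sequence_iff[of C a k, OF C at] by blast
  let ?D = "C \<union> (\<Union>j<m. set (a j))"
  have "(\<Union>j<m. set (a j)) \<subseteq> U" using at by (auto simp: tuples_def)
  then have D: "sm ?D" by (intro small_Un[OF C] small_finite) auto
  have "dep C (a m) ?D" using m by (rule dep_subset) blast
  then have "forking_extension M k C p ?D (tp M (a m) ?D)"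
    using forking_extension_tp[OF p C _ small_subset_U[OF D]] a by blast
  from cover[OF D this] obtain F where F: "finite F"
    "\<And>as. as \<in> F \<Longrightarrow> length as = n \<and> set as \<subseteq> realizations M k p"
    "realizations M k (tp M (a m) ?D) \<subseteq> (\<Union>as\<in>F. p_closure M k C p (\<Union>a\<in>set as. set a))"
    by (elim exE conjE) simp
  have "\<exists>as\<in>F. a i \<in> p_closure M k C p (\<Union>a\<in>set as. set a)" if i: "m \<le> i" for i
  \<comment> \<open>By indiscernibility all terms from \<open>m\<close> on realize the type of
    \<open>a m\<close> over \<open>?D\<close>, to which the cover applies.\<close>
  proof -
    obtain \<sigma> where \<sigma>: "\<sigma> \<in> Aut ?D" "map \<sigma> (a m) = a i"
      using indiscernible_Aut_last[OF ind at C i] by blast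
    have "a m \<in> realizations M k (tp M (a m) ?D)" using at by (auto simp: realizations_def tp_def)
    then have "a i \<in> realizations M k (tp M (a m) ?D)"
      using realizations_orbit[OF tp_in_types[OF at] _ D at] \<sigma> by blast
    then show ?thesis using F(3) by blast
  qed
  then have "\<forall>i\<in>{m..}. \<exists>as. as \<in> F \<and> a i \<in> p_closure M k C p (\<Union>a\<in>set as. set a)" by auto
  from bchoice[OF this] obtain f where f: "\<And>i. i \<in> {m..} \<Longrightarrow> f i \<in> F \<and> a i \<in> p_closure M k C p (\<Union>a\<in>set (f i). set a)"
    by blast
  \<comment> \<open>Infinitely many terms fall into the closure of one and the same list from the
    finite cover.\<close>
  have "finite (f ` {m..})" using f F(1) by (meson finite_subset image_subsetI)
  then obtain i\<^sub>0 where i0: "i\<^sub>0 \<in> {m..}" "infinite {i \<in> {m..}. f i = f i\<^sub>0}"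
    using pigeonhole_infinite[of "{m..}" f] infinite_Ici by blast
  let ?as = "f i\<^sub>0" and ?J = "{i \<in> {m..}. f i = f i\<^sub>0}"
  have as: "length ?as = n" "set ?as \<subseteq> realizations M k p" using F(2) f[OF i0(1)] by auto
  have asU: "(\<Union>a\<in>set ?as. set a) \<subseteq> U" using as(2) by (auto simp: realizations_def tuples_def)
  define h where "h = enumerate ?J"
  have h: "strict_mono h" unfolding h_def using i0(2) by (rule strict_mono_enumerate)
  have dh: "dep C (a (h i)) (\<Union>a\<in>set ?as. set a)" for i
  proof -
    have "h i \<in> ?J" unfolding h_def by (rule enumerate_in_set[OF i0(2)])
    then have "a (h i) \<in> p_closure M k C p (\<Union>a\<in>set ?as. set a)" using f[of "h i"] by auto
    then show ?thesis using indep_iff[OF C asU at] by (simp add: p_closure_def)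
  qed
  \<comment> \<open>These \<open>n + 1\<close> terms lie in the closure of a list of length
    \<open>n\<close>, so the dimension bound keeps them from being independent.\<close>
  have "\<exists>i<Suc n. dep C (a (h i)) (\<Union>j<i. set (a (h j)))"
  proof (rule ccontr)
    assume "\<not> ?thesis"
    then have "Suc n \<le> card (set ?as)"
      using regular_dimension_le[OF p C reg, of "Suc n" "a \<circ> h" "set ?as"] a as(2) dh by simp
    then show False using card_length[of ?as] as(1) by simp
  qed
  then obtain i where i: "i \<le> n" "dep C (a (h i)) (\<Union>j<i. set (a (h j)))" by (auto simp: less_Suc_eq_le)
  \<comment> \<open>The dependence found at positions \<open>h 0, ..., h i\<close> is moved to
    \<open>0, ..., i\<close> and then, as \<open>i \<le> n\<close>, up to \<open>n\<close>.\<close>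
  have s: "sorted_wrt (<) [0..<Suc i]" by (rule sorted_wrt_upt)
  obtain \<sigma> where \<sigma>: "\<sigma> \<in> Aut C" and eq: "\<And>l. l < length (map h [0..<Suc i]) \<Longrightarrow>
      map \<sigma> (a (map h [0..<Suc i] ! l)) = a ([0..<Suc i] ! l)"
    using indiscernible_Aut[OF ind at C sorted_wrt_map_strict_mono[OF h s] s] by auto
  have eq': "map \<sigma> (a (h l)) = a l" if "l \<le> i" for l
    using eq[of l] that by (simp del: upt_Suc)
  then have "\<sigma> ` set (a (h l)) = set (a l)" if "l \<le> i" for l using that by (metis list.set_map)
  then have "\<sigma> ` (\<Union>j<i. set (a (h j))) = (\<Union>j<i. set (a j))" by (simp add: image_UN)
  moreover have "(\<Union>j<i. set (a (h j))) \<subseteq> U" using at by (auto simp: tuples_def)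
  ultimately have "dep C (a i) (\<Union>j<i. set (a j))"
    using dep_Aut[OF i(2) \<sigma> CU] eq'[of i] by simp
  then show "dep C (a n) (\<Union>j<n. set (a j))" using indiscernible_dep_mono[OF ind at C _ i(1)] by blast
qed

end

section \<open>Small saturated submodels\<close>

lemma eval_trm_univ_update: "eval_trm (M\<lparr>univ := V\<rparr>) v t = eval_trm M v t"
proof (induction t)
  case (Fn f ts)
  then have "map (eval_trm (M\<lparr>univ := V\<rparr>) v) ts = map (eval_trm M v) ts" by simp
  then show ?case by (simp del: map_eq_conv)
qed simp

text \<open>The Tarski-Vaught test.\<close>

lemma elementary_submodelI:
  assumes M: "is_structure M" and V: "V \<subseteq> univ M" "V \<noteq> {}"
    and TV: "\<And>\<phi> v x. \<lbrakk>wf_fm M \<phi>; range v \<subseteq> V; \<exists>a\<in>univ M. sat M (v(x := a)) \<phi>\<rbrakk>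
      \<Longrightarrow> \<exists>a\<in>V. sat M (v(x := a)) \<phi>"
  shows "elementary_submodel (M\<lparr>univ := V\<rparr>) M"
proof -
  let ?N = "M\<lparr>univ := V\<rparr>"
  have sat: "sat ?N v \<phi> = sat M v \<phi>" if "wf_fm M \<phi>" "range v \<subseteq> V" for \<phi> v
    using that
  proof (induction \<phi> arbitrary: v)
    case (Rel r ts)
    have "map (eval_trm ?N v) ts = map (eval_trm M v) ts" by (simp add: eval_trm_univ_update)
    then show ?case by (simp del: map_eq_conv)
  next
    case (Ex x \<phi>)
    have "sat ?N (v(x := a)) \<phi> = sat M (v(x := a)) \<phi>" if "a \<in> V" for a
      by (rule Ex.IH) (use Ex.prems that in auto)
    then have "sat ?N v (Ex x \<phi>) \<longleftrightarrow> (\<exists>a\<in>V. sat M (v(x := a)) \<phi>)" by simp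
    also have "\<dots> \<longleftrightarrow> sat M v (Ex x \<phi>)" using TV[of \<phi> v x] Ex.prems V(1) by auto
    finally show ?case .
  qed (auto simp: eval_trm_univ_update)
  obtain e where e: "e \<in> V" using V(2) by blast
  have "fint M f a \<in> V" if f: "(f, n) \<in> funs M" and a: "a \<in> tuples ?N n" for f n a
  proof -
    \<comment> \<open>Variable \<open>n\<close> is fresh and its only possible value is that of the
      function, so the test puts this value into \<open>V\<close>.\<close>
    let ?\<phi> = "Eq (Var n) (Fn f (map Var [0..<n]))"
    define v where "v i = (if i < n then a ! i else e)" for i
    have v: "range v \<subseteq> V" using a e by (auto simp: v_def tuples_def)
    have *: "sat M (v(n := y)) ?\<phi> \<longleftrightarrow> y = fint M f a" for y
    proof -
      have "map (eval_trm M (v(n := y))) (map Var [0..<n]) = a"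
        by (rule nth_equalityI) (use a in \<open>auto simp: v_def tuples_def\<close>)
      then show ?thesis by (simp del: map_map)
    qed
    have "a \<in> tuples M n" using a V(1) by (auto simp: tuples_def)
    then have "fint M f a \<in> univ M" using M f unfolding is_structure_def by blast
    then show ?thesis using TV[of ?\<phi> v n] f v * by auto
  qed
  then have "is_structure ?N" using V(2) by (auto simp: is_structure_def)
  then show ?thesis
    unfolding elementary_submodel_def using V(1) sat by (auto simp: formulas_def)
qed

lemma card_of_lists_ordLeq:
  assumes "infinite J"
  shows "|lists J| \<le>o |J|"
proof -
  have "|{l \<in> lists J. length l = n}| \<le>o |J|" for n
  proof (induction n)
    case 0
    have "{l \<in> lists J. length l = 0} = {[]}" by auto
    moreover have "|{[]}| \<le>o |J|"
      using assms by (metis card_of_singl_ordLeq finite.emptyI)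
    ultimately show ?case by simp
  next
    case (Suc n)
    have "{l \<in> lists J. length l = Suc n} \<subseteq> (\<lambda>(x, l). x # l) ` (J \<times> {l \<in> lists J. length l = n})"
    proof
      fix l assume l: "l \<in> {l \<in> lists J. length l = Suc n}"
      then obtain x l' where "l = x # l'" by (cases l) auto
      then show "l \<in> (\<lambda>(x, l). x # l) ` (J \<times> {l \<in> lists J. length l = n})" using l by force
    qed
    then have "|{l \<in> lists J. length l = Suc n}| \<le>o |J \<times> {l \<in> lists J. length l = n}|"
      by (meson card_of_image card_of_mono1 ordLeq_transitive)
    also have "|J \<times> {l \<in> lists J. length l = n}| \<le>o |J|"
      using Suc assms by (intro card_of_Times_ordLeq_infinite_Field)
        (auto simp: Field_card_of card_of_card_order_on ordIso_imp_ordLeq card_of_refl)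
    finally show ?case .
  qed
  then have "|\<Union>n. {l \<in> lists J. length l = n}| \<le>o |J|"
    using assms infinite_iff_card_of_nat by (intro card_of_UNION_ordLeq_infinite) auto
  moreover have "lists J = (\<Union>n. {l \<in> lists J. length l = n})" by blast
  ultimately show ?thesis by simp
qed

lemma card_of_Pow_ordLeq:
  assumes "|A| \<le>o |B|"
  shows "|Pow A| \<le>o |Pow B|"
proof -
  obtain f where f: "inj_on f A" "f ` A \<subseteq> B" using card_of_ordLeq[of A B] assms by auto
  have "inj_on ((`) f) (Pow A)" using inj_on_image_Pow[OF f(1)] .
  moreover have "(`) f ` Pow A \<subseteq> Pow B" using f(2) by blast
  ultimately show ?thesis using card_of_ordLeq[of "Pow A" "Pow B"] by auto
qed

context monster_model
begin

text \<open>A submodel realizing all types over its subsets of size at most \<open>|J|\<close> is generated from \<open>E\<close> by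
  operations of arity \<open>J\<close>. Its elements are values of well-founded \<open>J\<close>-branching labelled trees; a tree
  is a set of pairs of a node and a piece of its label, which bounds the number of trees without
  transfinite recursion.\<close>

inductive tree_value :: "'a set \<Rightarrow> 'j set \<Rightarrow>
    ('j list \<times> (('a + nat \<times> nat) + (('f, 'r) fm \<times> 'j list))) set \<Rightarrow> 'a \<Rightarrow> bool" for E J where
  leaf: "\<lbrakk>{z. ([], z) \<in> t} = {Inl (Inl c)}; c \<in> E\<rbrakk> \<Longrightarrow> tree_value E J t c"
| node: "\<lbrakk>{z. ([], z) \<in> t} = insert (Inl (Inr (m, j))) (Inr ` q); q \<subseteq> formulas M \<times> lists J;
    \<forall>i\<in>J. tree_value E J {(l, z). (i # l, z) \<in> t} (x i);
    r = (\<lambda>(\<phi>, is). (\<phi>, map x is)) ` q; realizations M m r \<noteq> {}; j < m\<rbrakk>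
    \<Longrightarrow> tree_value E J t ((SOME a. a \<in> realizations M m r) ! j)"

text \<open>The tree determines its value: the coded parameters are lists over \<open>J\<close>, so
  only the values of the subtrees matter, and a fixed choice selects the realization. Hence there
  are at most as many values as trees.\<close>

lemma tree_value_unique: "tree_value E J t y \<Longrightarrow> tree_value E J t y' \<Longrightarrow> y = y'"
proof (induction t y arbitrary: y' rule: tree_value.induct)
  case (leaf t c)
  from leaf(3) show ?case
  proof cases
    case leaf': leaf
    then show ?thesis using leaf(1) by simp
  next
    case (node m j q x r)
    then have "Inl (Inr (m, j)) \<in> {z. ([], z) \<in> t}" by simp
    then show ?thesis unfolding leaf(1) by simp
  qed
next
  case (node t m j q x r)
  from node.prems show ?case
  proof cases
    case leaf
    then have "Inl (Inl y') \<in> {z. ([], z) \<in> t}" by simp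
    then show ?thesis unfolding node(1) by auto
  next
    case node': (node m' j' q' x' r')
    have "Inl (Inr (m, j)) \<in> {z. ([], z) \<in> t}" unfolding node(1) by simp
    then have mj: "m = m'" "j = j'" unfolding node'(2) by auto
    have "z \<in> q \<longleftrightarrow> z \<in> q'" for z
    proof -
      have "Inr z \<in> {z. ([], z) \<in> t} \<longleftrightarrow> z \<in> q" unfolding node(1) by auto
      moreover have "Inr z \<in> {z. ([], z) \<in> t} \<longleftrightarrow> z \<in> q'" unfolding node'(2) by auto
      ultimately show ?thesis by simp
    qed
    then have q: "q = q'" by blast
    have "x i = x' i" if "i \<in> J" for i using node.IH node'(4) that by blast
    then have "map x is = map x' is" if "is \<in> lists J" for "is" using that by auto
    then have "(\<phi>, map x is) = (\<phi>, map x' is)" if "(\<phi>, is) \<in> q" for \<phi> "is"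
      using node(2) that by blast
    then have "(\<lambda>(\<phi>, is). (\<phi>, map x is)) ` q = (\<lambda>(\<phi>, is). (\<phi>, map x' is)) ` q"
      by (intro image_cong refl) force
    then have "r = r'" using \<open>r = (\<lambda>(\<phi>, is). (\<phi>, map x is)) ` q\<close> node'(5) q by simp
    then show ?thesis using node'(1) mj by simp
  qed
qed

lemma tree_value_in_U:
  assumes "tree_value E J t y" "E \<subseteq> U"
  shows "y \<in> U"
  using assms(1)
proof cases
  case (node m j q x r)
  then have "(SOME a. a \<in> realizations M m r) \<in> realizations M m r" by (intro some_in_eq[THEN iffD2])
  then show ?thesis using node by (auto simp: realizations_def tuples_def)
qed (use assms(2) in auto)

lemma small_saturated_submodel:
  assumes C: "C \<subseteq> U" "|Pow (C <+> formulas M)| <o \<kappa>" and D: "finite D" "D \<subseteq> U"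
  obtains N where "elementary_submodel N M" "sm (univ N)" "C \<union> D \<subseteq> univ N"
    "saturated N (cardSuc |C| +c natLeq)"
proof -
  \<comment> \<open>Of size \<open>|C| + |T|\<close>: large enough to enumerate every parameter set
    that saturation requires, small enough that its power set stays below
    \<open>\<kappa>\<close>.\<close>
  define J where "J = C <+> formulas M"
  have J: "infinite J" using infinite_formulas by (simp add: J_def finite_Plus_iff)
  obtain e where e: "e \<in> U" using is_struct by (auto simp: is_structure_def)
  define E where "E = insert e (C \<union> D)"
  have EU: "E \<subseteq> U" and eE: "e \<in> E" using C(1) D(2) e by (auto simp: E_def)
  have CJ: "|C| \<le>o |J|" and FJ: "|formulas M| \<le>o |J|"
    unfolding J_def by (rule card_of_Plus1, rule card_of_Plus2)
  have natJ: "|UNIV :: nat set| \<le>o |J|" using J infinite_iff_card_of_nat by blast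
  have natLeqJ: "natLeq \<le>o |J|" using J infinite_iff_natLeq_ordLeq by blast
  have finJ: "|X| \<le>o |J|" if "finite X" for X :: "'a set"
    using that natLeqJ finite_iff_ordLess_natLeq ordLess_ordLeq_trans ordLess_imp_ordLeq by metis
  have FieldJ: "\<not> finite (Field |J| )" using J by (simp add: Field_card_of)
  have cJ: "Card_order |J|" by (rule card_of_Card_order)
  have EJ: "|E| \<le>o |J|"
    unfolding E_def using card_of_Un_ordLeq_infinite_Field[OF FieldJ CJ finJ[of "insert e D"] cJ] D(1)
    by simp
  have LJ: "|lists J| \<le>o |J|" by (rule card_of_lists_ordLeq[OF J])
  define K where "K = (E <+> (UNIV :: (nat \<times> nat) set)) <+> (formulas M \<times> lists J)"
  have "|UNIV \<times> UNIV :: (nat \<times> nat) set| \<le>o |J|"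
    by (rule card_of_Times_ordLeq_infinite_Field[OF FieldJ natJ natJ cJ])
  then have "|K| \<le>o |J|"
    unfolding K_def
    using card_of_Plus_ordLeq_infinite_Field[OF FieldJ _ _ cJ] EJ FJ LJ
      card_of_Times_ordLeq_infinite_Field[OF FieldJ _ _ cJ] by (metis UNIV_Times_UNIV)
  then have KJ: "|lists J \<times> K| \<le>o |J|"
    by (rule card_of_Times_ordLeq_infinite_Field[OF FieldJ LJ _ cJ])
  define T where "T = Pow (lists J \<times> K)"
  define V where "V = {y. \<exists>t\<in>T. tree_value E J t y}"
  have VU: "V \<subseteq> U" using tree_value_in_U[OF _ EU] by (auto simp: V_def)
  have "V \<subseteq> (\<lambda>t. THE y. tree_value E J t y) ` T"
  proof
    fix y assume "y \<in> V"
    then obtain t where t: "t \<in> T" "tree_value E J t y" by (auto simp: V_def)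
    then have "(THE y. tree_value E J t y) = y" using tree_value_unique by (intro the_equality) blast+
    then show "y \<in> (\<lambda>t. THE y. tree_value E J t y) ` T" using t(1) by force
  qed
  then have "|V| \<le>o |T|" by (meson card_of_image card_of_mono1 ordLeq_transitive)
  also have "|T| \<le>o |Pow J|" unfolding T_def by (rule card_of_Pow_ordLeq[OF KJ])
  finally have "|V| <o \<kappa>" using C(2) ordLeq_ordLess_trans unfolding J_def by blast
  then have Vsm: "sm V" using VU by (simp add: small_def)
  have EV: "E \<subseteq> V"
  proof
    fix c assume c: "c \<in> E"
    have "tree_value E J {([], Inl (Inl c))} c" by (rule tree_value.leaf) (use c in auto)
    moreover have "{([], Inl (Inl c))} \<in> T" using c by (auto simp: T_def K_def)
    ultimately show "c \<in> V" unfolding V_def by blast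
  qed
  \<comment> \<open>The closure property behind both the Tarski-Vaught test and saturation: what is
    realized in the monster is realized in \<open>V\<close>.\<close>
  have realize: "\<exists>a\<in>realizations M m q. set a \<subseteq> V"
    if B: "B \<subseteq> V" "|B| \<le>o |J|" and q: "q \<subseteq> pformulas M m B" "realizations M m q \<noteq> {}" for B m q
  proof -
    \<comment> \<open>Adjoining \<open>e\<close> makes the set nonempty, so that \<open>J\<close>
      can be mapped onto it.\<close>
    have "|insert e B| \<le>o |J|"
      using card_of_Un_ordLeq_infinite_Field[OF FieldJ finJ[of "{e}"] B(2) cJ] by simp
    then obtain x where x: "x ` J = insert e B" using card_of_ordLeq2[of "insert e B" J] by auto
    have "insert e B \<subseteq> V" using B(1) EV eE by blast
    then have "x i \<in> V" if "i \<in> J" for i using x that by (metis image_eqI subsetD)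
    then have "\<forall>i\<in>J. \<exists>t. t \<in> T \<and> tree_value E J t (x i)" by (auto simp: V_def)
    from bchoice[OF this] obtain c where c: "\<And>i. i \<in> J \<Longrightarrow> c i \<in> T \<and> tree_value E J (c i) (x i)" by blast
    define q' where "q' = {(\<phi>, is). \<phi> \<in> formulas M \<and> is \<in> lists J \<and> (\<phi>, map x is) \<in> q}"
    have q': "(\<lambda>(\<phi>, is). (\<phi>, map x is)) ` q' = q"
    proof (intro equalityI subsetI)
      fix \<delta> assume \<delta>: "\<delta> \<in> q"
      obtain \<phi> b where [simp]: "\<delta> = (\<phi>, b)" by force
      have b: "\<phi> \<in> formulas M" "set b \<subseteq> x ` J" using \<delta> q(1) x by (auto simp: pformulas_def)
      then have "b \<in> map x ` lists J" by (simp add: lists_image[symmetric] in_lists_conv_set subset_iff)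
      then obtain "is" where "is \<in> lists J" "b = map x is" by blast
      then show "\<delta> \<in> (\<lambda>(\<phi>, is). (\<phi>, map x is)) ` q'" using \<delta> b(1)
        by (intro image_eqI[of _ _ "(\<phi>, is)"]) (auto simp: q'_def)
    qed (auto simp: q'_def)
    let ?a = "SOME a. a \<in> realizations M m q"
    have a: "?a \<in> realizations M m q" using q(2) by (intro some_in_eq[THEN iffD2])
    have "?a ! j \<in> V" if j: "j < m" for j
    proof -
      \<comment> \<open>The root codes the formulas and the wanted coordinate; below
        \<open>i\<close> hangs the tree whose value is the parameter \<open>x i\<close>.\<close>
      define t where "t = {[]} \<times> insert (Inl (Inr (m, j))) (Inr ` q') \<union>
        (\<Union>i\<in>J. (\<lambda>(l, z). (i # l, z)) ` c i)"
      have sub: "{(l, z). (i # l, z) \<in> t} = c i" if "i \<in> J" for i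
        using that by (auto simp: t_def)
      have "tree_value E J t (?a ! j)"
      proof (rule tree_value.node)
        show "{z. ([], z) \<in> t} = insert (Inl (Inr (m, j))) (Inr ` q')" by (auto simp: t_def)
        show "q' \<subseteq> formulas M \<times> lists J" by (auto simp: q'_def)
        show "\<forall>i\<in>J. tree_value E J {(l, z). (i # l, z) \<in> t} (x i)" using c sub by simp
        show "q = (\<lambda>(\<phi>, is). (\<phi>, map x is)) ` q'" using q' by simp
      qed (use q(2) j in auto)
      moreover have "t \<in> T"
      proof -
        have "insert (Inl (Inr (m, j))) (Inr ` q') \<subseteq> K" by (auto simp: K_def q'_def)
        moreover have "(\<lambda>(l, z). (i # l, z)) ` c i \<subseteq> lists J \<times> K" if i: "i \<in> J" for i
        proof
          fix w assume "w \<in> (\<lambda>(l, z). (i # l, z)) ` c i"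
          then obtain l z where w: "(l, z) \<in> c i" "w = (i # l, z)" by auto
          then have "(l, z) \<in> lists J \<times> K" using c[OF i] unfolding T_def by blast
          then show "w \<in> lists J \<times> K" using w(2) i by simp
        qed
        ultimately show ?thesis unfolding t_def T_def by blast
      qed
      ultimately show ?thesis unfolding V_def by blast
    qed
    moreover have "length ?a = m" using a by (simp add: realizations_def tuples_def)
    ultimately have "set ?a \<subseteq> V" by (metis in_set_conv_nth subsetI)
    then show ?thesis using a by blast
  qed
  let ?N = "M\<lparr>univ := V\<rparr>"
  have N: "elementary_submodel ?N M"
  proof (rule elementary_submodelI[OF is_struct VU])
    show "V \<noteq> {}" using EV eE by blast
    fix \<phi> v x assume \<phi>: "wf_fm M \<phi>" and v: "range v \<subseteq> V" and ex: "\<exists>a\<in>U. sat M (v(x := a)) \<phi>"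
    define s where "s i = (if i = x then Inl (0 :: nat) else Inr (v i))" for i
    let ?B = "v ` fv \<phi>" and ?X = "{y \<in> tups 1. sat M (assignment s y) \<phi>}"
    have eq: "assignment s [a] = v(x := a)" for a by (auto simp: assignment_def s_def fun_eq_iff)
    have "dfn 1 ?B ?X"
      by (rule definableI[of \<phi> 1 ?B s]) (use \<phi> v VU in \<open>auto simp: admissible_def s_def\<close>)
    then obtain \<delta> where \<delta>: "\<delta> \<in> pformulas M 1 ?B" "?X = realizations M 1 {\<delta>}" unfolding definable_def by blast
    obtain a where "a \<in> U" "sat M (v(x := a)) \<phi>" using ex by blast
    then have "[a] \<in> ?X" using eq[of a] by (simp add: tuples_def)
    then have "realizations M 1 {\<delta>} \<noteq> {}" using \<delta>(2) by blast
    then have "\<exists>a\<in>realizations M 1 {\<delta>}. set a \<subseteq> V"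
      using v \<delta>(1) finJ[of ?B] finite_fv[of \<phi>] by (intro realize[of ?B]) auto
    then obtain y where y: "y \<in> ?X" "set y \<subseteq> V" using \<delta>(2) by blast
    then obtain a where "y = [a]" by (auto simp: tuples_def length_Suc_conv)
    then show "\<exists>a\<in>V. sat M (v(x := a)) \<phi>" using y eq[of a] by auto
  qed
  moreover have "saturated ?N (cardSuc |C| +c natLeq)"
    unfolding saturated_def
  proof (intro allI impI ballI)
    fix B m q assume B: "B \<subseteq> univ ?N" "|B| <o cardSuc |C| +c natLeq" and q: "q \<in> types ?N m B"
    have BV: "B \<subseteq> V" using B(1) by simp
    \<comment> \<open>Both summands are at most \<open>cardSuc |J|\<close>, so the sets
      \<open>B\<close> in question have size at most \<open>|J|\<close>.\<close>
    have "cardSuc |C| \<le>o cardSuc |J|" using CJ cardSuc_mono_ordLeq[OF card_of_Card_order cJ] by blast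
    moreover have "natLeq \<le>o cardSuc |J|"
      using natLeqJ cardSuc_greater[OF cJ] ordLeq_ordLess_trans ordLess_imp_ordLeq by blast
    moreover have "Cinfinite (cardSuc |J| )" using J by (intro Cinfinite_cardSuc) (simp add: cinfinite_def Field_card_of card_of_card_order_on)
    ultimately have "cardSuc |C| +c natLeq \<le>o cardSuc |J|"
      using cardSuc_Card_order[OF card_of_Card_order] natLeq_Card_order
      by (intro csum_cinfinite_bound) auto
    then have "|B| <o cardSuc |J|" using B(2) ordLess_ordLeq_trans by blast
    then have BJ: "|B| \<le>o |J|" using cardSuc_ordLeq_ordLess[OF cJ card_of_Card_order] by blast
    have Bsm: "sm B" using small_subset[OF Vsm BV] .
    have qM: "q \<subseteq> pformulas M m B" using q pformulas_submodel[OF N] by (auto simp: types_def)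
    then have qN: "q \<subseteq> pformulas M m (univ ?N)" using B(1) by (auto simp: pformulas_def)
    \<comment> \<open>Consistency in the submodel gives a realization in the monster, as
      \<open>B\<close> is small; \<open>realize\<close> then replaces it by one in
      \<open>V\<close>.\<close>
    obtain a where "a \<in> tups m" "\<And>X. X \<in> (\<lambda>\<delta>. realizations M m {\<delta>}) ` q \<Longrightarrow> a \<in> X"
    proof (rule realize_definable_sets[OF Bsm, of "(\<lambda>\<delta>. realizations M m {\<delta>}) ` q" m])
      show "dfn m B X" if "X \<in> (\<lambda>\<delta>. realizations M m {\<delta>}) ` q" for X
        using that qM unfolding definable_def by blast
      fix S assume "finite S" "S \<subseteq> (\<lambda>\<delta>. realizations M m {\<delta>}) ` q"
      then obtain q\<^sub>0 where q0: "q\<^sub>0 \<subseteq> q" "finite q\<^sub>0" "S = (\<lambda>\<delta>. realizations M m {\<delta>}) ` q\<^sub>0"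
        by (meson finite_subset_image)
      then have "realizations ?N m q\<^sub>0 \<noteq> {}" using q unfolding types_def by blast
      then obtain y where "y \<in> realizations M m q\<^sub>0"
        using realizations_submodel[OF N, of q\<^sub>0 m] q0(1) qN by blast
      then have "y \<in> tups m \<inter> \<Inter>S" using q0(3) by (auto simp: realizations_def)
      then show "tups m \<inter> \<Inter>S \<noteq> {}" by blast
    qed blast
    then have "realizations M m q \<noteq> {}" by (auto simp: realizations_def)
    then obtain a where "a \<in> realizations M m q" "set a \<subseteq> V" using realize[OF BV BJ qM] by blast
    then have "a \<in> realizations M m q \<inter> tuples ?N m" by (auto simp: realizations_def tuples_def)
    then show "realizations ?N m q \<noteq> {}" using realizations_submodel[OF N qN] by blast
  qed
  moreover have "C \<union> D \<subseteq> univ ?N" "sm (univ ?N)" using EV Vsm by (auto simp: E_def)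
  ultimately show thesis using that by blast
qed

end

section \<open>Weak degeneracy and finite covers\<close>

text \<open>Weak degeneracy supplies at most \<open>n\<close> elements while the cover wants lists
  of length \<open>n\<close>; repetition pads a nonempty set.\<close>

lemma list_of_card_le:
  assumes "finite B" "B \<noteq> {}" "card B \<le> n"
  obtains xs where "set xs = B" "length xs = n"
proof -
  obtain ys where ys: "set ys = B" "distinct ys" using finite_distinct_list[OF assms(1)] by blast
  have len: "length ys = card B" using ys distinct_card by metis
  have ne: "ys \<noteq> []" using ys(1) assms(2) by auto
  show thesis
  proof (rule that[of "ys @ replicate (n - card B) (hd ys)"])
    show "set (ys @ replicate (n - card B) (hd ys)) = B"
      using ys(1) ne by (auto simp: set_replicate_conv_if)
    show "length (ys @ replicate (n - card B) (hd ys)) = n" using len assms(3) by simp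
  qed
qed

context simple_monster
begin

theorem weakly_degenerate_imp_covering:
  assumes p: "p \<in> types M k C" and CU: "C \<subseteq> U" and card: "|Pow (C <+> formulas M)| <o \<kappa>" and C: "sm C"
    and wd: "weakly_degenerate M \<kappa> n k C p" and D: "sm D" and fe: "forking_extension M k C p D q"
  shows "\<exists>F. finite F \<and> (\<forall>as\<in>F. length as = n \<and> set as \<subseteq> realizations M k p) \<and>
    realizations M k q \<subseteq> (\<Union>as\<in>F. p_closure M k C p (\<Union>a\<in>set as. set a))"
proof -
  have DU: "D \<subseteq> U" using small_subset_U[OF D] .
  have CD: "C \<subseteq> D" and q: "q \<in> types M k D" and pq: "p \<subseteq> q" using fe by (auto simp: forking_extension_def)
  have qp: "a \<in> realizations M k p" if "a \<in> realizations M k q" for a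
    using that pq by (auto simp: realizations_def)
  obtain a\<^sub>0 where a0: "a\<^sub>0 \<in> realizations M k q"
    using monster q D unfolding monster_def saturated_def small_def by blast
  have "q = tp M a\<^sub>0 D" by (rule type_eq_tp[OF q a0])
  then have "dep C a\<^sub>0 D" using fe forking_extension_tp[OF p C CD DU qp[OF a0]] by simp
  moreover have "length a\<^sub>0 = k" using a0 by (simp add: realizations_def tuples_def)
  ultimately obtain X r where X: "dfn k (C \<union> D) X" "a\<^sub>0 \<in> X" "sdiv C r X" by (auto simp: dep_def)
  \<comment> \<open>One finite \<open>d\<close> serves all realizations of \<open>q\<close>: they
    are conjugate over \<open>D\<close>, and \<open>X\<close> is definable over
    \<open>D\<close>.\<close>
  obtain d where d: "set d \<subseteq> D" "dfn k (C \<union> set d) X" using definable_finite_support[OF X(1)] by blast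
  have dU: "set d \<subseteq> U" using d(1) DU by blast
  have dt: "d \<in> tups (length d)" using dU by (simp add: tuples_def)
  have dep_d: "dep C a (set d)" if a: "a \<in> realizations M k q" for a
  proof -
    have at: "a \<in> tups k" and a0t: "a\<^sub>0 \<in> tups k" using a a0 by (auto simp: realizations_def)
    obtain \<sigma> where \<sigma>: "\<sigma> \<in> Aut D" "map \<sigma> a\<^sub>0 = a" using realizations_orbit[OF q a0 D at] a by blast
    have "dfn k D X" using X(1) CD by (simp add: Un_absorb1)
    then have "a \<in> X" using definable_invariant[OF _ DU \<sigma>(1) a0t] \<sigma>(2) X(2) by blast
    then show ?thesis using d(2) X(3) at by (auto simp: dep_def tuples_def)
  qed
  obtain N where N: "elementary_submodel N M" "sm (univ N)" "C \<union> set d \<subseteq> univ N"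
    "saturated N (cardSuc |C| +c natLeq)"
    using small_saturated_submodel[OF CU card _ dU] by blast
  have CN: "C \<subseteq> univ N" and dN: "set d \<subseteq> univ N" using N(3) by auto
  have pN: "p \<subseteq> pformulas M k (univ N)" using p CN by (auto simp: types_def pformulas_def)
  have pNM: "realizations N k p = realizations M k p \<inter> tuples N k" by (rule realizations_submodel[OF N(1) pN])
  \<comment> \<open>Openness made uniform: all realizations of \<open>p\<close> are conjugate over
    \<open>C\<close>, so a set \<open>Y\<close> found for one of them works for all.\<close>
  define good where "good Y \<longleftrightarrow> dfn (n * k + k) C Y \<and>
    (\<forall>x\<in>realizations M k p. \<forall>e\<in>tups (n * k). e @ x \<in> Y \<longrightarrow> dep C x (set e))" for Y
  define P where "P = {(as, Y). length as = n \<and> set as \<subseteq> realizations N k p \<and> good Y}"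
  have concat_t: "concat as \<in> tups (n * k) \<and> set (concat as) \<subseteq> univ N" if "(as, Y) \<in> P" for as Y
  proof -
    have len: "length as = n" and sub: "set as \<subseteq> realizations N k p" using that by (auto simp: P_def)
    have "set as \<subseteq> tups k" using sub tuples_submodel[OF N(1)] by (auto simp: realizations_def)
    then have "concat (map id as) \<in> tups (length as * k)" by (intro concat_map_in_tuples) auto
    then show ?thesis using len sub by (auto simp: realizations_def tuples_def)
  qed
  have covered: "\<exists>(as, Y)\<in>P. concat as @ a \<in> Y" if a: "a \<in> realizations M k q" for a
  proof -
    have at: "a \<in> tups k" and ap: "a \<in> realizations M k p" using a qp by (auto simp: realizations_def)
    obtain \<sigma> :: "nat \<Rightarrow> 'a \<Rightarrow> 'a" where \<sigma>: "\<And>i. \<sigma> i \<in> Aut (C \<union> set d \<union> (\<Union>j<i. set (map (\<sigma> j) a)))"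
      "\<And>i. map (\<sigma> i) a \<in> tuples N k"
      using submodel_sequence[OF N(1) CN N(4) C at dN] by blast
    have bt: "map (\<sigma> i) a \<in> tups k" for i using \<sigma>(2) tuples_submodel[OF N(1)] by blast
    have \<sigma>C: "\<sigma> i \<in> Aut C" and \<sigma>d: "\<sigma> i \<in> Aut (C \<union> set d)" for i using \<sigma>(1)[of i] by (auto simp: Aut_def)
    have bp: "map (\<sigma> i) a \<in> realizations N k p" for i
      unfolding pNM using realizations_orbit[OF p ap C bt] \<sigma>(2) \<sigma>C by blast
    \<comment> \<open>Otherwise the sequence in \<open>N\<close> would be independent over
      \<open>C\<close>, contrary to the dependence of \<open>a\<close> on \<open>d\<close>.\<close>
    have "dep C a (\<Union>b\<in>realizations N k p. set b)"
    proof (rule ccontr)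
      assume nd: "\<not> ?thesis"
      have "\<not> dep C (map (\<sigma> i) a) (\<Union>j<i. set (map (\<sigma> j) a))" for i
      proof
        let ?B = "\<Union>j<i. set (map (\<sigma> j) a)"
        assume "dep C (map (\<sigma> i) a) ?B"
        moreover have "\<sigma> i \<in> Aut (C \<union> ?B)" using \<sigma>(1)[of i] by (auto simp: Aut_def)
        moreover have "?B \<subseteq> U" using bt by (auto simp: tuples_def)
        ultimately have "dep C a ?B" using dep_Aut_fixedD[OF _ _ CU _ at] by blast
        then have "dep C a (\<Union>b\<in>realizations N k p. set b)" by (rule dep_subset) (use bp in blast)
        then show False using nd by blast
      qed
      moreover have "dep C d (set a)" using dep_sym[OF C dt at dep_d[OF a]] .
      ultimately show False
        using not_dep_sequence_not_common[of C a k d _ \<sigma>, OF C at dt _ \<sigma>d] by blast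
    qed
    then have "\<exists>B\<^sub>0 \<subseteq> realizations N k p. finite B\<^sub>0 \<and> card B\<^sub>0 \<le> n \<and> dep C a (\<Union>b\<in>B\<^sub>0. set b)"
      using wd[unfolded weakly_degenerate_iff[OF C]] ap N(1,2,4) CN by blast
    then obtain B\<^sub>0 where B0: "B\<^sub>0 \<subseteq> realizations N k p" "finite B\<^sub>0" "card B\<^sub>0 \<le> n" "dep C a (\<Union>b\<in>B\<^sub>0. set b)"
      by blast
    have "B\<^sub>0 \<noteq> {}" using B0(4) not_dep_base[OF CU, of "{}" a] by auto
    then obtain as where as: "set as = B\<^sub>0" "length as = n" using list_of_card_le[OF B0(2) _ B0(3)] by blast
    have "set as \<subseteq> tups k" using as(1) B0(1) tuples_submodel[OF N(1)] by (auto simp: realizations_def)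
    then have "concat (map id as) \<in> tups (length as * k)" by (intro concat_map_in_tuples) auto
    then have et: "concat as \<in> tups (n * k)" using as(2) by simp
    have "dep C a (set (concat as))" using B0(4) as(1) by simp
    then obtain Y where Y: "dfn (n * k + k) C Y" "concat as @ a \<in> Y"
      "\<And>\<sigma> e'. \<lbrakk>\<sigma> \<in> Aut C; e' \<in> tups (n * k); e' @ map \<sigma> a \<in> Y\<rbrakk> \<Longrightarrow> dep C (map \<sigma> a) (set e')"
      using dep_open[OF C at et] by blast
    have "good Y"
      unfolding good_def
    proof (intro conjI ballI impI)
      fix x e assume x: "x \<in> realizations M k p" and e: "e \<in> tups (n * k)" "e @ x \<in> Y"
      have "x \<in> tups k" using x by (simp add: realizations_def)
      then obtain \<tau> where "\<tau> \<in> Aut C" "map \<tau> a = x" using realizations_orbit[OF p ap C] x by blast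
      then show "dep C x (set e)" using Y(3)[of \<tau> e] e by blast
    qed (rule Y(1))
    then have "(as, Y) \<in> P" using as B0(1) by (simp add: P_def)
    then show ?thesis using Y(2) by blast
  qed
  \<comment> \<open>The complements of the open conditions with parameters in \<open>N\<close> are
    inconsistent with \<open>q\<close>; compactness leaves finitely many of them, and their lists
    form the cover.\<close>
  define g where "g = (\<lambda>(as, Y). tups k - {x \<in> tups k. concat as @ x \<in> Y})"
  define \<X> where "\<X> = (\<lambda>\<delta>. realizations M k {\<delta>}) ` q \<union> g ` P"
  let ?E = "D \<union> univ N"
  have E: "sm ?E" "?E \<subseteq> U" using small_Un[OF D N(2)] small_subset_U by auto
  have dfnX: "dfn k ?E X" if "X \<in> \<X>" for X
    using that unfolding \<X>_def
  proof
    assume "X \<in> (\<lambda>\<delta>. realizations M k {\<delta>}) ` q"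
    then obtain \<delta> where "\<delta> \<in> q" "X = realizations M k {\<delta>}" by blast
    moreover have "q \<subseteq> pformulas M k D" using q by (simp add: types_def)
    ultimately have "dfn k D X" unfolding definable_def by blast
    then show ?thesis by (rule definable_mono) blast
  next
    assume "X \<in> g ` P"
    then obtain as Y where asY: "(as, Y) \<in> P" "X = tups k - {x \<in> tups k. concat as @ x \<in> Y}"
      by (auto simp: g_def)
    have "dfn (n * k + k) C Y" using asY(1) by (simp add: P_def good_def)
    then have "dfn k (C \<union> set (concat as)) {x \<in> tups k. concat as @ x \<in> Y}"
      using definable_front_fibre[OF _ _ CU] concat_t[OF asY(1)] by blast
    then have "dfn k ?E {x \<in> tups k. concat as @ x \<in> Y}"
      by (rule definable_mono) (use CD concat_t[OF asY(1)] in blast)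
    then show ?thesis unfolding asY(2) by (rule definable_complement[OF _ E(2)])
  qed
  have "\<exists>T. finite T \<and> T \<subseteq> \<X> \<and> tups k \<inter> \<Inter>T = {}"
  proof (rule ccontr)
    assume no: "\<not> ?thesis"
    obtain a where a: "a \<in> tups k" "\<And>X. X \<in> \<X> \<Longrightarrow> a \<in> X"
    proof (rule realize_definable_sets[of ?E \<X> k])
      show "tups k \<inter> \<Inter>T \<noteq> {}" if "finite T" "T \<subseteq> \<X>" for T using no that by blast
    qed (use E dfnX in blast)+
    then have "a \<in> realizations M k q" by (auto simp: \<X>_def realizations_def)
    then obtain as Y where "(as, Y) \<in> P" "concat as @ a \<in> Y" using covered by blast
    moreover then have "g (as, Y) \<in> \<X>" by (simp add: \<X>_def)
    ultimately show False using a by (auto simp: g_def)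
  qed
  then obtain T where T: "finite T" "T \<subseteq> \<X>" "tups k \<inter> \<Inter>T = {}" by blast
  have "finite (T \<inter> g ` P)" "T \<inter> g ` P \<subseteq> g ` P" using T(1) by auto
  then have "\<exists>P'\<subseteq>P. finite P' \<and> T \<inter> g ` P = g ` P'" by (rule finite_subset_image)
  then obtain P' where P': "P' \<subseteq> P" "finite P'" "T \<inter> g ` P = g ` P'" by (elim exE conjE)
  show ?thesis
  proof (intro exI[of _ "fst ` P'"] conjI ballI)
    show "finite (fst ` P')" using P'(2) by simp
    show "length as = n" "set as \<subseteq> realizations M k p" if "as \<in> fst ` P'" for as
      using that P'(1) pNM by (auto simp: P_def)
    show "realizations M k q \<subseteq> (\<Union>as\<in>fst ` P'. p_closure M k C p (\<Union>a\<in>set as. set a))"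
    proof
      fix a assume a: "a \<in> realizations M k q"
      then have at: "a \<in> tups k" by (simp add: realizations_def)
      then obtain X where X: "X \<in> T" "a \<notin> X" using T(3) by blast
      have "X \<notin> (\<lambda>\<delta>. realizations M k {\<delta>}) ` q"
        using X(2) a by (auto simp: realizations_def)
      then have "X \<in> T \<inter> g ` P" using X(1) T(2) by (auto simp: \<X>_def)
      then have "X \<in> g ` P'" unfolding P'(3) .
      then obtain as Y where asY: "(as, Y) \<in> P'" "X = g (as, Y)" by auto
      then have asP: "(as, Y) \<in> P" using P'(1) by blast
      have "concat as @ a \<in> Y" using X(2) at asY(2) by (simp add: g_def)
      then have "dep C a (set (concat as))"
        using asP concat_t[OF asP] qp[OF a] unfolding P_def good_def by blast
      moreover have "set (concat as) \<subseteq> U" using concat_t[OF asP] by (simp add: tuples_def)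
      ultimately have "a \<in> p_closure M k C p (set (concat as))"
        using indep_iff[OF C _ at] qp[OF a] by (auto simp: p_closure_def)
      then show "a \<in> (\<Union>as\<in>fst ` P'. p_closure M k C p (\<Union>a\<in>set as. set a))"
        using asY(1) by force
    qed
  qed
qed

end

theorem theorem4p14:
  fixes M :: "('a, 'f, 'r) struct"
    and \<kappa> :: "'k rel"
    and C :: "'a set"
    and k n :: nat
    and p :: "(('f, 'r) fm \<times> 'a list) set"
  assumes "monster M \<kappa>"
    and "simple_theory M"
    and "C \<subseteq> univ M"
    and "|Pow (C <+> formulas M)| <o \<kappa>"
    and "p \<in> types M k C"
    and "regular_type M \<kappa> k C p"
  shows "(F_Mb M k C p \<le> enat n \<longleftrightarrow> weakly_degenerate M \<kappa> n k C p) \<and>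
    (weakly_degenerate M \<kappa> n k C p \<longleftrightarrow>
      (\<forall>D q. small M \<kappa> D \<and> forking_extension M k C p D q \<longrightarrow>
        (\<exists>F. finite F \<and> (\<forall>as\<in>F. length as = n \<and> set as \<subseteq> realizations M k p) \<and>
          realizations M k q \<subseteq> (\<Union>as\<in>F. p_closure M k C p (\<Union>a\<in>set as. set a)))))"
    (is "(?F \<longleftrightarrow> ?W) \<and> (?W \<longleftrightarrow> ?cover)")
proof -
  interpret simple_monster M \<kappa>
    using assms(1,2) by unfold_locales
  have "|C| \<le>o |C <+> formulas M|" by (rule card_of_Plus1)
  also have "|C <+> formulas M| <o |Pow (C <+> formulas M)|" by (rule card_of_Pow)
  finally have "|C| <o \<kappa>" using assms(4) ordLess_transitive by blast
  then have C: "small M \<kappa> C" using assms(3) by (simp add: small_def)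
  have "?F \<Longrightarrow> ?W" using F_Mb_imp_weakly_degenerate[OF assms(5) C] .
  moreover have "?W \<Longrightarrow> ?cover"
    using weakly_degenerate_imp_covering[OF assms(5,3,4) C] by (intro allI impI, elim conjE)
  moreover have "?cover \<Longrightarrow> ?F"
    by (rule covering_imp_F_Mb[OF assms(5) C assms(6)]) simp
  ultimately show ?thesis by argo
qed

end
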